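(* Let $k\ge 2$ and let $\Gamma$ be a finite generating set of $M_{k,1}$. The following two decision problems are decidable in deterministic polynomial time, when the inputs $\psi,\varphi\in M_{k,1}$ are given by tables or by words over $\Gamma$: (i) the $\le_{\mathcal J}$ decision problem: is $\psi\le_{\mathcal J}\varphi$ in $M_{k,1}$? (ii) the $\equiv_{\mathcal D}$ decision problem: is $\psi\equiv_{\mathcal D}\varphi$ in $M_{k,1}$?
   Context: Let $A=\{a_1,\dots,a_k\}$, $k\ge2$, and let $A^*$ be the set of all finite words over $A$ (including the empty word). A right ideal of $A^*$ is a subset $R$ with $RA^*=R$ (the empty set is allowed). A prefix code is a set of words none of which is a proper prefix of another. Two right ideals are essentially equal iff every right ideal that has non-empty intersection with one also has non-empty intersection with the other. A right ideal homomorphism is a total surjective function $\varphi:R_1\to R_2$ between finitely generated right ideals of $A^*$ with $\varphi(rx)=\varphi(r)x$ for all $r\in R_1$, $x\in A^*$. Two such homomorphisms are essentially equal iff their domains are essentially equal and they agree on the intersection of their domains. Every right ideal homomorphism $\varphi$ has a unique maximal essentially equal extension $\max(\varphi)$ to a right ideal homomorphism. $M_{k,1}$ is the monoid of all maximally extended right ideal homomorphisms, with product $\psi\varphi=\max(\psi\circ\varphi)$ ($\circ$ is composition of partial functions, $\varphi$ applied first). $M_{k,1}$ is finitely generated. A table is a surjective function $F:P\to Q$ between finite prefix codes $P,Q\subset A^*$, written as a finite list of pairs; it represents the element $\max(\varphi)$ of $M_{k,1}$, where $\varphi:PA^*\to QA^*$, $\varphi(pw)=F(p)w$. Every element of $M_{k,1}$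 is represented by a table. Green's relations in a monoid $M$: $u\le_{\mathcal J}v$ iff $u=xvy$ for some $x,y\in M$; $u\le_{\mathcal L}v$ iff $u=xv$ for some $x\in M$; $u\le_{\mathcal R}v$ iff $u=vx$ for some $x\in M$; $\equiv_{\mathcal L},\equiv_{\mathcal R}$ are the associated equivalences; $u\equiv_{\mathcal D}v$ iff there is $s\in M$ with $u\equiv_{\mathcal R}s\equiv_{\mathcal L}v$. *)

theory Defs
  imports
    Main
    "HOL-Library.Sublist"
    "HOL-Computational_Algebra.Polynomial"
    "HOL-Algebra.Group"
begin

section \<open>The Thompson-Higman monoid\<close>

text \<open>
  The alphabet of size \<open>k\<close> is \<open>{..<k}\<close>, the number \<open>i\<close> standing for the letter \<open>a\<^sub>i\<^sub>+\<^sub>1\<close>.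
\<close>

type_synonym word = "nat list"
type_synonym word_map = "word \<rightharpoonup> word"

definition words :: "nat \<Rightarrow> word set" where
  "words k = lists {..<k}"

definition ideal_of :: "nat \<Rightarrow> word set \<Rightarrow> word set" where
  "ideal_of k P = {p @ w | p w. p \<in> P \<and> w \<in> words k}"

definition right_ideal :: "nat \<Rightarrow> word set \<Rightarrow> bool" where
  "right_ideal k R \<longleftrightarrow> R \<subseteq> words k \<and> ideal_of k R = R"

definition fg_right_ideal :: "nat \<Rightarrow> word set \<Rightarrow> bool" where
  "fg_right_ideal k R \<longleftrightarrow> (\<exists>P. finite P \<and> P \<subseteq> words k \<and> R = ideal_of k P)"

definition prefix_code :: "word set \<Rightarrow> bool" where
  "prefix_code P \<longleftrightarrow> (\<forall>u\<in>P. \<forall>v\<in>P. \<not> strict_prefix u v)"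

definition ess_eq_ideal :: "nat \<Rightarrow> word set \<Rightarrow> word set \<Rightarrow> bool" where
  "ess_eq_ideal k R1 R2 \<longleftrightarrow>
     (\<forall>R. right_ideal k R \<longrightarrow> (R \<inter> R1 \<noteq> {} \<longleftrightarrow> R \<inter> R2 \<noteq> {}))"

text \<open>
  A homomorphism \<open>R1 \<rightarrow> R2\<close> is a partial map with domain \<open>R1\<close>; being total on \<open>R1\<close> and onto
  \<open>R2\<close>, it determines both.
\<close>

definition right_ideal_hom :: "nat \<Rightarrow> word_map \<Rightarrow> bool" where
  "right_ideal_hom k \<phi> \<longleftrightarrow>
     fg_right_ideal k (dom \<phi>) \<and> fg_right_ideal k (ran \<phi>) \<and>
     (\<forall>r\<in>dom \<phi>. \<forall>x\<in>words k. \<phi> (r @ x) = Some (the (\<phi> r) @ x))"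

definition ess_eq_hom :: "nat \<Rightarrow> word_map \<Rightarrow> word_map \<Rightarrow> bool" where
  "ess_eq_hom k \<phi> \<psi> \<longleftrightarrow>
     ess_eq_ideal k (dom \<phi>) (dom \<psi>) \<and> (\<forall>x\<in>dom \<phi> \<inter> dom \<psi>. \<phi> x = \<psi> x)"

definition ess_eq_extension :: "nat \<Rightarrow> word_map \<Rightarrow> word_map \<Rightarrow> bool" where
  "ess_eq_extension k \<phi> \<psi> \<longleftrightarrow> right_ideal_hom k \<psi> \<and> \<phi> \<subseteq>\<^sub>m \<psi> \<and> ess_eq_hom k \<phi> \<psi>"

definition max_ext :: "nat \<Rightarrow> word_map \<Rightarrow> word_map" where
  "max_ext k \<phi> = (THE \<psi>. ess_eq_extension k \<phi> \<psi> \<and>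
     (\<forall>\<chi>. ess_eq_extension k \<phi> \<chi> \<and> \<psi> \<subseteq>\<^sub>m \<chi> \<longrightarrow> \<chi> = \<psi>))"

definition thompson_higman :: "nat \<Rightarrow> word_map monoid" where
  "thompson_higman k =
     \<lparr> carrier = {\<phi>. right_ideal_hom k \<phi> \<and> max_ext k \<phi> = \<phi>},
       mult = (\<lambda>\<psi> \<phi>. max_ext k (\<psi> \<circ>\<^sub>m \<phi>)),
       one = Some |` words k \<rparr>"


section \<open>Monoids: generation and Green's relations\<close>

definition list_product :: "('a, 'b) monoid_scheme \<Rightarrow> 'a list \<Rightarrow> 'a" where
  "list_product G us = foldr (\<otimes>\<^bsub>G\<^esub>) us \<one>\<^bsub>G\<^esub>"

definition monoid_generating_set :: "('a, 'b) monoid_scheme \<Rightarrow> 'a set \<Rightarrow> bool" where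
  "monoid_generating_set G \<Gamma> \<longleftrightarrow>
     \<Gamma> \<subseteq> carrier G \<and> (\<forall>u\<in>carrier G. \<exists>us\<in>lists \<Gamma>. u = list_product G us)"

definition J_le :: "('a, 'b) monoid_scheme \<Rightarrow> 'a \<Rightarrow> 'a \<Rightarrow> bool" where
  "J_le G u v \<longleftrightarrow> (\<exists>x\<in>carrier G. \<exists>y\<in>carrier G. u = x \<otimes>\<^bsub>G\<^esub> v \<otimes>\<^bsub>G\<^esub> y)"

definition L_le :: "('a, 'b) monoid_scheme \<Rightarrow> 'a \<Rightarrow> 'a \<Rightarrow> bool" where
  "L_le G u v \<longleftrightarrow> (\<exists>x\<in>carrier G. u = x \<otimes>\<^bsub>G\<^esub> v)"

definition R_le :: "('a, 'b) monoid_scheme \<Rightarrow> 'a \<Rightarrow> 'a \<Rightarrow> bool" where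
  "R_le G u v \<longleftrightarrow> (\<exists>x\<in>carrier G. u = v \<otimes>\<^bsub>G\<^esub> x)"

definition L_equiv :: "('a, 'b) monoid_scheme \<Rightarrow> 'a \<Rightarrow> 'a \<Rightarrow> bool" where
  "L_equiv G u v \<longleftrightarrow> L_le G u v \<and> L_le G v u"

definition R_equiv :: "('a, 'b) monoid_scheme \<Rightarrow> 'a \<Rightarrow> 'a \<Rightarrow> bool" where
  "R_equiv G u v \<longleftrightarrow> R_le G u v \<and> R_le G v u"

definition D_equiv :: "('a, 'b) monoid_scheme \<Rightarrow> 'a \<Rightarrow> 'a \<Rightarrow> bool" where
  "D_equiv G u v \<longleftrightarrow> (\<exists>s\<in>carrier G. R_equiv G u s \<and> L_equiv G s v)"


section \<open>Deterministic polynomial time\<close>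

text \<open>
  Deterministic multi-tape Turing machines with two-way infinite tapes. The tape alphabet
  consists of the blank, the input symbols, and finitely many auxiliary symbols. A tape
  \<open>(l, a, r)\<close> has symbol \<open>a\<close> under the head, \<open>l\<close> to its left (nearest symbol first) and \<open>r\<close> to
  its right; cells beyond the two lists are blank.
\<close>

datatype 'i tape_symbol = Blank | Input 'i | Aux nat

datatype head_move = MoveLeft | Stay | MoveRight

type_synonym 'i tape = "'i tape_symbol list \<times> 'i tape_symbol \<times> 'i tape_symbol list"

record 'i turing_machine =
  num_tapes :: nat
  tape_alphabet :: "'i tape_symbol set"
  states :: "nat set"
  start_state :: nat
  accept_state :: nat
  reject_state :: nat
  transition ::
    "nat \<Rightarrow> 'i tape_symbol list \<Rightarrow> nat \<times> ('i tape_symbol \<times> head_move) list"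

definition turing_machine_over :: "'i set \<Rightarrow> 'i turing_machine \<Rightarrow> bool" where
  "turing_machine_over \<Sigma> M \<longleftrightarrow>
     num_tapes M \<ge> 1 \<and>
     finite (tape_alphabet M) \<and> Blank \<in> tape_alphabet M \<and> Input ` \<Sigma> \<subseteq> tape_alphabet M \<and>
     finite (states M) \<and> {start_state M, accept_state M, reject_state M} \<subseteq> states M \<and>
     accept_state M \<noteq> reject_state M \<and>
     (\<forall>q\<in>states M. \<forall>as\<in>lists (tape_alphabet M). length as = num_tapes M \<longrightarrow>
        (case transition M q as of (q', acts) \<Rightarrow>
           q' \<in> states M \<and> length acts = num_tapes M \<and>
           (\<forall>(b, d)\<in>set acts. b \<in> tape_alphabet M)))"

fun read_tape :: "'i tape \<Rightarrow> 'i tape_symbol" where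
  "read_tape (l, a, r) = a"

fun act_tape :: "'i tape_symbol \<times> head_move \<Rightarrow> 'i tape \<Rightarrow> 'i tape" where
  "act_tape (b, Stay) (l, a, r) = (l, b, r)"
| "act_tape (b, MoveLeft) ([], a, r) = ([], Blank, b # r)"
| "act_tape (b, MoveLeft) (c # l, a, r) = (l, c, b # r)"
| "act_tape (b, MoveRight) (l, a, []) = (b # l, Blank, [])"
| "act_tape (b, MoveRight) (l, a, c # r) = (b # l, c, r)"

fun initial_tape :: "'i list \<Rightarrow> 'i tape" where
  "initial_tape [] = ([], Blank, [])"
| "initial_tape (i # is) = ([], Input i, map Input is)"

definition initial_config :: "'i turing_machine \<Rightarrow> 'i list \<Rightarrow> nat \<times> 'i tape list" where
  "initial_config M w =
     (start_state M, initial_tape w # replicate (num_tapes M - 1) (initial_tape []))"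

text \<open>The accepting and rejecting configurations are halting, hence fixed by the step function.\<close>

definition step_config ::
    "'i turing_machine \<Rightarrow> nat \<times> 'i tape list \<Rightarrow> nat \<times> 'i tape list" where
  "step_config M = (\<lambda>(q, ts).
     if q \<in> {accept_state M, reject_state M} then (q, ts)
     else case transition M q (map read_tape ts) of
       (q', acts) \<Rightarrow> (q', map2 act_tape acts ts))"

definition decidable_in_ptime :: "'i set \<Rightarrow> 'i list set \<Rightarrow> bool" where
  "decidable_in_ptime \<Sigma> L \<longleftrightarrow>
     finite \<Sigma> \<and> L \<subseteq> lists \<Sigma> \<and>
     (\<exists>M (p :: nat poly). turing_machine_over \<Sigma> M \<and>
        (\<forall>w\<in>lists \<Sigma>. \<exists>t \<le> poly p (length w).
           fst ((step_config M ^^ t) (initial_config M w)) =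
             (if w \<in> L then accept_state M else reject_state M)))"


section \<open>Inputs\<close>

text \<open>
  A finite generating set is enumerated by \<open>\<gamma>\<close>, whose first \<open>m\<close> values are the generators; a
  word over the generators is the list of their indices.
\<close>

datatype monoid_input = Table "(word \<times> word) list" | Gen_Word "nat list"

definition is_table :: "nat \<Rightarrow> (word \<times> word) list \<Rightarrow> bool" where
  "is_table k T \<longleftrightarrow>
     fst ` set T \<subseteq> words k \<and> snd ` set T \<subseteq> words k \<and> distinct (map fst T) \<and>
     prefix_code (fst ` set T) \<and> prefix_code (snd ` set T)"

definition table_hom :: "nat \<Rightarrow> (word \<times> word) list \<Rightarrow> word_map" where
  "table_hom k T x =
     (if x \<in> ideal_of k (fst ` set T)
      then let p = (THE p. p \<in> fst ` set T \<and> prefix p x)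
           in Some (the (map_of T p) @ drop (length p) x)
      else None)"

fun valid_input :: "nat \<Rightarrow> nat \<Rightarrow> monoid_input \<Rightarrow> bool" where
  "valid_input k m (Table T) = is_table k T"
| "valid_input k m (Gen_Word v) = (v \<in> lists {..<m})"

fun input_value :: "nat \<Rightarrow> (nat \<Rightarrow> word_map) \<Rightarrow> monoid_input \<Rightarrow> word_map" where
  "input_value k \<gamma> (Table T) = max_ext k (table_hom k T)"
| "input_value k \<gamma> (Gen_Word v) = list_product (thompson_higman k) (map \<gamma> v)"

datatype input_symbol = Table_Mark | Word_Mark | Arg_Mark | Val_Mark | Letter nat | Generator nat

definition input_symbols :: "nat \<Rightarrow> nat \<Rightarrow> input_symbol set" where
  "input_symbols k m =
     {Table_Mark, Word_Mark, Arg_Mark, Val_Mark} \<union> Letter ` {..<k} \<union> Generator ` {..<m}"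

fun encode_input :: "monoid_input \<Rightarrow> input_symbol list" where
  "encode_input (Table T) =
     Table_Mark # concat (map (\<lambda>(p, q). Arg_Mark # map Letter p @ Val_Mark # map Letter q) T)"
| "encode_input (Gen_Word v) = Word_Mark # map Generator v"

definition relation_problem ::
    "nat \<Rightarrow> nat \<Rightarrow> (nat \<Rightarrow> word_map) \<Rightarrow> (word_map \<Rightarrow> word_map \<Rightarrow> bool) \<Rightarrow> input_symbol list set" where
  "relation_problem k m \<gamma> rel =
     {encode_input \<psi> @ encode_input \<phi> | \<psi> \<phi>. valid_input k m \<psi> \<and> valid_input k m \<phi> \<and>
        rel (input_value k \<gamma> \<psi>) (input_value k \<gamma> \<phi>)}"

text \<open>The encoding of pairs of inputs is unambiguous.\<close>

lemma map_marker_append_eq: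
  assumes "map f v @ r = map f v' @ r'" "inj f"
    and "r = [] \<or> hd r \<notin> range f" "r' = [] \<or> hd r' \<notin> range f"
  shows "v = v' \<and> r = r'"
  using assms(1)
proof (induction v arbitrary: v')
  case Nil
  then show ?case using assms(3,4) by (cases v') auto
next
  case (Cons a v)
  show ?case
  proof (cases v')
    case Nil
    then show ?thesis using Cons.prems assms(4) by auto
  next
    case (Cons b u)
    then show ?thesis using Cons.prems Cons.IH[of u] assms(2) by (auto dest: injD)
  qed
qed

lemma encode_table_append_eq:
  fixes T T' :: "(word \<times> word) list"
  defines "e \<equiv> \<lambda>(p, q). Arg_Mark # map Letter p @ Val_Mark # map Letter q"
  assumes "concat (map e T) @ r = concat (map e T') @ r'"
    and "r = [] \<or> hd r \<in> {Table_Mark, Word_Mark}" "r' = [] \<or> hd r' \<in> {Table_Mark, Word_Mark}"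
  shows "T = T' \<and> r = r'"
  using assms(2)
proof (induction T arbitrary: T')
  case Nil
  then show ?case using assms(3) by (cases T') (auto simp: e_def)
next
  case (Cons a T)
  obtain p q where a: "a = (p, q)" by force
  show ?case
  proof (cases T')
    case Nil
    then show ?thesis using Cons.prems assms(4) by (auto simp: e_def a)
  next
    case (Cons b U)
    obtain p' q' where b: "b = (p', q')" by force
    have inj: "inj Letter" by (simp add: inj_def)
    have hd: "concat (map e V) @ s = [] \<or> hd (concat (map e V) @ s) \<notin> range Letter"
      if "s = [] \<or> hd s \<in> {Table_Mark, Word_Mark}" for V s
      using that by (cases V) (auto simp: e_def)
    have eq: "map Letter p @ (Val_Mark # map Letter q @ concat (map e T) @ r) =
              map Letter p' @ (Val_Mark # map Letter q' @ concat (map e U) @ r')"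
      using Cons.prems by (simp add: e_def a b \<open>T' = b # U\<close>)
    have 1: "p = p' \<and> Val_Mark # map Letter q @ concat (map e T) @ r =
              Val_Mark # map Letter q' @ concat (map e U) @ r'"
      by (rule map_marker_append_eq[OF eq inj]) auto
    then have 2: "map Letter q @ (concat (map e T) @ r) = map Letter q' @ (concat (map e U) @ r')"
      by simp
    have 3: "q = q' \<and> concat (map e T) @ r = concat (map e U) @ r'"
      by (rule map_marker_append_eq[OF 2 inj hd[OF assms(3)] hd[OF assms(4)]])
    then show ?thesis using 1 Cons.IH[of U] by (simp add: a b \<open>T' = b # U\<close>)
  qed
qed

lemma encode_input_pair_inject:
  assumes "encode_input i @ encode_input j = encode_input i' @ encode_input j'"
  shows "i = i' \<and> j = j'"
proof -
  have hd: "encode_input x = [] \<or> hd (encode_input x) \<in> {Table_Mark, Word_Mark}" for x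
    by (cases x) auto
  have gen: "inj Generator" by (simp add: inj_def)
  have step: "x = x' \<and> r = r'"
    if "encode_input x @ r = encode_input x' @ r'" "r = [] \<or> hd r \<in> {Table_Mark, Word_Mark}"
      "r' = [] \<or> hd r' \<in> {Table_Mark, Word_Mark}" for x x' r r'
  proof (cases x)
    case (Table T)
    with that(1) obtain T' where "x' = Table T'" by (cases x') auto
    then show ?thesis using that Table encode_table_append_eq[of T r T' r'] by simp
  next
    case (Gen_Word v)
    with that(1) obtain v' where "x' = Gen_Word v'" by (cases x') auto
    moreover have "r = [] \<or> hd r \<notin> range Generator" "r' = [] \<or> hd r' \<notin> range Generator"
      using that(2,3) by auto
    ultimately show ?thesis
      using that(1) Gen_Word map_marker_append_eq[OF _ gen, of v r v' r'] by simp
  qed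
  have 1: "i = i' \<and> encode_input j = encode_input j'"
    by (rule step[OF assms hd hd])
  have "j = j'" using step[of j "[]" j' "[]"] 1 by simp
  with 1 show ?thesis by simp
qed

end

theory Submission
  imports Defs "HOL-Library.Countable"
begin

text \<open>
  A nonzero homomorphism \<open>\<phi>\<close> with \<open>\<phi> p = q\<close> satisfies \<open>1 \<le>\<^sub>J \<phi>\<close> (prepend \<open>p\<close>, apply \<open>\<phi>\<close>, strip \<open>q\<close>), so
  \<open>\<psi> \<le>\<^sub>J \<phi>\<close> fails only for \<open>\<phi> = 0 \<noteq> \<psi>\<close>. Two elements are R-equivalent iff their images are essentially
  equal, and L-equivalence preserves the size of the image code modulo \<open>k - 1\<close>; conversely image codes
  congruent modulo \<open>k - 1\<close> can be expanded to the same size, and a bijection between them links the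
  elements. So both relations depend only on the class of the image: zero, or the size of its prefix
  code modulo \<open>k - 1\<close>.

  For a word over the generators the domain code may have exponential size, but generators of the image
  do not: each factor contributes at most a constant number of new words and lengthens the old ones by
  a constant. They are obtained by applying the factors one at a time, in one pass over the list of
  words per factor. The minimal words of the final list are then counted modulo \<open>k - 1\<close> by
  comparing each word with all later ones in parallel, one letter per pass. All passes are finite-state
  transductions, and a polynomial number of them suffices.
\<close>

section \<open>Right ideals\<close>

text \<open>Maximal extensions are never computed. All arguments use essential equality
  \<open>hom_equiv\<close>, an equivalence relation respected by composition, and
  \<open>ideal_class\<close> is invariant under it. Hence any finitely generated ideal essentially
  equal to the image may stand for it, and domains need not be followed when a product is evaluated.
  The class takes only finitely many values, so it fits into the finite control: that of the first
  input is kept there while the second is read. Both problems are decided by one procedure; only the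
  final test \<open>verdict\<close> on the two classes differs. Polynomial time has to be shown for
  an explicit Turing machine. Programming is reduced to a single loop, in which a finite-state
  transducer rewrites the whole string until it reaches a verdict; bounds on the string lengths and
  on the number of passes give the running time. Strings that are not encodings must be rejected
  too, so parsing and the validity of tables belong to the task.\<close>

lemma append_in_words [simp]: "x @ y \<in> words k \<longleftrightarrow> x \<in> words k \<and> y \<in> words k"
  by (auto simp: words_def)

lemma Nil_in_words [simp]: "[] \<in> words k"
  by (simp add: words_def)

lemma finite_words_length: "finite {x \<in> words k. length x \<le> N}"
proof (rule finite_subset)
  show "{x \<in> words k. length x \<le> N} \<subseteq> {xs. set xs \<subseteq> {..<k} \<and> length xs \<le> N}"
    by (auto simp: words_def)
qed (rule finite_lists_length_le, simp)

lemma right_ideal_append: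
  assumes "right_ideal k R" "x \<in> R" "w \<in> words k"
  shows "x @ w \<in> R"
  using assms unfolding right_ideal_def ideal_of_def by blast

lemma right_ideal_subset_words: "right_ideal k R \<Longrightarrow> R \<subseteq> words k"
  by (simp add: right_ideal_def)

lemma right_idealI:
  assumes "R \<subseteq> words k" "\<And>x w. x \<in> R \<Longrightarrow> w \<in> words k \<Longrightarrow> x @ w \<in> R"
  shows "right_ideal k R"
proof -
  have "x \<in> ideal_of k R" if "x \<in> R" for x
    using that append_Nil2[of x] Nil_in_words[of k] unfolding ideal_of_def by (metis (mono_tags, lifting) mem_Collect_eq)
  then show ?thesis using assms unfolding right_ideal_def ideal_of_def by auto
qed

lemma right_ideal_ideal_of: "P \<subseteq> words k \<Longrightarrow> right_ideal k (ideal_of k P)"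
  by (rule right_idealI) (auto simp: ideal_of_def, metis append_assoc append_in_words)

lemma subset_ideal_of: "P \<subseteq> ideal_of k P"
  unfolding ideal_of_def by (force intro: exI[of _ "[]"])

lemma fg_right_ideal_imp: "fg_right_ideal k R \<Longrightarrow> right_ideal k R"
  by (auto simp: fg_right_ideal_def right_ideal_ideal_of)

text \<open>Only finitely many words have length at most \<open>N\<close>, so a length bound can
  replace an explicit generating set. For composites and saturations such a bound is easier to find
  than generators.\<close>

lemma fg_right_idealI:
  assumes R: "right_ideal k R"
    and N: "\<And>x. x \<in> R \<Longrightarrow> \<exists>v\<in>R. prefix v x \<and> length v \<le> N"
  shows "fg_right_ideal k R"
proof -
  let ?P = "{x \<in> R. length x \<le> N}"
  have "R = ideal_of k ?P"
  proof
    show "R \<subseteq> ideal_of k ?P"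
    proof
      fix x
      assume x: "x \<in> R"
      then obtain v w where v: "v \<in> ?P" "x = v @ w" using N unfolding prefix_def by blast
      have "v @ w \<in> words k" using x v(2) right_ideal_subset_words[OF R] by blast
      then show "x \<in> ideal_of k ?P" using v unfolding ideal_of_def by auto
    qed
    show "ideal_of k ?P \<subseteq> R"
      using right_ideal_append[OF R] unfolding ideal_of_def by auto
  qed
  moreover have "finite ?P" "?P \<subseteq> words k"
    using right_ideal_subset_words[OF R] by (auto intro: finite_subset[OF _ finite_words_length])
  ultimately show ?thesis unfolding fg_right_ideal_def by blast
qed

lemma fg_right_ideal_bound:
  assumes "fg_right_ideal k R"
  obtains N where "\<And>x. x \<in> R \<Longrightarrow> \<exists>v\<in>R. prefix v x \<and> length v \<le> N"
proof -
  obtain P where P: "finite P" "R = ideal_of k P" using assms by (auto simp: fg_right_ideal_def)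
  have "\<exists>v\<in>R. prefix v x \<and> length v \<le> Max (length ` P)" if x: "x \<in> R" for x
  proof -
    obtain p w where "p \<in> P" "x = p @ w" using x P(2) unfolding ideal_of_def by blast
    then show ?thesis using P subset_ideal_of[of P k]
      by (intro bexI[of _ p]) auto
  qed
  then show ?thesis using that by blast
qed

text \<open>One half of essential equality, in elementwise form. The one-sided version matters on
  its own: it describes \<open>R_le\<close>.\<close>

definition dense_in :: "nat \<Rightarrow> word set \<Rightarrow> word set \<Rightarrow> bool" where
  "dense_in k R1 R2 \<longleftrightarrow> (\<forall>x\<in>R1. \<exists>w\<in>words k. x @ w \<in> R2)"

lemma dense_inD: "dense_in k R1 R2 \<Longrightarrow> x \<in> R1 \<Longrightarrow> \<exists>w\<in>words k. x @ w \<in> R2"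
  by (simp add: dense_in_def)

lemma dense_in_subset: "R1 \<subseteq> R2 \<Longrightarrow> dense_in k R1 R2"
  unfolding dense_in_def by (metis Nil_in_words append_Nil2 subsetD)

lemma dense_in_trans:
  assumes "dense_in k R1 R2" "dense_in k R2 R3"
  shows "dense_in k R1 R3"
  unfolding dense_in_def
proof
  fix x
  assume "x \<in> R1"
  then obtain w where w: "w \<in> words k" "x @ w \<in> R2" using assms(1) by (auto simp: dense_in_def)
  then obtain v where "v \<in> words k" "x @ w @ v \<in> R3" using assms(2) by (auto simp: dense_in_def)
  with w show "\<exists>w\<in>words k. x @ w \<in> R3" by (intro bexI[of _ "w @ v"]) auto
qed

text \<open>Principal ideals \<open>ideal_of k {x}\<close> are enough as test ideals in one
  direction. In the other, a word shared with the first ideal is extended into the second, and the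
  test ideal absorbs the extension.\<close>

lemma ess_eq_ideal_iff:
  assumes "right_ideal k R1" "right_ideal k R2"
  shows "ess_eq_ideal k R1 R2 \<longleftrightarrow> dense_in k R1 R2 \<and> dense_in k R2 R1"
proof -
  have 1: "dense_in k A B"
    if "right_ideal k A" "\<And>R. right_ideal k R \<Longrightarrow> R \<inter> A \<noteq> {} \<Longrightarrow> R \<inter> B \<noteq> {}" for A B
    unfolding dense_in_def
  proof
    fix x
    assume x: "x \<in> A"
    have "right_ideal k (ideal_of k {x})"
      using x right_ideal_subset_words[OF that(1)] by (intro right_ideal_ideal_of) auto
    moreover have "ideal_of k {x} \<inter> A \<noteq> {}" using x subset_ideal_of[of "{x}" k] by auto
    ultimately have "ideal_of k {x} \<inter> B \<noteq> {}" using that(2) by blast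
    then show "\<exists>w\<in>words k. x @ w \<in> B" by (auto simp: ideal_of_def)
  qed
  have 2: "R \<inter> B \<noteq> {}" if "right_ideal k R" "dense_in k A B" "R \<inter> A \<noteq> {}" for A B R
    using that right_ideal_append unfolding dense_in_def by blast
  show ?thesis
  proof (intro iffI conjI)
    assume e: "ess_eq_ideal k R1 R2"
    show "dense_in k R1 R2" by (rule 1[OF assms(1)]) (use e in \<open>simp add: ess_eq_ideal_def\<close>)
    show "dense_in k R2 R1" by (rule 1[OF assms(2)]) (use e in \<open>simp add: ess_eq_ideal_def\<close>)
  next
    assume "dense_in k R1 R2 \<and> dense_in k R2 R1"
    then show "ess_eq_ideal k R1 R2" unfolding ess_eq_ideal_def using 2 by meson
  qed
qed

section \<open>Homomorphisms and their maximal extensions\<close>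

lemma homD:
  assumes "right_ideal_hom k \<phi>"
  shows "fg_right_ideal k (dom \<phi>)" "fg_right_ideal k (ran \<phi>)"
    "right_ideal k (dom \<phi>)" "right_ideal k (ran \<phi>)"
    "\<And>x y w. \<phi> x = Some y \<Longrightarrow> w \<in> words k \<Longrightarrow> \<phi> (x @ w) = Some (y @ w)"
    "\<And>x y. \<phi> x = Some y \<Longrightarrow> x \<in> words k" "\<And>x y. \<phi> x = Some y \<Longrightarrow> y \<in> words k"
proof -
  show fg: "fg_right_ideal k (dom \<phi>)" "fg_right_ideal k (ran \<phi>)"
    using assms by (auto simp: right_ideal_hom_def)
  show ri: "right_ideal k (dom \<phi>)" "right_ideal k (ran \<phi>)"
    using fg fg_right_ideal_imp by auto
  show "\<phi> (x @ w) = Some (y @ w)" if "\<phi> x = Some y" "w \<in> words k" for x y w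
  proof -
    have "x \<in> dom \<phi>" using that by auto
    then show ?thesis using assms that unfolding right_ideal_hom_def by simp
  qed
  show "x \<in> words k" "y \<in> words k" if "\<phi> x = Some y" for x y
    using that ri right_ideal_subset_words by (blast intro: ranI)+
qed

lemma ran_generated:
  assumes app: "\<And>x y w. \<phi> x = Some y \<Longrightarrow> w \<in> words k \<Longrightarrow> \<phi> (x @ w) = Some (y @ w)"
    and P: "dom \<phi> = ideal_of k P"
  shows "ran \<phi> = ideal_of k ((\<lambda>p. the (\<phi> p)) ` P)"
proof
  have some: "\<exists>y. \<phi> p = Some y" if "p \<in> P" for p
    using that P subset_ideal_of[of P k] by blast
  show "ran \<phi> \<subseteq> ideal_of k ((\<lambda>p. the (\<phi> p)) ` P)"
  proof
    fix z
    assume "z \<in> ran \<phi>"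
    then obtain x where x: "\<phi> x = Some z" by (auto simp: ran_def)
    then have "x \<in> ideal_of k P" using P by auto
    then obtain p w where pw: "p \<in> P" "w \<in> words k" "x = p @ w" by (auto simp: ideal_of_def)
    then obtain y where y: "\<phi> p = Some y" using some by blast
    then have "z = the (\<phi> p) @ w" using app[OF y pw(2)] x pw(3) by simp
    then show "z \<in> ideal_of k ((\<lambda>p. the (\<phi> p)) ` P)" using pw by (auto simp: ideal_of_def)
  qed
  show "ideal_of k ((\<lambda>p. the (\<phi> p)) ` P) \<subseteq> ran \<phi>"
  proof
    fix z
    assume "z \<in> ideal_of k ((\<lambda>p. the (\<phi> p)) ` P)"
    then obtain p w where pw: "p \<in> P" "w \<in> words k" "z = the (\<phi> p) @ w" by (auto simp: ideal_of_def)
    then obtain y where y: "\<phi> p = Some y" using some by blast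
    show "z \<in> ran \<phi>" using app[OF y pw(2)] y pw(3) by (auto simp: ran_def)
  qed
qed

text \<open>The range is finitely generated by the images of generators of the domain, so finiteness
  has to be checked for the domain only.\<close>

lemma homI:
  assumes fg: "fg_right_ideal k (dom \<phi>)"
    and val: "\<And>x y. \<phi> x = Some y \<Longrightarrow> y \<in> words k"
    and app: "\<And>x y w. \<phi> x = Some y \<Longrightarrow> w \<in> words k \<Longrightarrow> \<phi> (x @ w) = Some (y @ w)"
  shows "right_ideal_hom k \<phi>"
proof -
  obtain P where P: "finite P" "dom \<phi> = ideal_of k P" using fg by (auto simp: fg_right_ideal_def)
  have "(\<lambda>p. the (\<phi> p)) ` P \<subseteq> words k"
  proof
    fix z
    assume "z \<in> (\<lambda>p. the (\<phi> p)) ` P"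
    then obtain p where p: "p \<in> P" "z = the (\<phi> p)" by auto
    then have "p \<in> dom \<phi>" using P subset_ideal_of[of P k] by auto
    then show "z \<in> words k" using p val by auto
  qed
  then have "fg_right_ideal k (ran \<phi>)"
    unfolding fg_right_ideal_def
    using ran_generated[OF app P(2)] P(1) by blast
  then show ?thesis using fg app unfolding right_ideal_hom_def by auto
qed

lemma dom_map_comp_iff: "x \<in> dom (\<psi> \<circ>\<^sub>m \<phi>) \<longleftrightarrow> (\<exists>y. \<phi> x = Some y \<and> y \<in> dom \<psi>)"
  by (auto simp: map_comp_def split: option.splits)

lemma hom_comp:
  assumes \<psi>: "right_ideal_hom k \<psi>" and \<phi>: "right_ideal_hom k \<phi>"
  shows "right_ideal_hom k (\<psi> \<circ>\<^sub>m \<phi>)"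
proof (rule homI)
  have app: "(\<psi> \<circ>\<^sub>m \<phi>) (x @ w) = Some (y @ w)"
    if c: "(\<psi> \<circ>\<^sub>m \<phi>) x = Some y" "w \<in> words k" for x y w
  proof -
    obtain z where z: "\<phi> x = Some z" "\<psi> z = Some y" using c(1) by (auto simp: map_comp_Some_iff)
    show ?thesis using homD(5)[OF \<phi> z(1) c(2)] homD(5)[OF \<psi> z(2) c(2)] by simp
  qed
  then show "\<And>x y w. (\<psi> \<circ>\<^sub>m \<phi>) x = Some y \<Longrightarrow> w \<in> words k \<Longrightarrow> (\<psi> \<circ>\<^sub>m \<phi>) (x @ w) = Some (y @ w)" .
  show "\<And>x y. (\<psi> \<circ>\<^sub>m \<phi>) x = Some y \<Longrightarrow> y \<in> words k"
    unfolding map_comp_Some_iff using homD(7)[OF \<psi>] by blast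
  obtain M where M: "\<And>x. x \<in> dom \<phi> \<Longrightarrow> \<exists>v\<in>dom \<phi>. prefix v x \<and> length v \<le> M"
    using fg_right_ideal_bound[OF homD(1)[OF \<phi>]] by blast
  obtain N where N: "\<And>x. x \<in> dom \<psi> \<Longrightarrow> \<exists>v\<in>dom \<psi>. prefix v x \<and> length v \<le> N"
    using fg_right_ideal_bound[OF homD(1)[OF \<psi>]] by blast
  show "fg_right_ideal k (dom (\<psi> \<circ>\<^sub>m \<phi>))"
  proof (rule fg_right_idealI[where N = "M + N"])
    show "right_ideal k (dom (\<psi> \<circ>\<^sub>m \<phi>))"
    proof (rule right_idealI)
      show "dom (\<psi> \<circ>\<^sub>m \<phi>) \<subseteq> words k"
        using homD(6)[OF \<phi>] unfolding subset_iff dom_map_comp_iff by blast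
      show "x @ w \<in> dom (\<psi> \<circ>\<^sub>m \<phi>)" if "x \<in> dom (\<psi> \<circ>\<^sub>m \<phi>)" "w \<in> words k" for x w
        using app[of x _ w] that by (metis domD domI)
    qed
    fix x
    assume "x \<in> dom (\<psi> \<circ>\<^sub>m \<phi>)"
    then obtain z where z: "\<phi> x = Some z" "z \<in> dom \<psi>" by (auto simp: dom_map_comp_iff)
    then obtain p w where p: "p \<in> dom \<phi>" "x = p @ w" "length p \<le> M"
      using M[of x] by (auto simp: prefix_def)
    then obtain y where y: "\<phi> p = Some y" by auto
    have w: "w \<in> words k" using homD(6)[OF \<phi> z(1)] p(2) by simp
    have zy: "z = y @ w" using homD(5)[OF \<phi> y w] z(1) p(2) by simp
    obtain q v where q: "q \<in> dom \<psi>" "z = q @ v" "length q \<le> N"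
      using N[OF z(2)] by (auto simp: prefix_def)
    show "\<exists>v\<in>dom (\<psi> \<circ>\<^sub>m \<phi>). prefix v x \<and> length v \<le> M + N"
    \<comment> \<open>Both \<open>y\<close> and \<open>q\<close> are prefixes of \<open>z\<close>,
      hence comparable. If \<open>q\<close> is the shorter one, \<open>p\<close> itself lies in the
      domain of the composite; otherwise \<open>p\<close> is lengthened by the part of
      \<open>q\<close> beyond \<open>y\<close>, which costs at most \<open>N\<close>
      letters.\<close>
    proof (cases "length q \<le> length y")
      case True
      then obtain u where u: "y = q @ u" using zy q(2) by (metis prefixE prefix_length_prefix prefixI)
      have "y \<in> words k" using homD(7)[OF \<phi> y] .
      then have "y \<in> dom \<psi>"
        using u right_ideal_append[OF homD(3)[OF \<psi>] q(1)] by simp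
      then have "p \<in> dom (\<psi> \<circ>\<^sub>m \<phi>)" using y by (auto simp: dom_map_comp_iff)
      then show ?thesis using p by (intro bexI[of _ p]) auto
    next
      case False
      then obtain u where u: "q = y @ u" using zy q(2)
        by (metis nle_le prefixE prefix_length_prefix prefixI)
      then have wu: "w = u @ v" using zy q(2) by simp
      then have "\<phi> (p @ u) = Some (y @ u)" using homD(5)[OF \<phi> y] w by simp
      then have "p @ u \<in> dom (\<psi> \<circ>\<^sub>m \<phi>)" using q(1) u by (auto simp: dom_map_comp_iff)
      then show ?thesis using p q u wu by (intro bexI[of _ "p @ u"]) auto
    qed
  qed
qed

section \<open>Essential equality of homomorphisms and its compatibility with composition\<close>

definition hom_equiv :: "nat \<Rightarrow> word_map \<Rightarrow> word_map \<Rightarrow> bool" where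
  "hom_equiv k \<phi> \<psi> \<longleftrightarrow> right_ideal_hom k \<phi> \<and> right_ideal_hom k \<psi> \<and> ess_eq_hom k \<phi> \<psi>"

lemma hom_equiv_iff:
  "hom_equiv k \<phi> \<psi> \<longleftrightarrow> right_ideal_hom k \<phi> \<and> right_ideal_hom k \<psi> \<and>
     dense_in k (dom \<phi>) (dom \<psi>) \<and> dense_in k (dom \<psi>) (dom \<phi>) \<and>
     (\<forall>x y z. \<phi> x = Some y \<longrightarrow> \<psi> x = Some z \<longrightarrow> y = z)"
proof -
  have "(\<forall>x\<in>dom \<phi> \<inter> dom \<psi>. \<phi> x = \<psi> x) \<longleftrightarrow> (\<forall>x y z. \<phi> x = Some y \<longrightarrow> \<psi> x = Some z \<longrightarrow> y = z)"
  proof (intro iffI allI impI ballI)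
    fix x
    assume a: "\<forall>x y z. \<phi> x = Some y \<longrightarrow> \<psi> x = Some z \<longrightarrow> y = z" and x: "x \<in> dom \<phi> \<inter> dom \<psi>"
    then obtain y z where "\<phi> x = Some y" "\<psi> x = Some z" by blast
    moreover from this have "y = z" using a by blast
    ultimately show "\<phi> x = \<psi> x" by simp
  next
    fix x y z
    assume a: "\<forall>x\<in>dom \<phi> \<inter> dom \<psi>. \<phi> x = \<psi> x" and x: "\<phi> x = Some y" "\<psi> x = Some z"
    then have "\<phi> x = \<psi> x" by blast
    then show "y = z" using x by simp
  qed
  then have e: "ess_eq_hom k \<phi> \<psi> \<longleftrightarrow> ess_eq_ideal k (dom \<phi>) (dom \<psi>) \<and>
      (\<forall>x y z. \<phi> x = Some y \<longrightarrow> \<psi> x = Some z \<longrightarrow> y = z)"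
    unfolding ess_eq_hom_def by (rule arg_cong)
  show ?thesis
  proof (cases "right_ideal_hom k \<phi> \<and> right_ideal_hom k \<psi>")
    case True
    then show ?thesis
      unfolding hom_equiv_def e using ess_eq_ideal_iff[OF homD(3) homD(3), of k \<phi> \<psi>] by metis
  qed (unfold hom_equiv_def, metis)
qed

lemma hom_equiv_refl: "right_ideal_hom k \<phi> \<Longrightarrow> hom_equiv k \<phi> \<phi>"
  by (auto simp: hom_equiv_iff dense_in_subset)

lemma hom_equiv_sym: "hom_equiv k \<phi> \<psi> \<Longrightarrow> hom_equiv k \<psi> \<phi>"
  by (auto simp: hom_equiv_iff)

text \<open>The middle map may be undefined at a point where the outer two are defined. Such a point
  is extended into its domain, the values are compared there, and the common suffix is
  cancelled.\<close>

lemma hom_equiv_trans: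
  assumes "hom_equiv k \<phi> \<psi>" "hom_equiv k \<psi> \<chi>"
  shows "hom_equiv k \<phi> \<chi>"
  unfolding hom_equiv_iff
proof (intro conjI allI impI)
  have hom: "right_ideal_hom k \<phi>" "right_ideal_hom k \<psi>" "right_ideal_hom k \<chi>"
    using assms by (auto simp: hom_equiv_iff)
  fix x y z
  assume xy: "\<phi> x = Some y" "\<chi> x = Some z"
  then obtain w where w: "w \<in> words k" "x @ w \<in> dom \<psi>"
    using assms(1) unfolding hom_equiv_iff dense_in_def by blast
  then obtain u where "\<psi> (x @ w) = Some u" by auto
  moreover have "\<phi> (x @ w) = Some (y @ w)" "\<chi> (x @ w) = Some (z @ w)"
    using xy w homD(5)[OF hom(1)] homD(5)[OF hom(3)] by auto
  ultimately have "y @ w = u" "u = z @ w" using assms unfolding hom_equiv_iff by blast+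
  then show "y = z" by simp
qed (use assms dense_in_trans in \<open>auto simp: hom_equiv_iff\<close>)

text \<open>Density needs two extensions: one that brings the argument into the domain of the other
  inner map, and one that brings its value into the domain of the other outer map.\<close>

lemma hom_equiv_comp:
  assumes "hom_equiv k \<psi> \<psi>'" "hom_equiv k \<phi> \<phi>'"
  shows "hom_equiv k (\<psi> \<circ>\<^sub>m \<phi>) (\<psi>' \<circ>\<^sub>m \<phi>')"
proof -
  have dense: "dense_in k (dom (\<psi> \<circ>\<^sub>m \<phi>)) (dom (\<psi>' \<circ>\<^sub>m \<phi>'))"
    if e: "hom_equiv k \<psi> \<psi>'" "hom_equiv k \<phi> \<phi>'" for \<psi> \<psi>' \<phi> \<phi>'
    unfolding dense_in_def
  proof
    have hom: "right_ideal_hom k \<psi>" "right_ideal_hom k \<psi>'" "right_ideal_hom k \<phi>" "right_ideal_hom k \<phi>'"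
      using e by (auto simp: hom_equiv_iff)
    fix x
    assume "x \<in> dom (\<psi> \<circ>\<^sub>m \<phi>)"
    then obtain y where y: "\<phi> x = Some y" "y \<in> dom \<psi>" by (auto simp: dom_map_comp_iff)
    obtain w where w: "w \<in> words k" "x @ w \<in> dom \<phi>'"
      using y e(2) unfolding hom_equiv_iff dense_in_def by blast
    then obtain z where z: "\<phi>' (x @ w) = Some z" by auto
    have xw: "\<phi> (x @ w) = Some (y @ w)" using homD(5)[OF hom(3) y(1) w(1)] .
    then have z': "z = y @ w" using z e(2) unfolding hom_equiv_iff by blast
    have "y @ w \<in> dom \<psi>" using right_ideal_append[OF homD(3)[OF hom(1)] y(2) w(1)] .
    then obtain v where v: "v \<in> words k" "y @ w @ v \<in> dom \<psi>'"
      using e(1) unfolding hom_equiv_iff dense_in_def by (metis append_assoc)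
    then have "\<phi>' (x @ w @ v) = Some (y @ w @ v)" using homD(5)[OF hom(4) z v(1)] z' by simp
    then have "x @ w @ v \<in> dom (\<psi>' \<circ>\<^sub>m \<phi>')" using v by (auto simp: dom_map_comp_iff)
    then show "\<exists>w\<in>words k. x @ w \<in> dom (\<psi>' \<circ>\<^sub>m \<phi>')" using w v by (intro bexI[of _ "w @ v"]) auto
  qed
  have "y = z" if c: "(\<psi> \<circ>\<^sub>m \<phi>) x = Some y" "(\<psi>' \<circ>\<^sub>m \<phi>') x = Some z" for x y z
  proof -
    obtain u u' where "\<phi> x = Some u" "\<psi> u = Some y" "\<phi>' x = Some u'" "\<psi>' u' = Some z"
      using c by (auto simp: map_comp_Some_iff)
    then show ?thesis using assms unfolding hom_equiv_iff by blast
  qed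
  then show ?thesis
    using dense[OF assms] dense[OF assms[THEN hom_equiv_sym]] assms hom_comp
    unfolding hom_equiv_iff by auto
qed

text \<open>\<open>x\<close> belongs to the domain of the maximal extension iff \<open>dom \<phi>\<close> is essential in \<open>xA\<^sup>*\<close> and
  \<open>\<phi>\<close> acts on the common part as the prefix replacement \<open>x \<mapsto> y\<close>.\<close>

definition extends_at :: "nat \<Rightarrow> word_map \<Rightarrow> word \<Rightarrow> word \<Rightarrow> bool" where
  "extends_at k \<phi> x y \<longleftrightarrow> x \<in> words k \<and> y \<in> words k \<and>
     (\<forall>v\<in>words k. \<exists>w\<in>words k. x @ v @ w \<in> dom \<phi>) \<and>
     (\<forall>w\<in>words k. x @ w \<in> dom \<phi> \<longrightarrow> \<phi> (x @ w) = Some (y @ w))"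

definition saturation :: "nat \<Rightarrow> word_map \<Rightarrow> word_map" where
  "saturation k \<phi> x = (if \<exists>y. extends_at k \<phi> x y then Some (THE y. extends_at k \<phi> x y) else None)"

lemma extends_at_unique: "extends_at k \<phi> x y \<Longrightarrow> extends_at k \<phi> x z \<Longrightarrow> y = z"
proof -
  assume 1: "extends_at k \<phi> x y" "extends_at k \<phi> x z"
  then have "\<exists>w\<in>words k. x @ [] @ w \<in> dom \<phi>" unfolding extends_at_def by (meson Nil_in_words)
  then obtain w where "w \<in> words k" "x @ w \<in> dom \<phi>" by auto
  then have "\<phi> (x @ w) = Some (y @ w)" "\<phi> (x @ w) = Some (z @ w)"
    using 1 unfolding extends_at_def by blast+
  then show "y = z" by simp
qed

lemma saturation_Some: "saturation k \<phi> x = Some y \<longleftrightarrow> extends_at k \<phi> x y"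
  unfolding saturation_def using extends_at_unique
  by (smt (verit, best) option.discI option.inject the_equality)

text \<open>The assumption covers all maps essentially equal to \<open>\<phi>\<close>, not only its
  extensions. This is what makes the saturations of equivalent maps coincide in
  \<open>max_ext_cong\<close>.\<close>

lemma saturation_greatest:
  assumes "hom_equiv k \<phi> \<chi>"
  shows "\<chi> \<subseteq>\<^sub>m saturation k \<phi>"
  unfolding map_le_def
proof
  have hom: "right_ideal_hom k \<phi>" "right_ideal_hom k \<chi>" using assms by (auto simp: hom_equiv_iff)
  fix x
  assume "x \<in> dom \<chi>"
  then obtain y where y: "\<chi> x = Some y" by auto
  have "extends_at k \<phi> x y"
    unfolding extends_at_def
  proof (intro conjI ballI impI)
    show "x \<in> words k" "y \<in> words k" using homD[OF hom(2)] y by auto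
    show "\<exists>w\<in>words k. x @ v @ w \<in> dom \<phi>" if "v \<in> words k" for v
    proof -
      have "x @ v \<in> dom \<chi>" using homD(5)[OF hom(2) y that] by auto
      then show ?thesis using assms unfolding hom_equiv_iff dense_in_def by (metis append_assoc)
    qed
    show "\<phi> (x @ w) = Some (y @ w)" if w: "w \<in> words k" "x @ w \<in> dom \<phi>" for w
    proof -
      have "\<chi> (x @ w) = Some (y @ w)" using homD(5)[OF hom(2) y w(1)] .
      moreover obtain z where "\<phi> (x @ w) = Some z" using w(2) by auto
      ultimately show ?thesis using assms unfolding hom_equiv_iff by auto
    qed
  qed
  then show "\<chi> x = saturation k \<phi> x" using y by (simp add: saturation_Some[symmetric])
qed

lemma saturation_equiv:
  assumes \<phi>: "right_ideal_hom k \<phi>"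
  shows "hom_equiv k \<phi> (saturation k \<phi>)"
proof -
  have le: "\<phi> \<subseteq>\<^sub>m saturation k \<phi>" using saturation_greatest[OF hom_equiv_refl[OF \<phi>]] .
  have app: "saturation k \<phi> (x @ w) = Some (y @ w)"
    if "saturation k \<phi> x = Some y" "w \<in> words k" for x y w
    unfolding saturation_Some extends_at_def
  proof (intro conjI ballI impI)
    have e: "extends_at k \<phi> x y" using that by (simp add: saturation_Some)
    then show "x @ w \<in> words k" "y @ w \<in> words k" using that(2) by (auto simp: extends_at_def)
    show "\<exists>wa\<in>words k. (x @ w) @ v @ wa \<in> dom \<phi>" if v: "v \<in> words k" for v
    proof -
      have "w @ v \<in> words k" using v \<open>w \<in> words k\<close> by simp
      then show ?thesis using e unfolding extends_at_def by (metis append_assoc)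
    qed
    show "\<phi> ((x @ w) @ wa) = Some ((y @ w) @ wa)" if v: "wa \<in> words k" "(x @ w) @ wa \<in> dom \<phi>" for wa
    proof -
      have "w @ wa \<in> words k" using v \<open>w \<in> words k\<close> by simp
      then show ?thesis using e v unfolding extends_at_def by (metis append_assoc)
    qed
  qed
  have word: "x \<in> words k" "y \<in> words k" if "saturation k \<phi> x = Some y" for x y
    using that unfolding saturation_Some extends_at_def by auto
  have dense: "dense_in k (dom (saturation k \<phi>)) (dom \<phi>)"
    unfolding dense_in_def
  proof
    fix x
    assume "x \<in> dom (saturation k \<phi>)"
    then obtain y where "extends_at k \<phi> x y" by (auto simp: saturation_Some)
    then have "\<exists>w\<in>words k. x @ [] @ w \<in> dom \<phi>" unfolding extends_at_def by (meson Nil_in_words)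
    then show "\<exists>w\<in>words k. x @ w \<in> dom \<phi>" by simp
  qed
  obtain N where N: "\<And>x. x \<in> dom \<phi> \<Longrightarrow> \<exists>v\<in>dom \<phi>. prefix v x \<and> length v \<le> N"
    using fg_right_ideal_bound[OF homD(1)[OF \<phi>]] by blast
  have "fg_right_ideal k (dom (saturation k \<phi>))"
  proof (rule fg_right_idealI)
    show "right_ideal k (dom (saturation k \<phi>))"
      by (rule right_idealI) (use word app in blast)+
    fix x
    assume x: "x \<in> dom (saturation k \<phi>)"
    show "\<exists>v\<in>dom (saturation k \<phi>). prefix v x \<and> length v \<le> N"
    \<comment> \<open>If \<open>x\<close> is longer than \<open>N\<close>, it is extended into
      \<open>dom \<phi>\<close>; a word of \<open>dom \<phi>\<close> of length at most
      \<open>N\<close> that is a prefix of the extension is then a prefix of \<open>x\<close>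
      already.\<close>
    proof (cases "length x \<le> N")
      case False
      obtain w where w: "x @ w \<in> dom \<phi>" using dense x unfolding dense_in_def by blast
      then obtain v where v: "v \<in> dom \<phi>" "prefix v (x @ w)" "length v \<le> N" using N by blast
      then have "prefix v x" using False by (metis nle_le prefixI prefix_length_prefix order_trans)
      moreover have "v \<in> dom (saturation k \<phi>)" using v(1) le by (meson map_le_implies_dom_le subsetD)
      ultimately show ?thesis using v(3) by blast
    qed (use x in blast)
  qed
  then have hom: "right_ideal_hom k (saturation k \<phi>)" using word app by (intro homI)
  have "y = z" if "\<phi> x = Some y" "saturation k \<phi> x = Some z" for x y z
    using that le by (metis domI map_le_def option.inject)
  then show ?thesis
    unfolding hom_equiv_iff using \<phi> hom dense map_le_implies_dom_le[OF le]
    by (auto intro: dense_in_subset)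
qed

text \<open>A greatest essentially equal extension is the only maximal one, which settles the
  definite description.\<close>

lemma max_ext_eq:
  assumes \<phi>: "right_ideal_hom k \<phi>"
  shows "max_ext k \<phi> = saturation k \<phi>"
proof -
  have ext: "ess_eq_extension k \<phi> \<chi> \<longleftrightarrow> hom_equiv k \<phi> \<chi> \<and> \<phi> \<subseteq>\<^sub>m \<chi>" for \<chi>
    using \<phi> by (auto simp: ess_eq_extension_def hom_equiv_def)
  have sat: "ess_eq_extension k \<phi> (saturation k \<phi>)"
    using ext saturation_equiv[OF \<phi>] saturation_greatest[OF hom_equiv_refl[OF \<phi>]] by blast
  show ?thesis
    unfolding max_ext_def
  proof (rule the_equality)
    show "ess_eq_extension k \<phi> (saturation k \<phi>) \<and>
      (\<forall>\<chi>. ess_eq_extension k \<phi> \<chi> \<and> saturation k \<phi> \<subseteq>\<^sub>m \<chi> \<longrightarrow> \<chi> = saturation k \<phi>)"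
      using sat ext saturation_greatest map_le_antisym by blast
    show "\<psi> = saturation k \<phi>" if "ess_eq_extension k \<phi> \<psi> \<and>
      (\<forall>\<chi>. ess_eq_extension k \<phi> \<chi> \<and> \<psi> \<subseteq>\<^sub>m \<chi> \<longrightarrow> \<chi> = \<psi>)" for \<psi>
      using that sat ext saturation_greatest by metis
  qed
qed

lemma max_ext_equiv: "right_ideal_hom k \<phi> \<Longrightarrow> hom_equiv k \<phi> (max_ext k \<phi>)"
  by (simp add: max_ext_eq saturation_equiv)

lemma max_ext_cong:
  assumes "hom_equiv k \<phi> \<psi>"
  shows "max_ext k \<phi> = max_ext k \<psi>"
proof -
  have hom: "right_ideal_hom k \<phi>" "right_ideal_hom k \<psi>" using assms by (auto simp: hom_equiv_iff)
  have "saturation k \<psi> \<subseteq>\<^sub>m saturation k \<phi>"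
    by (rule saturation_greatest[OF hom_equiv_trans[OF assms saturation_equiv[OF hom(2)]]])
  moreover have "saturation k \<phi> \<subseteq>\<^sub>m saturation k \<psi>"
    by (rule saturation_greatest[OF hom_equiv_trans[OF hom_equiv_sym[OF assms] saturation_equiv[OF hom(1)]]])
  ultimately show ?thesis by (simp add: max_ext_eq hom map_le_antisym)
qed

section \<open>Elements and products of the monoid\<close>

lemma carrier_iff:
  "\<phi> \<in> carrier (thompson_higman k) \<longleftrightarrow> right_ideal_hom k \<phi> \<and> max_ext k \<phi> = \<phi>"
  by (simp add: thompson_higman_def)

lemma max_ext_in_carrier:
  assumes "right_ideal_hom k \<phi>"
  shows "max_ext k \<phi> \<in> carrier (thompson_higman k)"
  using max_ext_equiv[OF assms] max_ext_cong[of k \<phi> "max_ext k \<phi>"]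
  by (auto simp: carrier_iff hom_equiv_iff)

lemma carrier_eqI:
  "u \<in> carrier (thompson_higman k) \<Longrightarrow> v \<in> carrier (thompson_higman k) \<Longrightarrow> hom_equiv k u v \<Longrightarrow> u = v"
  using max_ext_cong[of k u v] by (simp add: carrier_iff)

text \<open>From here on a product in the monoid can be handled as the plain composition of
  arbitrary representatives of its factors.\<close>

lemma mult_equiv:
  assumes "hom_equiv k \<psi> \<psi>'" "hom_equiv k \<phi> \<phi>'"
  shows "hom_equiv k (\<psi> \<otimes>\<^bsub>thompson_higman k\<^esub> \<phi>) (\<psi>' \<circ>\<^sub>m \<phi>')"
proof -
  have "right_ideal_hom k (\<psi> \<circ>\<^sub>m \<phi>)" using assms hom_comp by (auto simp: hom_equiv_iff)
  then have "hom_equiv k (\<psi> \<otimes>\<^bsub>thompson_higman k\<^esub> \<phi>) (\<psi> \<circ>\<^sub>m \<phi>)"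
    by (simp add: thompson_higman_def max_ext_equiv hom_equiv_sym)
  then show ?thesis using hom_equiv_comp[OF assms] hom_equiv_trans by blast
qed

lemma mult_in_carrier:
  assumes "right_ideal_hom k \<psi>" "right_ideal_hom k \<phi>"
  shows "\<psi> \<otimes>\<^bsub>thompson_higman k\<^esub> \<phi> \<in> carrier (thompson_higman k)"
  using max_ext_in_carrier[OF hom_comp[OF assms]] by (simp add: thompson_higman_def)

section \<open>The class of a right ideal\<close>

text \<open>For a right ideal this is its unique generating prefix code. The same operator is
  applied to finite generating sets, where the procedure can count its elements;
  \<open>min_gens_ideal_of\<close> links the two uses.\<close>

definition min_gens :: "word set \<Rightarrow> word set" where
  "min_gens R = {x \<in> R. \<forall>v\<in>R. \<not> strict_prefix v x}"

lemma prefix_code_min_gens: "prefix_code (min_gens R)"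
  by (auto simp: prefix_code_def min_gens_def)

lemma min_gens_prefix:
  assumes "x \<in> R"
  shows "\<exists>p\<in>min_gens R. prefix p x"
  using assms
proof (induction "length x" arbitrary: x rule: less_induct)
  case less
  show ?case
  proof (cases "x \<in> min_gens R")
    case False
    then obtain v where v: "v \<in> R" "strict_prefix v x" using less.prems by (auto simp: min_gens_def)
    then have "length v < length x" by (simp add: prefix_length_less)
    then obtain p where "p \<in> min_gens R" "prefix p v" using less.hyps v by blast
    then show ?thesis using v(2) by (meson prefix_order.order_trans strict_prefix_def)
  qed auto
qed

lemma ideal_of_min_gens:
  assumes "right_ideal k R"
  shows "ideal_of k (min_gens R) = R"
proof
  show "ideal_of k (min_gens R) \<subseteq> R"
    using right_ideal_append[OF assms] by (auto simp: ideal_of_def min_gens_def)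
  show "R \<subseteq> ideal_of k (min_gens R)"
  proof
    fix x
    assume x: "x \<in> R"
    then obtain p w where p: "p \<in> min_gens R" "x = p @ w"
      using min_gens_prefix by (meson prefixE)
    then have "p @ w \<in> words k" using x right_ideal_subset_words[OF assms] by blast
    then show "x \<in> ideal_of k (min_gens R)" using p unfolding ideal_of_def by auto
  qed
qed

lemma min_gens_ideal_of:
  assumes "P \<subseteq> words k"
  shows "min_gens (ideal_of k P) = min_gens P"
proof -
  have sub: "P \<subseteq> ideal_of k P" by (rule subset_ideal_of)
  have pre: "\<exists>p\<in>P. prefix p x" if "x \<in> ideal_of k P" for x
    using that unfolding ideal_of_def by (force simp: prefix_def)
  show ?thesis
  proof (intro equalityI subsetI)
    fix x
    assume x: "x \<in> min_gens (ideal_of k P)"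
    then obtain p where p: "p \<in> P" "prefix p x" using pre by (auto simp: min_gens_def)
    then have "p = x" using x sub unfolding min_gens_def strict_prefix_def by blast
    then show "x \<in> min_gens P" using p x sub by (auto simp: min_gens_def)
  next
    fix x
    assume x: "x \<in> min_gens P"
    have "\<not> strict_prefix v x" if v: "v \<in> ideal_of k P" for v
    proof
      assume "strict_prefix v x"
      moreover obtain p where "p \<in> P" "prefix p v" using pre[OF v] by blast
      ultimately have "p \<in> P" "strict_prefix p x" by (auto simp: prefix_order.le_less_trans)
      then show False using x by (auto simp: min_gens_def)
    qed
    then show "x \<in> min_gens (ideal_of k P)" using x sub by (auto simp: min_gens_def)
  qed
qed

lemma min_gens_prefix_code: "prefix_code P \<Longrightarrow> min_gens P = P"
  by (auto simp: prefix_code_def min_gens_def)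

lemma fg_min_gens:
  assumes "fg_right_ideal k R"
  shows "finite (min_gens R)" "min_gens R \<subseteq> words k"
proof -
  obtain P where P: "finite P" "P \<subseteq> words k" "R = ideal_of k P"
    using assms by (auto simp: fg_right_ideal_def)
  then have "min_gens R \<subseteq> P" using min_gens_ideal_of by (auto simp: min_gens_def)
  then show "finite (min_gens R)" "min_gens R \<subseteq> words k"
    using P finite_subset by auto
qed

lemma prefix_code_unique:
  assumes "prefix_code P" "p \<in> P" "q \<in> P" "p @ u = q @ v"
  shows "p = q \<and> u = v"
proof -
  have "prefix p q \<or> prefix q p"
    using assms(4) by (metis prefixI prefix_same_cases)
  then have "p = q" using assms(1-3) by (auto simp: prefix_code_def strict_prefix_def)
  then show ?thesis using assms(4) by simp
qed

section \<open>Counting the words of a fixed length in an ideal\<close>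

lemma card_words_length: "card {w \<in> words k. length w = n} = k ^ n"
  using card_lists_length_eq[of "{..<k}" n] by (simp add: words_def lists_eq_set conj_commute)

lemma card_level_prefix_code:
  assumes P: "finite P" "prefix_code P" "P \<subseteq> words k" and N: "\<And>p. p \<in> P \<Longrightarrow> length p \<le> N"
  shows "card {x \<in> ideal_of k P. length x = N} = (\<Sum>p\<in>P. k ^ (N - length p))"
proof -
  let ?W = "\<lambda>p. {w \<in> words k. length w = N - length p}"
  have fin: "finite (?W p)" for p
    by (rule finite_subset[OF _ finite_words_length[of k "N - length p"]]) auto
  have "{x \<in> ideal_of k P. length x = N} = (\<Union>p\<in>P. (@) p ` ?W p)"
  proof (intro equalityI subsetI)
    fix x
    assume "x \<in> {x \<in> ideal_of k P. length x = N}"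
    then obtain p w where "p \<in> P" "w \<in> words k" "x = p @ w" "length x = N"
      by (auto simp: ideal_of_def)
    then show "x \<in> (\<Union>p\<in>P. (@) p ` ?W p)" by (intro UN_I[of p] image_eqI[of _ _ w]) auto
  next
    fix x
    assume "x \<in> (\<Union>p\<in>P. (@) p ` ?W p)"
    then obtain p w where "p \<in> P" "w \<in> words k" "length w = N - length p" "x = p @ w" by auto
    then show "x \<in> {x \<in> ideal_of k P. length x = N}" using N[of p] by (auto simp: ideal_of_def)
  qed
  also have "card \<dots> = (\<Sum>p\<in>P. card ((@) p ` ?W p))"
  proof (rule card_UN_disjoint)
    show "\<forall>p\<in>P. \<forall>q\<in>P. p \<noteq> q \<longrightarrow> (@) p ` ?W p \<inter> (@) q ` ?W q = {}"
    proof (intro ballI impI)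
      fix p q
      assume pq: "p \<in> P" "q \<in> P" "p \<noteq> q"
      then show "(@) p ` ?W p \<inter> (@) q ` ?W q = {}"
        using prefix_code_unique[OF P(2) pq(1,2)] by blast
    qed
  qed (use P(1) fin in auto)
  also have "\<dots> = (\<Sum>p\<in>P. k ^ (N - length p))"
  proof (intro sum.cong refl)
    fix p
    show "card ((@) p ` ?W p) = k ^ (N - length p)"
      unfolding card_words_length[symmetric] by (rule card_image) (simp add: inj_on_def)
  qed
  finally show ?thesis .
qed

lemma power_mod_pred: "k \<ge> 1 \<Longrightarrow> k ^ n mod (k - 1) = 1 mod (k - 1)" for k :: nat
proof (induction n)
  case (Suc n)
  have "k = (k - 1) * 1 + 1" using Suc.prems by simp
  then have "k mod (k - 1) = 1 mod (k - 1)" by (metis mod_mult_self2 add.commute mult.commute)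
  then have "(k * k ^ n) mod (k - 1) = (1 * 1) mod (k - 1)"
    using Suc by (metis mod_mult_cong)
  then show ?case by simp
qed simp

lemma card_level_mod:
  assumes "finite P" "prefix_code P" "P \<subseteq> words k" "\<And>p. p \<in> P \<Longrightarrow> length p \<le> N" "k \<ge> 1"
  shows "card {x \<in> ideal_of k P. length x = N} mod (k - 1) = card P mod (k - 1)"
proof -
  have "(\<Sum>p\<in>P. k ^ (N - length p)) mod (k - 1) = (\<Sum>p\<in>P. k ^ (N - length p) mod (k - 1)) mod (k - 1)"
    by (simp add: mod_sum_eq)
  also have "\<dots> = (\<Sum>p\<in>P. 1 mod (k - 1)) mod (k - 1)"
    by (intro arg_cong2[of _ _ _ _ "(mod)"] sum.cong refl power_mod_pred assms(5))
  also have "\<dots> = (\<Sum>p\<in>P. 1) mod (k - 1)" by (rule mod_sum_eq)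
  also have "\<dots> = card P mod (k - 1)" by simp
  finally show ?thesis using card_level_prefix_code[OF assms(1-4)] by simp
qed

text \<open>The value \<open>None\<close> keeps the empty ideal apart from nonempty ideals with
  residue 0. For \<open>k = 2\<close> all residues are 0 and emptiness is the only distinction
  left.\<close>

definition ideal_class :: "nat \<Rightarrow> word set \<Rightarrow> nat option" where
  "ideal_class k R = (if R = {} then None else Some (card (min_gens R) mod (k - 1)))"

definition ideal_equiv :: "nat \<Rightarrow> word set \<Rightarrow> word set \<Rightarrow> bool" where
  "ideal_equiv k R1 R2 \<longleftrightarrow> dense_in k R1 R2 \<and> dense_in k R2 R1"

lemma ideal_equiv_trans: "ideal_equiv k R1 R2 \<Longrightarrow> ideal_equiv k R2 R3 \<Longrightarrow> ideal_equiv k R1 R3"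
  by (auto simp: ideal_equiv_def intro: dense_in_trans)

text \<open>Essentially equal ideals contain the same words of each sufficiently large length \<open>N\<close>, and
  modulo \<open>k - 1\<close> their number is the size of the prefix code, since \<open>k \<equiv> 1\<close>.\<close>

lemma ideal_class_cong:
  assumes fg: "fg_right_ideal k R1" "fg_right_ideal k R2" and eq: "ideal_equiv k R1 R2" and k: "k \<ge> 1"
  shows "ideal_class k R1 = ideal_class k R2"
proof -
  define N where "N = Max (length ` (insert [] (min_gens R1 \<union> min_gens R2)))"
  have N: "length p \<le> N" if "p \<in> min_gens R1 \<union> min_gens R2" for p
    unfolding N_def using that fg_min_gens[OF fg(1)] fg_min_gens[OF fg(2)] by (intro Max_ge) auto
  have sub: "{x \<in> A. length x = N} \<subseteq> {x \<in> B. length x = N}"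
    if A: "right_ideal k A" "right_ideal k B" "dense_in k A B" "\<And>p. p \<in> min_gens B \<Longrightarrow> length p \<le> N" for A B
  proof
    fix x
    assume x: "x \<in> {x \<in> A. length x = N}"
    then obtain w where w: "x @ w \<in> B" using A(3) by (auto simp: dense_in_def)
    then obtain p where p: "p \<in> min_gens B" "prefix p (x @ w)" using min_gens_prefix by blast
    moreover have "prefix x (x @ w)" "length p \<le> length x" using x A(4)[OF p(1)] by auto
    ultimately have "prefix p x" using prefix_length_prefix by blast
    then obtain v where v: "x = p @ v" by (auto simp: prefix_def)
    have "v \<in> words k" using x v right_ideal_subset_words[OF A(1)] by auto
    then have "x \<in> B" using right_ideal_append[OF A(2)] p v by (auto simp: min_gens_def)
    then show "x \<in> {x \<in> B. length x = N}" using x by simp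
  qed
  have ri: "right_ideal k R1" "right_ideal k R2" using fg fg_right_ideal_imp by auto
  have "{x \<in> R1. length x = N} = {x \<in> R2. length x = N}"
    using sub[OF ri] sub[OF ri(2,1)] eq N unfolding ideal_equiv_def by (intro equalityI) auto
  then have "card (min_gens R1) mod (k - 1) = card (min_gens R2) mod (k - 1)"
    using card_level_mod[OF fg_min_gens(1)[OF fg(1)] prefix_code_min_gens fg_min_gens(2)[OF fg(1)], of N]
      card_level_mod[OF fg_min_gens(1)[OF fg(2)] prefix_code_min_gens fg_min_gens(2)[OF fg(2)], of N]
      N k ideal_of_min_gens ri by auto
  moreover have "R1 = {} \<longleftrightarrow> R2 = {}" using eq by (auto simp: ideal_equiv_def dense_in_def)
  ultimately show ?thesis by (simp add: ideal_class_def)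
qed

text \<open>Replacing one code word by its \<open>k\<close> one-letter extensions adds
  \<open>k - 1\<close> words to the code and changes the ideal only inessentially.\<close>

lemma expand_prefix_code:
  assumes Q: "finite Q" "prefix_code Q" "Q \<subseteq> words k" "Q \<noteq> {}" and k: "k \<ge> 1"
  shows "\<exists>Q'. finite Q' \<and> prefix_code Q' \<and> Q' \<subseteq> ideal_of k Q \<and>
    ideal_equiv k (ideal_of k Q') (ideal_of k Q) \<and> card Q' = card Q + j * (k - 1)"
proof (induction j)
  case 0
  show ?case using Q subset_ideal_of by (intro exI[of _ Q]) (auto simp: ideal_equiv_def dense_in_subset)
next
  case (Suc j)
  then obtain P where P: "finite P" "prefix_code P" "P \<subseteq> ideal_of k Q"
    "ideal_equiv k (ideal_of k P) (ideal_of k Q)" "card P = card Q + j * (k - 1)" by blast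
  have words: "P \<subseteq> words k"
    using P(3) right_ideal_subset_words[OF right_ideal_ideal_of[OF Q(3)]] by blast
  have "card Q > 0" using Q by (simp add: card_gt_0_iff)
  then have "P \<noteq> {}" using P(5) by auto
  then obtain q where q: "q \<in> P" by blast
  define S where "S = (\<lambda>a. q @ [a]) ` {..<k}"
  define P' where "P' = (P - {q}) \<union> S"
  have S: "x \<in> S \<Longrightarrow> strict_prefix q x" for x by (auto simp: S_def strict_prefix_def)
  have qw: "q \<in> words k" using q words by auto
  have Sw: "S \<subseteq> ideal_of k {q}" by (auto simp: S_def ideal_of_def words_def)
  have disj: "x \<notin> P" if "x \<in> S" for x
    using S[OF that] P(2) q by (auto simp: prefix_code_def)
  have fin: "finite P'" using P(1) by (simp add: P'_def S_def)
  have "card S = k" by (simp add: S_def card_image inj_on_def)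
  then have "card P' = (card P - 1) + k"
    unfolding P'_def using P(1) q disj by (subst card_Un_disjoint) (auto simp: S_def)
  moreover have "card P > 0" using P(1) q by (auto simp: card_gt_0_iff)
  ultimately have "card P' = card P + (k - 1)" using k by simp
  then have card: "card P' = card Q + Suc j * (k - 1)" using P(5) by simp
  have code: "prefix_code P'"
    unfolding prefix_code_def
  proof (intro ballI notI)
    fix u v
    assume uv: "u \<in> P'" "v \<in> P'" "strict_prefix u v"
    consider "u \<in> P" "v \<in> P" | "u \<in> S" "v \<in> S" | "u \<in> S" "v \<in> P" | "u \<in> P - {q}" "v \<in> S"
      using uv by (auto simp: P'_def)
    then show False
    proof cases
      case 1
      then show ?thesis using uv(3) P(2) by (auto simp: prefix_code_def)
    next
      case 2
      then show ?thesis using uv(3) prefix_length_less[of u v] by (auto simp: S_def)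
    next
      case 3
      then have "strict_prefix q v" using S uv(3) by (meson prefix_order.less_trans)
      then show ?thesis using 3 q P(2) by (auto simp: prefix_code_def)
    next
      case 4
      then obtain a where "v = q @ [a]" by (auto simp: S_def)
      then have "prefix u q" using uv(3) by (auto simp: strict_prefix_def)
      then show ?thesis using 4 q P(2) by (auto simp: prefix_code_def strict_prefix_def)
    qed
  qed
  have qP: "ideal_of k {q} \<subseteq> ideal_of k P" using q by (auto simp: ideal_of_def)
  have sub: "P' \<subseteq> ideal_of k P" using Sw qP subset_ideal_of[of P k] by (auto simp: P'_def)
  have ri: "right_ideal k (ideal_of k P)" using right_ideal_ideal_of[OF words] .
  have "ideal_of k P' \<subseteq> ideal_of k P"
  proof
    fix x
    assume "x \<in> ideal_of k P'"
    then obtain p w where p: "p \<in> P'" "w \<in> words k" "x = p @ w" by (auto simp: ideal_of_def)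
    then show "x \<in> ideal_of k P" using right_ideal_append[OF ri] sub by blast
  qed
  moreover have "dense_in k (ideal_of k P) (ideal_of k P')"
    unfolding dense_in_def
  proof
    fix x
    assume "x \<in> ideal_of k P"
    then obtain p w where p: "p \<in> P" "w \<in> words k" "x = p @ w" by (auto simp: ideal_of_def)
    show "\<exists>w\<in>words k. x @ w \<in> ideal_of k P'"
    proof (cases "p = q")
      case False
      then have "p \<in> P'" using p by (auto simp: P'_def)
      then have "x @ [] \<in> ideal_of k P'" using p unfolding ideal_of_def by auto
      then show ?thesis by (intro bexI[of _ "[]"]) auto
    next
      case True
      show ?thesis
      proof (cases w)
        case Nil
        \<comment> \<open>The word \<open>q\<close> itself is the only one lost by the expansion. It
          comes back after appending any letter; 0 is one since \<open>k \<ge> 1\<close>.\<close>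
        have "[0] \<in> words k" using k by (simp add: words_def)
        moreover have "q @ [0] \<in> P'" using k by (auto simp: P'_def S_def)
        ultimately show ?thesis using p True Nil subset_ideal_of[of P' k] by (intro bexI[of _ "[0]"]) auto
      next
        case (Cons a v)
        then have "a < k" "v \<in> words k" using p(2) by (auto simp: words_def)
        then have "q @ [a] \<in> P'" by (auto simp: P'_def S_def)
        then have "(q @ [a]) @ v \<in> ideal_of k P'" using \<open>v \<in> words k\<close> unfolding ideal_of_def by blast
        then show ?thesis using p True Cons by (intro bexI[of _ "[]"]) auto
      qed
    qed
  qed
  ultimately have "ideal_equiv k (ideal_of k P') (ideal_of k P)"
    by (simp add: ideal_equiv_def dense_in_subset)
  then have "ideal_equiv k (ideal_of k P') (ideal_of k Q)" using P(4) ideal_equiv_trans by blast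
  moreover have "P' \<subseteq> ideal_of k Q"
  proof -
    have "ideal_of k P \<subseteq> ideal_of k Q"
    proof
      fix x
      assume "x \<in> ideal_of k P"
      then obtain p w where p: "p \<in> P" "w \<in> words k" "x = p @ w" by (auto simp: ideal_of_def)
      then show "x \<in> ideal_of k Q"
        using right_ideal_append[OF right_ideal_ideal_of[OF Q(3)]] P(3) by blast
    qed
    then show ?thesis using sub by blast
  qed
  ultimately show ?case using fin code card by blast
qed

lemma equal_card_codes:
  assumes fg: "fg_right_ideal k R1" "fg_right_ideal k R2"
    and c: "ideal_class k R1 = ideal_class k R2" and k: "k \<ge> 1"
  shows "\<exists>Q1 Q2. finite Q1 \<and> finite Q2 \<and> prefix_code Q1 \<and> prefix_code Q2 \<and> Q1 \<subseteq> R1 \<and> Q2 \<subseteq> R2 \<and>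
    ideal_equiv k (ideal_of k Q1) R1 \<and> ideal_equiv k (ideal_of k Q2) R2 \<and> card Q1 = card Q2"
proof -
  \<comment> \<open>By symmetry the first code may be taken as the smaller one. Only this code is
    expanded; the other ideal keeps its minimal generators.\<close>
  have *: "\<exists>Q1 Q2. finite Q1 \<and> finite Q2 \<and> prefix_code Q1 \<and> prefix_code Q2 \<and> Q1 \<subseteq> R1 \<and> Q2 \<subseteq> R2 \<and>
    ideal_equiv k (ideal_of k Q1) R1 \<and> ideal_equiv k (ideal_of k Q2) R2 \<and> card Q1 = card Q2"
    if fg: "fg_right_ideal k R1" "fg_right_ideal k R2"
      and c: "ideal_class k R1 = ideal_class k R2" and le: "card (min_gens R1) \<le> card (min_gens R2)" for R1 R2
  proof -
    have id: "ideal_of k (min_gens R1) = R1" "ideal_of k (min_gens R2) = R2"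
      using fg fg_right_ideal_imp ideal_of_min_gens by blast+
    have refl: "ideal_equiv k R R" for R by (simp add: ideal_equiv_def dense_in_subset)
    have sub: "min_gens R \<subseteq> R" for R by (auto simp: min_gens_def)
    show ?thesis
    proof (cases "R1 = {}")
      case True
      then have "R2 = {}" using c by (auto simp: ideal_class_def split: if_splits)
      then show ?thesis using True by (intro exI[of _ "{}"]) (auto simp: prefix_code_def ideal_of_def refl)
    next
      case False
      then have "card (min_gens R1) mod (k - 1) = card (min_gens R2) mod (k - 1)"
        using c by (auto simp: ideal_class_def split: if_splits)
      then obtain j where j: "card (min_gens R2) = card (min_gens R1) + j * (k - 1)"
        using le by (metis mod_eq_nat1E mult.commute)
      have ne: "min_gens R1 \<noteq> {}" using False min_gens_prefix by blast
      obtain Q where Q: "finite Q" "prefix_code Q" "Q \<subseteq> R1" "ideal_equiv k (ideal_of k Q) R1"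
        "card Q = card (min_gens R1) + j * (k - 1)"
        using expand_prefix_code[OF fg_min_gens(1)[OF fg(1)] prefix_code_min_gens fg_min_gens(2)[OF fg(1)] ne k, of j]
        unfolding id by blast
      have "ideal_equiv k (ideal_of k (min_gens R2)) R2" unfolding id by (rule refl)
      then show ?thesis
        using Q j fg_min_gens(1)[OF fg(2)] prefix_code_min_gens[of R2] sub[of R2] by (intro exI[of _ Q] exI[of _ "min_gens R2"]) simp
    qed
  qed
  show ?thesis
  proof (cases "card (min_gens R1) \<le> card (min_gens R2)")
    case True
    then show ?thesis using * fg c by blast
  next
    case False
    then have "card (min_gens R2) \<le> card (min_gens R1)" by simp
    from *[OF fg(2,1) c[symmetric] this] show ?thesis by metis
  qed
qed

section \<open>Homomorphisms given on a prefix code\<close>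

text \<open>The same construction as \<open>table_hom\<close>, with a function in place of a list.
  The words \<open>f p\<close> need not form a prefix code, which is essential for the right factor
  built in \<open>R_le_iff\<close>.\<close>

definition code_hom :: "nat \<Rightarrow> word set \<Rightarrow> (word \<Rightarrow> word) \<Rightarrow> word_map" where
  "code_hom k P f x = (if x \<in> ideal_of k P
     then let p = (THE p. p \<in> P \<and> prefix p x) in Some (f p @ drop (length p) x) else None)"

lemma code_hom_app:
  assumes "prefix_code P" "p \<in> P" "w \<in> words k"
  shows "code_hom k P f (p @ w) = Some (f p @ w)"
proof -
  have "(THE q. q \<in> P \<and> prefix q (p @ w)) = p"
  proof (rule the_equality)
    show "q = p" if "q \<in> P \<and> prefix q (p @ w)" for q
      using that prefix_code_unique[OF assms(1), of q p] assms(2) by (metis prefixE)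
  qed (use assms in simp)
  moreover have "p @ w \<in> ideal_of k P" using assms by (auto simp: ideal_of_def)
  ultimately show ?thesis by (simp add: code_hom_def)
qed

lemma dom_code_hom: "dom (code_hom k P f) = ideal_of k P"
  by (auto simp: code_hom_def dom_def Let_def)

lemma code_hom_SomeE:
  assumes "code_hom k P f x = Some y" "prefix_code P"
  obtains p w where "p \<in> P" "w \<in> words k" "x = p @ w" "y = f p @ w"
proof -
  have "x \<in> ideal_of k P" using assms(1) dom_code_hom[of k P f] by blast
  then obtain p w where p: "p \<in> P" "w \<in> words k" "x = p @ w" by (auto simp: ideal_of_def)
  then have "y = f p @ w" using assms code_hom_app[OF assms(2) p(1,2), of f] by simp
  then show thesis using p that by blast
qed

lemma hom_code_hom:
  assumes P: "finite P" "prefix_code P" "P \<subseteq> words k" and f: "\<And>p. p \<in> P \<Longrightarrow> f p \<in> words k"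
  shows "right_ideal_hom k (code_hom k P f)" "ran (code_hom k P f) = ideal_of k (f ` P)"
proof -
  have app: "code_hom k P f (x @ w) = Some (y @ w)"
    if xy: "code_hom k P f x = Some y" "w \<in> words k" for x y w
  proof -
    obtain p v where p: "p \<in> P" "v \<in> words k" "x = p @ v" "y = f p @ v"
      using xy(1) P(2) by (rule code_hom_SomeE)
    then show ?thesis using code_hom_app[OF P(2) p(1), of "v @ w" k f] xy(2) by simp
  qed
  show "right_ideal_hom k (code_hom k P f)"
  proof (rule homI[OF _ _ app])
    show "fg_right_ideal k (dom (code_hom k P f))"
      using P unfolding dom_code_hom fg_right_ideal_def by blast
    show "y \<in> words k" if xy: "code_hom k P f x = Some y" for x y
      using xy P(2) by (rule code_hom_SomeE) (use f in auto)
  qed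
  have "(\<lambda>p. the (code_hom k P f p)) ` P = f ` P"
    using code_hom_app[OF P(2), of _ "[]" k f] by force
  then show "ran (code_hom k P f) = ideal_of k (f ` P)"
    using ran_generated[OF app dom_code_hom] by simp
qed

lemma table_hom_eq: "table_hom k T = code_hom k (fst ` set T) (\<lambda>p. the (map_of T p))"
  by (rule ext) (simp add: table_hom_def code_hom_def)

lemma table_hom_props:
  assumes "is_table k T"
  shows "right_ideal_hom k (table_hom k T)" "ran (table_hom k T) = ideal_of k (snd ` set T)"
proof -
  have T: "fst ` set T \<subseteq> words k" "snd ` set T \<subseteq> words k" "distinct (map fst T)"
    "prefix_code (fst ` set T)" using assms by (auto simp: is_table_def)
  have m: "(p, q) \<in> set T \<Longrightarrow> the (map_of T p) = q" for p q
    using T(3) by (simp add: map_of_is_SomeI)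
  then have "(\<lambda>p. the (map_of T p)) ` fst ` set T = snd ` set T" by force
  moreover have "p \<in> fst ` set T \<Longrightarrow> the (map_of T p) \<in> words k" for p using m T(2) by force
  ultimately show "right_ideal_hom k (table_hom k T)" "ran (table_hom k T) = ideal_of k (snd ` set T)"
    unfolding table_hom_eq using hom_code_hom[OF _ T(4,1), of "\<lambda>p. the (map_of T p)"] by auto
qed

section \<open>Green's relations\<close>

lemma restrict_hom:
  assumes "fg_right_ideal k R"
  shows "right_ideal_hom k (Some |` R)"
proof (rule homI)
  have ri: "right_ideal k R" using assms fg_right_ideal_imp by blast
  show "fg_right_ideal k (dom (Some |` R))" using assms by simp
  show "y \<in> words k" if "(Some |` R) x = Some y" for x y
    using that right_ideal_subset_words[OF ri] by (auto simp: restrict_map_def split: if_splits)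
  show "(Some |` R) (x @ w) = Some (y @ w)" if "(Some |` R) x = Some y" "w \<in> words k" for x y w
    using that right_ideal_append[OF ri] by (auto simp: restrict_map_def split: if_splits)
qed

lemma hom_equiv_submap:
  assumes hom: "right_ideal_hom k \<phi>" "right_ideal_hom k \<psi>"
    and sub: "\<And>x y. \<phi> x = Some y \<Longrightarrow> \<psi> x = Some y" and d: "dense_in k (dom \<psi>) (dom \<phi>)"
  shows "hom_equiv k \<phi> \<psi>"
proof -
  have "dom \<phi> \<subseteq> dom \<psi>" using sub by blast
  moreover have "y = z" if "\<phi> x = Some y" "\<psi> x = Some z" for x y z using sub[OF that(1)] that(2) by simp
  ultimately show ?thesis unfolding hom_equiv_iff using hom d dense_in_subset by blast
qed

lemma hom_equiv_ran_dense:
  assumes "hom_equiv k \<phi> \<psi>"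
  shows "dense_in k (ran \<phi>) (ran \<psi>)"
  unfolding dense_in_def
proof
  have hom: "right_ideal_hom k \<phi>" "right_ideal_hom k \<psi>" using assms by (auto simp: hom_equiv_iff)
  fix y
  assume "y \<in> ran \<phi>"
  then obtain x where x: "\<phi> x = Some y" by (auto simp: ran_def)
  then obtain w z where w: "w \<in> words k" "\<psi> (x @ w) = Some z"
    using assms unfolding hom_equiv_iff dense_in_def by blast
  have "z = y @ w" using homD(5)[OF hom(1) x w(1)] w(2) assms unfolding hom_equiv_iff by metis
  then show "\<exists>w\<in>words k. y @ w \<in> ran \<psi>" using w by (auto simp: ran_def)
qed

lemma hom_equiv_ran: "hom_equiv k \<phi> \<psi> \<Longrightarrow> ideal_equiv k (ran \<phi>) (ran \<psi>)"
  by (simp add: ideal_equiv_def hom_equiv_ran_dense hom_equiv_sym)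

lemma ran_comp_subset: "ran (\<psi> \<circ>\<^sub>m \<phi>) \<subseteq> ran \<psi>"
  by (auto simp: ran_def map_comp_Some_iff)

lemma J_le_iff:
  assumes u: "u \<in> carrier (thompson_higman k)" and v: "v \<in> carrier (thompson_higman k)"
  shows "J_le (thompson_higman k) u v \<longleftrightarrow> (v = Map.empty \<longrightarrow> u = Map.empty)"
proof
  have hom: "right_ideal_hom k u" "right_ideal_hom k v" using u v by (auto simp: carrier_iff)
  have equiv3: "hom_equiv k (x \<otimes>\<^bsub>thompson_higman k\<^esub> v \<otimes>\<^bsub>thompson_higman k\<^esub> y) (x' \<circ>\<^sub>m v \<circ>\<^sub>m y')"
    if "hom_equiv k x x'" "hom_equiv k y y'" for x y x' y'
    using that mult_equiv[OF mult_equiv[OF that(1) hom_equiv_refl[OF hom(2)]] that(2)] by simp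
  have empty: "\<phi> = Map.empty" if "hom_equiv k \<phi> Map.empty" for \<phi>
    using that unfolding hom_equiv_iff dense_in_def by auto
  {
    assume "J_le (thompson_higman k) u v"
    then obtain x y where xy: "x \<in> carrier (thompson_higman k)" "y \<in> carrier (thompson_higman k)"
      "u = x \<otimes>\<^bsub>thompson_higman k\<^esub> v \<otimes>\<^bsub>thompson_higman k\<^esub> y" by (auto simp: J_le_def)
    then have e: "hom_equiv k u (x \<circ>\<^sub>m v \<circ>\<^sub>m y)"
      using equiv3[OF hom_equiv_refl hom_equiv_refl] by (simp add: carrier_iff)
    show "v = Map.empty \<longrightarrow> u = Map.empty"
    proof
      assume "v = Map.empty"
      then have "x \<circ>\<^sub>m v \<circ>\<^sub>m y = Map.empty" by (auto simp: map_comp_def split: option.splits)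
      then show "u = Map.empty" using empty e by simp
    qed
  next
    assume *: "v = Map.empty \<longrightarrow> u = Map.empty"
    have "\<exists>x y. right_ideal_hom k x \<and> right_ideal_hom k y \<and> x \<circ>\<^sub>m v \<circ>\<^sub>m y = u"
    proof (cases "v = Map.empty")
      case True
      have "u \<circ>\<^sub>m v \<circ>\<^sub>m u = u" using True * by (auto simp: map_comp_def)
      then show ?thesis using hom by blast
    next
      case False
      then obtain p where "v p \<noteq> None" by (auto simp: fun_eq_iff)
      then obtain q where pq: "v p = Some q" by auto
      then have w: "p \<in> words k" "q \<in> words k" using homD[OF hom(2)] by auto
      \<comment> \<open>On \<open>words k\<close> the composite of \<open>y\<close>,
        \<open>v\<close> and \<open>x\<close> is the identity, so \<open>u\<close> composed with
        \<open>x\<close> serves as the left factor.\<close>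
      define y where "y = code_hom k {[]} (\<lambda>_. p)"
      define x where "x = code_hom k {q} (\<lambda>_. [])"
      have y: "right_ideal_hom k y" unfolding y_def by (rule hom_code_hom) (auto simp: prefix_code_def w)
      have x: "right_ideal_hom k x" unfolding x_def by (rule hom_code_hom) (auto simp: prefix_code_def w)
      have "(u \<circ>\<^sub>m x \<circ>\<^sub>m v \<circ>\<^sub>m y) z = u z" for z
      proof (cases "z \<in> words k")
        case True
        then have "y z = Some (p @ z)" "v (p @ z) = Some (q @ z)" "x (q @ z) = Some z"
          using code_hom_app[of "{[]}" "[]" z k "\<lambda>_. p"] code_hom_app[of "{q}" q z k "\<lambda>_. []"]
            homD(5)[OF hom(2) pq] by (auto simp: y_def x_def prefix_code_def)
        then show ?thesis by (simp add: map_comp_def)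
      next
        case False
        then have "y z = None" "u z = None" using homD(6)[OF y] homD(6)[OF hom(1)]
          by (meson not_Some_eq)+
        then show ?thesis by (simp add: map_comp_def)
      qed
      then have "(u \<circ>\<^sub>m x) \<circ>\<^sub>m v \<circ>\<^sub>m y = u" by blast
      then show ?thesis using hom_comp[OF hom(1) x] y by blast
    qed
    then obtain x y where xy: "right_ideal_hom k x" "right_ideal_hom k y" "x \<circ>\<^sub>m v \<circ>\<^sub>m y = u" by blast
    have "max_ext k x \<otimes>\<^bsub>thompson_higman k\<^esub> v \<otimes>\<^bsub>thompson_higman k\<^esub> max_ext k y \<in> carrier (thompson_higman k)"
      using max_ext_in_carrier[OF xy(1)] max_ext_in_carrier[OF xy(2)] v mult_in_carrier
      by (meson carrier_iff)
    moreover have "hom_equiv k u (max_ext k x \<otimes>\<^bsub>thompson_higman k\<^esub> v \<otimes>\<^bsub>thompson_higman k\<^esub> max_ext k y)"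
      using equiv3[OF hom_equiv_sym[OF max_ext_equiv[OF xy(1)]] hom_equiv_sym[OF max_ext_equiv[OF xy(2)]]]
        xy(3) hom_equiv_sym by simp
    ultimately have "u = max_ext k x \<otimes>\<^bsub>thompson_higman k\<^esub> v \<otimes>\<^bsub>thompson_higman k\<^esub> max_ext k y"
      using carrier_eqI[OF u] by blast
    then show "J_le (thompson_higman k) u v"
      unfolding J_le_def using max_ext_in_carrier xy(1,2) by blast
  }
qed

text \<open>For the converse a preimage under \<open>v\<close> is chosen for each value of
  \<open>u\<close> on a finite prefix code. Both maps commute with appending words, so this finite
  choice already determines a right factor.\<close>

lemma R_le_iff:
  assumes u: "u \<in> carrier (thompson_higman k)" and v: "v \<in> carrier (thompson_higman k)"
  shows "R_le (thompson_higman k) u v \<longleftrightarrow> dense_in k (ran u) (ran v)"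
proof
  have hom: "right_ideal_hom k u" "right_ideal_hom k v" using u v by (auto simp: carrier_iff)
  {
    assume "R_le (thompson_higman k) u v"
    then obtain x where x: "x \<in> carrier (thompson_higman k)" "u = v \<otimes>\<^bsub>thompson_higman k\<^esub> x"
      by (auto simp: R_le_def)
    then have "hom_equiv k u (v \<circ>\<^sub>m x)"
      using mult_equiv[OF hom_equiv_refl hom_equiv_refl, of k v x] hom by (simp add: carrier_iff)
    then have "dense_in k (ran u) (ran (v \<circ>\<^sub>m x))" by (rule hom_equiv_ran_dense)
    then show "dense_in k (ran u) (ran v)"
      using dense_in_subset[OF ran_comp_subset[of v x]] dense_in_trans by blast
  next
    assume d: "dense_in k (ran u) (ran v)"
    \<comment> \<open>Preimages under \<open>v\<close> exist only for values in
      \<open>ran v\<close>. Cutting \<open>u\<close> down to these arguments is inessential because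
      of the density assumption.\<close>
    define u' where "u' = (Some |` ran v) \<circ>\<^sub>m u"
    have u': "right_ideal_hom k u'"
      unfolding u'_def using hom_comp[OF restrict_hom[OF homD(2)[OF hom(2)]] hom(1)] .
    have u'_iff: "u' x = Some y \<longleftrightarrow> u x = Some y \<and> y \<in> ran v" for x y
      by (auto simp: u'_def map_comp_Some_iff restrict_map_def split: if_splits)
    define P where "P = min_gens (dom u')"
    have P: "finite P" "P \<subseteq> words k" "prefix_code P" "ideal_of k P = dom u'"
      unfolding P_def using fg_min_gens[OF homD(1)[OF u']] prefix_code_min_gens
        ideal_of_min_gens[OF homD(3)[OF u']] by auto
    define f where "f p = (SOME z. v z = u p)" for p
    have f: "v (f p) = u p \<and> u p \<noteq> None" if "p \<in> P" for p
    proof -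
      have "p \<in> dom u'" using P(4) that subset_ideal_of by blast
      then obtain y where y: "u p = Some y" "y \<in> ran v" using u'_iff by blast
      then have "\<exists>z. v z = u p" by (auto simp: ran_def)
      then have "v (f p) = u p" unfolding f_def by (rule someI_ex)
      then show ?thesis using y by simp
    qed
    have fw: "f p \<in> words k" if "p \<in> P" for p using f[OF that] homD(6)[OF hom(2)] by (metis option.exhaust)
    define x where "x = code_hom k P f"
    have x: "right_ideal_hom k x" unfolding x_def using hom_code_hom(1)[OF P(1,3,2) fw] .
    have vx: "v (f p @ w) = u (p @ w)" "u (p @ w) \<noteq> None" if pw: "p \<in> P" "w \<in> words k" for p w
    proof -
      obtain y where "u p = Some y" "v (f p) = Some y" using f[OF pw(1)] by auto
      then have "u (p @ w) = Some (y @ w)" "v (f p @ w) = Some (y @ w)"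
        using homD(5)[OF hom(1)] homD(5)[OF hom(2)] pw(2) by blast+
      then show "v (f p @ w) = u (p @ w)" "u (p @ w) \<noteq> None" by simp_all
    qed
    have "hom_equiv k (v \<circ>\<^sub>m x) u"
    proof (rule hom_equiv_submap[OF hom_comp[OF hom(2) x] hom(1)])
      fix a b
      assume "(v \<circ>\<^sub>m x) a = Some b"
      then obtain c where c: "x a = Some c" "v c = Some b" by (auto simp: map_comp_Some_iff)
      obtain p w where p: "p \<in> P" "w \<in> words k" "a = p @ w" "c = f p @ w"
        using c(1) P(3) unfolding x_def by (rule code_hom_SomeE)
      then show "u a = Some b" using vx c by simp
    next
      show "dense_in k (dom u) (dom (v \<circ>\<^sub>m x))"
        unfolding dense_in_def
      proof
        fix a
        assume "a \<in> dom u"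
        then obtain b where b: "u a = Some b" by blast
        then obtain w where w: "w \<in> words k" "b @ w \<in> ran v" using dense_inD[OF d ranI[of u a b]] by blast
        then have "u' (a @ w) = Some (b @ w)" using u'_iff homD(5)[OF hom(1) b] by blast
        then have "a @ w \<in> ideal_of k P" using P(4) by blast
        then obtain p t where p: "p \<in> P" "t \<in> words k" "a @ w = p @ t" by (auto simp: ideal_of_def)
        then have "x (a @ w) = Some (f p @ t)" unfolding x_def using code_hom_app[OF P(3)] by simp
        then have "a @ w \<in> dom (v \<circ>\<^sub>m x)" using vx[OF p(1,2)] unfolding dom_map_comp_iff by auto
        then show "\<exists>w\<in>words k. a @ w \<in> dom (v \<circ>\<^sub>m x)" using w by blast
      qed
    qed
    then have "hom_equiv k u (v \<otimes>\<^bsub>thompson_higman k\<^esub> max_ext k x)"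
      using mult_equiv[OF hom_equiv_refl[OF hom(2)] hom_equiv_sym[OF max_ext_equiv[OF x]]]
        hom_equiv_trans hom_equiv_sym by blast
    moreover have "v \<otimes>\<^bsub>thompson_higman k\<^esub> max_ext k x \<in> carrier (thompson_higman k)"
      using mult_in_carrier[OF hom(2)] max_ext_in_carrier[OF x] carrier_iff by blast
    ultimately have "u = v \<otimes>\<^bsub>thompson_higman k\<^esub> max_ext k x" using carrier_eqI[OF u] by blast
    then show "R_le (thompson_higman k) u v"
      unfolding R_le_def using max_ext_in_carrier[OF x] by blast
  }
qed

text \<open>If \<open>v = y x v\<close> then \<open>x\<close> is injective on the image of \<open>v\<close>, hence maps its prefix code
  bijectively onto a prefix code.\<close>

lemma L_equiv_class:
  assumes u: "u \<in> carrier (thompson_higman k)" and v: "v \<in> carrier (thompson_higman k)" and k: "k \<ge> 1"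
    and L: "L_equiv (thompson_higman k) u v"
  shows "ideal_class k (ran u) = ideal_class k (ran v)"
proof -
  have hom: "right_ideal_hom k u" "right_ideal_hom k v" using u v by (auto simp: carrier_iff)
  obtain x y where x: "x \<in> carrier (thompson_higman k)" "u = x \<otimes>\<^bsub>thompson_higman k\<^esub> v"
    and y: "y \<in> carrier (thompson_higman k)" "v = y \<otimes>\<^bsub>thompson_higman k\<^esub> u"
    using L by (auto simp: L_equiv_def L_le_def)
  have hx: "right_ideal_hom k x" "right_ideal_hom k y" using x y by (auto simp: carrier_iff)
  have ux: "hom_equiv k u (x \<circ>\<^sub>m v)" using mult_equiv[OF hom_equiv_refl[OF hx(1)] hom_equiv_refl[OF hom(2)]] x by simp
  have vy: "hom_equiv k v (y \<circ>\<^sub>m (x \<circ>\<^sub>m v))"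
    using mult_equiv[OF hom_equiv_refl[OF hx(2)] ux] y by simp
  have retract: "\<exists>w\<in>words k. \<exists>c. x (q @ w) = Some c \<and> y c = Some (q @ w)" if q: "q \<in> ran v" for q
  proof -
    obtain p where p: "v p = Some q" using q by (auto simp: ran_def)
    then obtain w where w: "w \<in> words k" "p @ w \<in> dom (y \<circ>\<^sub>m (x \<circ>\<^sub>m v))"
      using vy unfolding hom_equiv_iff dense_in_def by blast
    then obtain z where z: "(y \<circ>\<^sub>m (x \<circ>\<^sub>m v)) (p @ w) = Some z" by blast
    have v': "v (p @ w) = Some (q @ w)" using homD(5)[OF hom(2) p w(1)] .
    then have "z = q @ w" using vy z unfolding hom_equiv_iff by metis
    then show ?thesis using z v' w by (auto simp: map_comp_Some_iff)
  qed
  \<comment> \<open>Injectivity of \<open>x\<close> is known only on the image of \<open>v\<close>,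
    so \<open>x\<close> is restricted to it.\<close>
  define x' where "x' = x \<circ>\<^sub>m (Some |` ran v)"
  have x': "right_ideal_hom k x'"
    unfolding x'_def using hom_comp[OF hx(1) restrict_hom[OF homD(2)[OF hom(2)]]] .
  have x'_iff: "x' q = Some c \<longleftrightarrow> q \<in> ran v \<and> x q = Some c" for q c
    by (auto simp: x'_def map_comp_Some_iff restrict_map_def split: if_splits)
  \<comment> \<open>Two successive extensions make \<open>y\<close> recover both words. The two
    images under \<open>x\<close> agree after the common suffix, so \<open>q\<close> and
    \<open>q'\<close> agree before it.\<close>
  have inj: "q = q'" if "x' q = Some c" "x' q' = Some c" for q q' c
  proof -
    have c: "q \<in> ran v" "q' \<in> ran v" "x q = Some c" "x q' = Some c" using that x'_iff by auto
    obtain w d where w: "w \<in> words k" "x (q @ w) = Some d" "y d = Some (q @ w)" using retract[OF c(1)] by blast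
    have "q' @ w \<in> ran v" using right_ideal_append[OF homD(4)[OF hom(2)] c(2) w(1)] .
    then obtain t e where t: "t \<in> words k" "x (q' @ w @ t) = Some e" "y e = Some (q' @ w @ t)"
      using retract[of "q' @ w"] by auto
    have "d = c @ w" using homD(5)[OF hx(1) c(3) w(1)] w(2) by simp
    moreover have "e = c @ w @ t" using homD(5)[OF hx(1) c(4), of "w @ t"] w(1) t by simp
    ultimately have "y e = Some (q @ w @ t)" using homD(5)[OF hx(2) w(3) t(1)] by simp
    then show ?thesis using t(3) by simp
  qed
  have dom': "ideal_equiv k (dom x') (ran v)"
  proof -
    have "dom x' \<subseteq> ran v" using x'_iff by blast
    moreover have "dense_in k (ran v) (dom x')"
      unfolding dense_in_def
    proof
      fix q
      assume q: "q \<in> ran v"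
      then obtain w c where w: "w \<in> words k" "x (q @ w) = Some c" using retract by blast
      then have "x' (q @ w) = Some c" using x'_iff right_ideal_append[OF homD(4)[OF hom(2)] q w(1)] by blast
      then show "\<exists>w\<in>words k. q @ w \<in> dom x'" using w by blast
    qed
    ultimately show ?thesis by (simp add: ideal_equiv_def dense_in_subset)
  qed
  have "ran x' = ran (x \<circ>\<^sub>m v)"
    unfolding ran_def by (auto simp: x'_iff map_comp_Some_iff, auto simp: ran_def)
  then have "ideal_equiv k (ran u) (ran x')" using hom_equiv_ran[OF ux] by simp
  then have 1: "ideal_class k (ran u) = ideal_class k (ran x')"
    using ideal_class_cong[OF homD(2)[OF hom(1)] homD(2)[OF x'] _ k] by blast
  have 2: "ideal_class k (dom x') = ideal_class k (ran v)"
    using ideal_class_cong[OF homD(1)[OF x'] homD(2)[OF hom(2)] dom' k] .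
  define P where "P = min_gens (dom x')"
  have P: "finite P" "P \<subseteq> words k" "prefix_code P" "ideal_of k P = dom x'"
    unfolding P_def using fg_min_gens[OF homD(1)[OF x']] prefix_code_min_gens
      ideal_of_min_gens[OF homD(3)[OF x']] by auto
  define g where "g p = the (x' p)" for p
  have g: "x' p = Some (g p)" if "p \<in> P" for p
  proof -
    have "p \<in> dom x'" using P(4) that subset_ideal_of by blast
    then show ?thesis unfolding g_def by auto
  qed
  have ran: "ran x' = ideal_of k (g ` P)"
    unfolding g_def using ran_generated[OF homD(5)[OF x'] P(4)[symmetric]] .
  have gw: "g ` P \<subseteq> words k" using g homD(7)[OF x'] by blast
  have "prefix_code (g ` P)"
    unfolding prefix_code_def
  proof (intro ballI notI)
    fix a b
    assume "a \<in> g ` P" "b \<in> g ` P" "strict_prefix a b"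
    then obtain p q w where pq: "p \<in> P" "q \<in> P" "g q = g p @ w" "w \<noteq> []"
      by (auto simp: strict_prefix_def prefix_def)
    have "g p @ w \<in> words k" using subsetD[OF gw imageI[OF pq(2)]] pq(3) by simp
    then have w: "w \<in> words k" by simp
    have "x' (p @ w) = Some (g q)" using homD(5)[OF x' g[OF pq(1)] w] pq(3) by simp
    then have "p @ w = q" using inj g[OF pq(2)] by blast
    then show False using prefix_code_unique[OF P(3) pq(1,2), of w "[]"] pq(4) by simp
  qed
  then have "min_gens (ran x') = g ` P"
    unfolding ran using min_gens_ideal_of[OF gw] min_gens_prefix_code by blast
  moreover have "inj_on g P" using inj g by (metis inj_onI)
  ultimately have "card (min_gens (ran x')) = card P" by (simp add: card_image)
  moreover have "ran x' = {} \<longleftrightarrow> dom x' = {}" by (auto simp: ran_def dom_def, metis not_Some_eq)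
  ultimately have "ideal_class k (ran x') = ideal_class k (dom x')" by (simp add: ideal_class_def P_def)
  then show ?thesis using 1 2 by simp
qed

lemma D_equiv_iff:
  assumes u: "u \<in> carrier (thompson_higman k)" and v: "v \<in> carrier (thompson_higman k)" and k: "k \<ge> 1"
  shows "D_equiv (thompson_higman k) u v \<longleftrightarrow> ideal_class k (ran u) = ideal_class k (ran v)"
proof
  have hom: "right_ideal_hom k u" "right_ideal_hom k v" using u v by (auto simp: carrier_iff)
  {
    assume "D_equiv (thompson_higman k) u v"
    then obtain s where s: "s \<in> carrier (thompson_higman k)" "R_equiv (thompson_higman k) u s"
      "L_equiv (thompson_higman k) s v" by (auto simp: D_equiv_def)
    have hs: "right_ideal_hom k s" using s(1) by (simp add: carrier_iff)
    have "ideal_equiv k (ran u) (ran s)"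
      using s(2) R_le_iff u s(1) by (simp add: R_equiv_def ideal_equiv_def)
    then have "ideal_class k (ran u) = ideal_class k (ran s)"
      using ideal_class_cong[OF homD(2)[OF hom(1)] homD(2)[OF hs] _ k] by blast
    then show "ideal_class k (ran u) = ideal_class k (ran v)" using L_equiv_class[OF s(1) v k s(3)] by simp
  next
    assume "ideal_class k (ran u) = ideal_class k (ran v)"
    then obtain Q P where Q: "finite Q" "prefix_code Q" "Q \<subseteq> ran u" "ideal_equiv k (ideal_of k Q) (ran u)"
      and P: "finite P" "prefix_code P" "P \<subseteq> ran v" "ideal_equiv k (ideal_of k P) (ran v)"
      and card: "card P = card Q"
      using equal_card_codes[OF homD(2)[OF hom(1)] homD(2)[OF hom(2)] _ k] by metis
    obtain b where b: "bij_betw b P Q" using finite_same_card_bij[OF P(1) Q(1) card] by blast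
    define b' where "b' = the_inv_into P b"
    have b': "b' q \<in> P" "b (b' q) = q" if "q \<in> Q" for q
      using that b f_the_inv_into_f_bij_betw[OF b] the_inv_into_into[of b P q P]
      unfolding b'_def bij_betw_def by auto
    have bb: "b p \<in> Q" "b' (b p) = p" if "p \<in> P" for p
      using that b the_inv_into_f_f[of b P p] unfolding b'_def bij_betw_def by auto
    have words: "P \<subseteq> words k" "Q \<subseteq> words k"
      using P(3) Q(3) right_ideal_subset_words homD(4)[OF hom(1)] homD(4)[OF hom(2)] by blast+
    define x where "x = code_hom k P b"
    define y where "y = code_hom k Q b'"
    have x: "right_ideal_hom k x" unfolding x_def using hom_code_hom(1)[OF P(1,2) words(1)] bb words by blast
    have y: "right_ideal_hom k y" unfolding y_def using hom_code_hom(1)[OF Q(1,2) words(2)] b' words by blast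
    \<comment> \<open>The linking element is \<open>v\<close> followed by the bijection from a code
      of its image to a code for the image of \<open>u\<close>. Its image is essentially that of
      \<open>u\<close>, which gives the R-part; \<open>y\<close> undoes \<open>x\<close> on
      \<open>ideal_of k P\<close>, which gives the L-part.\<close>
    define s where "s = max_ext k (x \<circ>\<^sub>m v)"
    have s: "s \<in> carrier (thompson_higman k)" unfolding s_def using max_ext_in_carrier[OF hom_comp[OF x hom(2)]] .
    have hs: "right_ideal_hom k s" using s by (simp add: carrier_iff)
    have se: "hom_equiv k (x \<circ>\<^sub>m v) s" unfolding s_def using max_ext_equiv[OF hom_comp[OF x hom(2)]] .
    have xe: "hom_equiv k (max_ext k x) x" "hom_equiv k (max_ext k y) y"
      using max_ext_equiv[OF x] max_ext_equiv[OF y] hom_equiv_sym by blast+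
    have mx: "max_ext k x \<in> carrier (thompson_higman k)" "max_ext k y \<in> carrier (thompson_higman k)"
      using max_ext_in_carrier x y by blast+
    have L1: "L_le (thompson_higman k) s v"
    proof -
      have "hom_equiv k s (max_ext k x \<otimes>\<^bsub>thompson_higman k\<^esub> v)"
        using mult_equiv[OF xe(1) hom_equiv_refl[OF hom(2)]] se hom_equiv_sym hom_equiv_trans by blast
      moreover have "max_ext k x \<otimes>\<^bsub>thompson_higman k\<^esub> v \<in> carrier (thompson_higman k)"
        using mult_in_carrier mx hom(2) carrier_iff by blast
      ultimately have "s = max_ext k x \<otimes>\<^bsub>thompson_higman k\<^esub> v" using carrier_eqI[OF s] by blast
      then show ?thesis unfolding L_le_def using mx by blast
    qed
    have yx: "y (b p @ w) = Some (p @ w)" "x (p @ w) = Some (b p @ w)" if "p \<in> P" "w \<in> words k" for p w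
      using that code_hom_app[OF Q(2) bb(1)[OF that(1)] that(2), of b'] code_hom_app[OF P(2) that, of b] bb
      by (simp_all add: x_def y_def)
    have "hom_equiv k (y \<circ>\<^sub>m (x \<circ>\<^sub>m v)) v"
    proof (rule hom_equiv_submap[OF hom_comp[OF y hom_comp[OF x hom(2)]] hom(2)])
      fix a c
      assume "(y \<circ>\<^sub>m (x \<circ>\<^sub>m v)) a = Some c"
      then obtain d e where d: "v a = Some d" "x d = Some e" "y e = Some c" by (auto simp: map_comp_Some_iff)
      obtain p w where p: "p \<in> P" "w \<in> words k" "d = p @ w" "e = b p @ w"
        using d(2) P(2) unfolding x_def by (rule code_hom_SomeE)
      then show "v a = Some c" using yx(1)[OF p(1,2)] d by simp
    next
      show "dense_in k (dom v) (dom (y \<circ>\<^sub>m (x \<circ>\<^sub>m v)))"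
        unfolding dense_in_def
      proof
        fix a
        assume "a \<in> dom v"
        then obtain d where d: "v a = Some d" by blast
        then obtain w where w: "w \<in> words k" "d @ w \<in> ideal_of k P"
          using P(4) ranI[of v a d] unfolding ideal_equiv_def dense_in_def by blast
        then obtain p t where p: "p \<in> P" "t \<in> words k" "d @ w = p @ t" by (auto simp: ideal_of_def)
        have "v (a @ w) = Some (p @ t)" using homD(5)[OF hom(2) d w(1)] p(3) by simp
        then have "(y \<circ>\<^sub>m (x \<circ>\<^sub>m v)) (a @ w) = Some (p @ t)" using yx[OF p(1,2)] by (simp add: map_comp_def)
        then show "\<exists>w\<in>words k. a @ w \<in> dom (y \<circ>\<^sub>m (x \<circ>\<^sub>m v))" using w(1) by blast
      qed
    qed
    then have L2': "hom_equiv k v (max_ext k y \<otimes>\<^bsub>thompson_higman k\<^esub> s)"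
      using mult_equiv[OF xe(2) hom_equiv_sym[OF se]] hom_equiv_sym hom_equiv_trans by blast
    have "max_ext k y \<otimes>\<^bsub>thompson_higman k\<^esub> s \<in> carrier (thompson_higman k)"
      using mult_in_carrier mx hs carrier_iff by blast
    then have "v = max_ext k y \<otimes>\<^bsub>thompson_higman k\<^esub> s" using carrier_eqI[OF v] L2' by blast
    then have L2: "L_le (thompson_higman k) v s" unfolding L_le_def using mx by blast
    have "ideal_equiv k (ran u) (ran (x \<circ>\<^sub>m v))"
    proof -
      have "ran (x \<circ>\<^sub>m v) \<subseteq> ran u"
      proof
        fix c
        assume "c \<in> ran (x \<circ>\<^sub>m v)"
        then obtain d where "x d = Some c" by (auto simp: ran_def map_comp_Some_iff)
        then obtain p w where "p \<in> P" "w \<in> words k" "c = b p @ w"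
          using P(2) unfolding x_def by (rule code_hom_SomeE)
        then show "c \<in> ran u" using right_ideal_append[OF homD(4)[OF hom(1)]] bb Q(3) by blast
      qed
      moreover have "dense_in k (ran u) (ran (x \<circ>\<^sub>m v))"
        unfolding dense_in_def
      proof
        fix c
        assume "c \<in> ran u"
        then obtain w where w: "w \<in> words k" "c @ w \<in> ideal_of k Q"
          using Q(4) unfolding ideal_equiv_def dense_in_def by blast
        then obtain q t where q: "q \<in> Q" "t \<in> words k" "c @ w = q @ t" by (auto simp: ideal_of_def)
        then have "b' q \<in> ran v" using b' P(3) by blast
        then obtain a where "v a = Some (b' q)" by (auto simp: ran_def)
        then have "v (a @ t) = Some (b' q @ t)" using homD(5)[OF hom(2)] q(2) by blast
        then have "(x \<circ>\<^sub>m v) (a @ t) = Some (c @ w)" using yx(2)[OF b'(1)[OF q(1)] q(2)] b'(2)[OF q(1)] q(3)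
          by (simp add: map_comp_def)
        then show "\<exists>w\<in>words k. c @ w \<in> ran (x \<circ>\<^sub>m v)" using w(1) ranI by metis
      qed
      ultimately show ?thesis by (simp add: ideal_equiv_def dense_in_subset)
    qed
    then have "ideal_equiv k (ran u) (ran s)" using hom_equiv_ran[OF se] ideal_equiv_trans by blast
    then have "R_equiv (thompson_higman k) u s"
      using R_le_iff u s by (simp add: R_equiv_def ideal_equiv_def)
    then show "D_equiv (thompson_higman k) u v"
      unfolding D_equiv_def L_equiv_def using s L1 L2 by blast
  }
qed

section \<open>Products of generators\<close>

definition ideal_image :: "word_map \<Rightarrow> word set \<Rightarrow> word set" where
  "ideal_image \<psi> R = {y. \<exists>x\<in>R. \<psi> x = Some y}"

text \<open>This permits evaluating a product factor by factor on ideals alone, starting from any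
  ideal essentially equal to the image of the right factor.\<close>

lemma mult_ideal_equiv:
  assumes hom: "right_ideal_hom k \<psi>" "right_ideal_hom k \<phi>" and R: "ideal_equiv k R (ran \<phi>)"
  shows "ideal_equiv k (ideal_image \<psi> R) (ran (\<psi> \<otimes>\<^bsub>thompson_higman k\<^esub> \<phi>))"
proof -
  have e: "hom_equiv k (\<psi> \<circ>\<^sub>m \<phi>) (\<psi> \<otimes>\<^bsub>thompson_higman k\<^esub> \<phi>)"
    using mult_equiv[OF hom_equiv_refl[OF hom(1)] hom_equiv_refl[OF hom(2)]] hom_equiv_sym by blast
  have d: "dense_in k (ideal_image \<psi> A) (ideal_image \<psi> B)" if AB: "dense_in k A B" for A B
    unfolding dense_in_def
  proof
    fix y
    assume "y \<in> ideal_image \<psi> A"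
    then obtain x where x: "x \<in> A" "\<psi> x = Some y" by (auto simp: ideal_image_def)
    then obtain w where w: "w \<in> words k" "x @ w \<in> B" using AB by (auto simp: dense_in_def)
    then have "y @ w \<in> ideal_image \<psi> B" using homD(5)[OF hom(1) x(2) w(1)] by (auto simp: ideal_image_def)
    then show "\<exists>w\<in>words k. y @ w \<in> ideal_image \<psi> B" using w(1) by blast
  qed
  have "ran (\<psi> \<circ>\<^sub>m \<phi>) = ideal_image \<psi> (ran \<phi>)"
    by (auto simp: ideal_image_def ran_def map_comp_Some_iff)
  then have "ideal_equiv k (ideal_image \<psi> R) (ran (\<psi> \<circ>\<^sub>m \<phi>))"
    using d[of R "ran \<phi>"] d[of "ran \<phi>" R] R by (simp add: ideal_equiv_def)
  then show ?thesis using hom_equiv_ran[OF e] ideal_equiv_trans by blast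
qed

lemma one_in_carrier: "\<one>\<^bsub>thompson_higman k\<^esub> \<in> carrier (thompson_higman k)"
proof -
  have w: "words k = ideal_of k {[]}" by (auto simp: ideal_of_def)
  have fg: "fg_right_ideal k (words k)" unfolding fg_right_ideal_def
    by (rule exI[of _ "{[]}"]) (simp add: w[symmetric])
  have hom: "right_ideal_hom k (Some |` words k)" by (rule restrict_hom[OF fg])
  have "dom (saturation k (Some |` words k)) \<subseteq> dom (Some |` words k)"
    by (auto simp: saturation_Some extends_at_def)
  then have "saturation k (Some |` words k) = Some |` words k"
    using saturation_greatest[OF hom_equiv_refl[OF hom]] by (metis map_le_def map_le_antisym subsetD)
  then show ?thesis using hom max_ext_eq[OF hom] by (simp add: carrier_iff thompson_higman_def)
qed

section \<open>Iterated transducers\<close>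

text \<open>\<open>Read\<close> pops the first tape; \<open>Push\<close> and \<open>Write\<close>
  put pending output on the second, the flag telling whether the end of the string has been reached.
  \<open>Return\<close> and \<open>Restore\<close> pour the second tape back onto the first, which
  undoes the reversal of the output.\<close>

datatype ('q, 'c) control =
  Read 'q | Push bool 'q "'c list" | Write bool 'q 'c "'c list" | Return 'q | Restore 'q 'c
| Accept | Reject

instance control :: (countable, countable) countable
  by countable_datatype

text \<open>An original input symbol and the \<open>Aux\<close> code written later by the machine
  stand for the same transducer symbol, so the input needs no preliminary translation. The value at
  \<open>Blank\<close> is a dummy.\<close>

fun stack_symbol :: "('i \<Rightarrow> 'c::countable) \<Rightarrow> 'i tape_symbol \<Rightarrow> 'c" where
  "stack_symbol inp (Input i) = inp i"
| "stack_symbol inp (Aux n) = from_nat n"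
| "stack_symbol inp Blank = undefined"

text \<open>A tape holds a stack from its head to the right, with blanks everywhere else.\<close>

definition holds :: "('i \<Rightarrow> 'c::countable) \<Rightarrow> 'c list \<Rightarrow> 'i tape \<Rightarrow> bool" where
  "holds inp xs t \<longleftrightarrow> (case t of (l, a, r) \<Rightarrow> set l \<subseteq> {Blank} \<and>
     (\<exists>ys zs. a # r = ys @ zs \<and> set zs \<subseteq> {Blank} \<and> Blank \<notin> set ys \<and> map (stack_symbol inp) ys = xs))"

lemma holdsE:
  assumes "holds inp xs t"
  obtains l a r ys zs where "t = (l, a, r)" "set l \<subseteq> {Blank}" "a # r = ys @ zs" "set zs \<subseteq> {Blank}"
    "Blank \<notin> set ys" "map (stack_symbol inp) ys = xs"
proof (cases t)
  case (fields l a r)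
  then obtain ys zs where "set l \<subseteq> {Blank}" "a # r = ys @ zs" "set zs \<subseteq> {Blank}"
    "Blank \<notin> set ys" "map (stack_symbol inp) ys = xs"
    using assms unfolding holds_def by (simp only: prod.case) blast
  then show ?thesis using that fields by blast
qed

lemma holds_read_tape:
  assumes "holds inp xs t"
  shows "read_tape t = Blank \<longleftrightarrow> xs = []"
    and "xs \<noteq> [] \<Longrightarrow> stack_symbol inp (read_tape t) = hd xs"
proof -
  obtain l a r ys zs where t: "t = (l, a, r)" "a # r = ys @ zs" "set zs \<subseteq> {Blank}"
    "Blank \<notin> set ys" "map (stack_symbol inp) ys = xs"
    using assms by (rule holdsE)
  show "read_tape t = Blank \<longleftrightarrow> xs = []"
    using t by (cases ys) auto
  show "xs \<noteq> [] \<Longrightarrow> stack_symbol inp (read_tape t) = hd xs"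
    using t by (cases ys) auto
qed

lemma holds_pop:
  assumes "holds inp (x # xs) t"
  shows "holds inp xs (act_tape (Blank, MoveRight) t)"
proof -
  obtain l a r ys zs where t: "t = (l, a, r)" "set l \<subseteq> {Blank}" "a # r = ys @ zs"
    "set zs \<subseteq> {Blank}" "Blank \<notin> set ys" "map (stack_symbol inp) ys = x # xs"
    using assms by (rule holdsE)
  then obtain ys' where ys: "ys = a # ys'" by (cases ys) auto
  then have r: "r = ys' @ zs" using t by simp
  show ?thesis
  proof (cases r)
    case Nil
    then show ?thesis using t ys r by (auto simp: holds_def intro!: exI[of _ "[]"])
  next
    case (Cons c r')
    then have "c # r' = ys' @ zs \<and> set zs \<subseteq> {Blank} \<and> Blank \<notin> set ys' \<and> map (stack_symbol inp) ys' = xs"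
      using t ys r by simp
    then have "holds inp xs (Blank # l, c, r')"
      using t(2) unfolding holds_def prod.case by (intro conjI exI[of _ ys'] exI[of _ zs]) auto
    then show ?thesis using t Cons by simp
  qed
qed

text \<open>A machine step writes before it moves. A push therefore takes two steps: a move to the
  left that rewrites the old top unchanged, then a write in place.\<close>

lemma holds_push:
  assumes "holds inp xs t" "s \<noteq> Blank" "stack_symbol inp s = x" "b = read_tape t"
  shows "holds inp (x # xs) (act_tape (s, Stay) (act_tape (b, MoveLeft) t))"
proof -
  obtain l a r ys zs where t: "t = (l, a, r)" "set l \<subseteq> {Blank}" "a # r = ys @ zs"
    "set zs \<subseteq> {Blank}" "Blank \<notin> set ys" "map (stack_symbol inp) ys = xs"
    using assms(1) by (rule holdsE)
  have h: "holds inp (x # xs) (l', s, a # r)" if "set l' \<subseteq> {Blank}" for l'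
    using that t assms unfolding holds_def prod.case
    by (intro conjI exI[of _ "s # ys"] exI[of _ zs]) auto
  show ?thesis using t(1,2) h[of "[]"] h[of "tl l"] assms(4) by (cases l) auto
qed

lemma act_tape_read [simp]: "act_tape (read_tape t, Stay) t = t"
  by (cases t) simp

text \<open>Finiteness is asked of the sets \<open>Q\<close> and \<open>C\<close>, since the natural
  state types are infinite; countability of the types serves to code states and symbols as numbers.
  The input \<open>None\<close> of \<open>\<delta>\<close> is the end of the string.\<close>

locale transducer =
  fixes \<delta> :: "'q::countable \<Rightarrow> 'c::countable option \<Rightarrow> 'q \<times> 'c list"
    and halt :: "'q \<Rightarrow> bool option"
    and start :: 'q
    and inp :: "'i \<Rightarrow> 'c"
    and Q :: "'q set" and C :: "'c set" and \<Sigma> :: "'i set"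
  assumes finite_Q: "finite Q" and finite_C: "finite C" and finite_\<Sigma>: "finite \<Sigma>"
    and start: "start \<in> Q" and inp: "inp ` \<Sigma> \<subseteq> C"
    and closed: "\<And>q x. q \<in> Q \<Longrightarrow> x \<in> insert None (Some ` C) \<Longrightarrow> fst (\<delta> q x) \<in> Q \<and> set (snd (\<delta> q x)) \<subseteq> C"
begin

fun pass :: "'q \<Rightarrow> 'c list \<Rightarrow> 'q \<times> 'c list" where
  "pass q [] = \<delta> q None"
| "pass q (x # s) = (let (q', out) = \<delta> q (Some x); (q'', out') = pass q' s in (q'', out @ out'))"

text \<open>The verdict \<open>b\<close> comes within \<open>n\<close> passes while all strings have
  length at most \<open>B\<close>. As a predicate with upper bounds it is monotone in both, so
  estimates may be relaxed freely. A verdict takes effect only after a complete pass.\<close>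

fun run :: "nat \<Rightarrow> nat \<Rightarrow> 'q \<Rightarrow> 'c list \<Rightarrow> bool \<Rightarrow> bool" where
  "run B 0 q s b = False"
| "run B (Suc n) q s b = (length s \<le> B \<and> (let (q', s') = pass q s in length s' \<le> B \<and>
     (case halt q' of Some b' \<Rightarrow> b' = b | None \<Rightarrow> run B n q' s' b)))"

lemma run_mono:
  assumes "run B n q s b" "B \<le> B'" "n \<le> n'"
  shows "run B' n' q s b"
  using assms
proof (induction n arbitrary: n' q s)
  case (Suc n)
  then obtain m where "n' = Suc m" "n \<le> m" by (cases n') auto
  then show ?case using Suc by (auto split: option.splits prod.splits)
qed simp

section \<open>Simulation by a two-tape machine\<close>

fun action ::
    "('q, 'c) control \<Rightarrow> 'i tape_symbol \<Rightarrow> 'i tape_symbol \<Rightarrow>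
     ('q, 'c) control \<times> ('i tape_symbol \<times> head_move) \<times> ('i tape_symbol \<times> head_move)" where
  "action (Read q) a b =
     (let (q', out) = \<delta> q (if a = Blank then None else Some (stack_symbol inp a))
      in (Push (a = Blank) q' out, (Blank, if a = Blank then Stay else MoveRight), (b, Stay)))"
| "action (Push e q (c # cs)) a b = (Write e q c cs, (a, Stay), (b, MoveLeft))"
| "action (Write e q c cs) a b = (Push e q cs, (a, Stay), (Aux (to_nat c), Stay))"
| "action (Push e q []) a b =
     (if \<not> e then Read q
      else case halt q of None \<Rightarrow> Return q | Some v \<Rightarrow> if v then Accept else Reject,
      (a, Stay), (b, Stay))"
| "action (Return q) a b =
     (if b = Blank then (Read q, (a, Stay), (b, Stay))
      else (Restore q (stack_symbol inp b), (a, MoveLeft), (Blank, MoveRight)))"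
| "action (Restore q c) a b = (Return q, (Aux (to_nat c), Stay), (b, Stay))"
| "action s a b = (s, (a, Stay), (b, Stay))"

text \<open>\<open>Push\<close> carries the output still to be written, so a uniform bound on its
  length is what keeps the set of control states finite.\<close>

definition out_bound :: nat where
  "out_bound = (SOME K. \<forall>q\<in>Q. \<forall>x\<in>insert None (Some ` C). length (snd (\<delta> q x)) \<le> K)"

lemma length_out:
  assumes "q \<in> Q" "x \<in> insert None (Some ` C)"
  shows "length (snd (\<delta> q x)) \<le> out_bound"
proof -
  have "finite ((\<lambda>(q, x). length (snd (\<delta> q x))) ` (Q \<times> insert None (Some ` C)))" (is "finite ?S")
    using finite_Q finite_C by auto
  then have "\<exists>K. \<forall>l\<in>?S. l \<le> K"
    using finite_nat_set_iff_bounded_le by blast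
  then have "\<exists>K. \<forall>q\<in>Q. \<forall>x\<in>insert None (Some ` C). length (snd (\<delta> q x)) \<le> K"
    by auto
  from someI_ex[OF this] show ?thesis using assms unfolding out_bound_def by blast
qed

definition outs :: "'c list set" where
  "outs = {cs. set cs \<subseteq> C \<and> length cs \<le> out_bound}"

fun control_in :: "('q, 'c) control \<Rightarrow> bool" where
  "control_in (Read q) \<longleftrightarrow> q \<in> Q"
| "control_in (Push e q cs) \<longleftrightarrow> q \<in> Q \<and> cs \<in> outs"
| "control_in (Write e q c cs) \<longleftrightarrow> q \<in> Q \<and> c \<in> C \<and> cs \<in> outs"
| "control_in (Return q) \<longleftrightarrow> q \<in> Q"
| "control_in (Restore q c) \<longleftrightarrow> q \<in> Q \<and> c \<in> C"
| "control_in Accept \<longleftrightarrow> True"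
| "control_in Reject \<longleftrightarrow> True"

definition controls :: "('q, 'c) control set" where
  "controls = {s. control_in s}"

lemma finite_controls: "finite controls"
proof (rule finite_subset)
  show "controls \<subseteq> {Accept, Reject} \<union> Read ` Q \<union> Return ` Q \<union> (\<lambda>(q, c). Restore q c) ` (Q \<times> C)
     \<union> (\<lambda>(e, q, cs). Push e q cs) ` (UNIV \<times> Q \<times> outs)
     \<union> (\<lambda>(e, q, c, cs). Write e q c cs) ` (UNIV \<times> Q \<times> C \<times> outs)" (is "_ \<subseteq> ?S")
  proof
    fix s
    assume "s \<in> controls"
    then have "control_in s" by (simp add: controls_def)
    then show "s \<in> ?S" by (cases s) (simp_all add: image_iff)
  qed
  have "finite outs" unfolding outs_def by (rule finite_lists_length_le[OF finite_C])
  then show "finite ?S" using finite_Q finite_C by simp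
qed

definition alphabet :: "'i tape_symbol set" where
  "alphabet = insert Blank (Input ` \<Sigma> \<union> (Aux \<circ> to_nat) ` C)"

lemma alphabet_stack_symbol:
  "a \<in> alphabet \<Longrightarrow> a \<noteq> Blank \<Longrightarrow> stack_symbol inp a \<in> C"
  using inp unfolding alphabet_def by auto

lemma action_closed:
  assumes "s \<in> controls" "a \<in> alphabet" "b \<in> alphabet" "action s a b = (s', (a', d), (b', e))"
  shows "s' \<in> controls" "a' \<in> alphabet" "b' \<in> alphabet"
proof -
  have *: "c \<in> C \<Longrightarrow> Aux (to_nat c) \<in> alphabet" for c by (auto simp: alphabet_def)
  have blank: "Blank \<in> alphabet" by (simp add: alphabet_def)
  have "s' \<in> controls \<and> a' \<in> alphabet \<and> b' \<in> alphabet"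
  proof (cases s)
    case (Read q)
    define x where "x = (if a = Blank then None else Some (stack_symbol inp a))"
    have x: "x \<in> insert None (Some ` C)"
      using alphabet_stack_symbol[OF assms(2)] by (auto simp: x_def)
    have q: "q \<in> Q" using assms(1) Read by (auto simp: controls_def)
    have "fst (\<delta> q x) \<in> Q" "snd (\<delta> q x) \<in> outs"
      using closed[OF q x] length_out[OF q x] by (auto simp: outs_def)
    then have "Push e' (fst (\<delta> q x)) (snd (\<delta> q x)) \<in> controls" for e'
      by (simp add: controls_def)
    then show ?thesis using assms Read blank
      by (auto simp: x_def[symmetric] split: prod.splits if_splits)
  next
    case (Push e' q cs)
    then have q: "q \<in> Q" "cs \<in> outs" using assms(1) by (auto simp: controls_def)
    show ?thesis
    proof (cases cs)
      case Nil
      then show ?thesis using assms Push q by (auto simp: controls_def split: option.splits)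
    next
      case (Cons c cs')
      then have "c \<in> C" "cs' \<in> outs" using q by (auto simp: outs_def)
      then have "Write e' q c cs' \<in> controls" using q by (simp add: controls_def)
      then show ?thesis using assms Push Cons by auto
    qed
  next
    case (Write e' q c cs)
    then have q: "q \<in> Q" "cs \<in> outs" "c \<in> C" using assms(1) by (auto simp: controls_def)
    then have "Push e' q cs \<in> controls" by (simp add: controls_def)
    then show ?thesis using assms Write * q by auto
  next
    case (Return q)
    then have q: "q \<in> Q" using assms(1) by (auto simp: controls_def)
    then have "b \<noteq> Blank \<Longrightarrow> Restore q (stack_symbol inp b) \<in> controls"
      using alphabet_stack_symbol[OF assms(3)] by (simp add: controls_def)
    moreover have "Read q \<in> controls" using q by (auto simp: controls_def)
    ultimately show ?thesis using assms Return blank by (auto split: if_splits)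
  next
    case (Restore q c)
    then show ?thesis using assms * by (auto simp: controls_def)
  qed (use assms in auto)
  then show "s' \<in> controls" "a' \<in> alphabet" "b' \<in> alphabet" by auto
qed

definition machine :: "'i turing_machine" where
  "machine = \<lparr> num_tapes = 2, tape_alphabet = alphabet, states = to_nat ` controls,
     start_state = to_nat (Read start :: ('q, 'c) control),
     accept_state = to_nat (Accept :: ('q, 'c) control),
     reject_state = to_nat (Reject :: ('q, 'c) control),
     transition = (\<lambda>n as. case action (from_nat n) (as ! 0) (as ! 1) of
        (s, x, y) \<Rightarrow> (to_nat s, [x, y])) \<rparr>"

lemma machine_over: "turing_machine_over \<Sigma> machine"
proof -
  have "finite alphabet" using finite_C finite_\<Sigma> by (simp add: alphabet_def)
  moreover have "(case transition machine q as of (q', acts) \<Rightarrow>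
           q' \<in> states machine \<and> length acts = num_tapes machine \<and>
           (\<forall>(b, d)\<in>set acts. b \<in> tape_alphabet machine))"
    if q: "q \<in> states machine" and as: "as \<in> lists (tape_alphabet machine)"
      "length as = num_tapes machine" for q as
  proof -
    obtain a b where ab: "as = [a, b]" using as(2)
      by (auto simp: machine_def numeral_2_eq_2 length_Suc_conv)
    then have abA: "a \<in> alphabet" "b \<in> alphabet" using as by (auto simp: machine_def)
    obtain s where s: "s \<in> controls" "q = to_nat s" using q by (auto simp: machine_def)
    obtain s' a' d b' e where act: "action s a b = (s', (a', d), (b', e))"
      by (cases "action s a b") auto
    show ?thesis using action_closed[OF s(1) abA act] act s ab by (auto simp: machine_def)
  qed
  ultimately show ?thesis
    using finite_controls start unfolding turing_machine_over_def
    by (auto simp: machine_def alphabet_def controls_def)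
qed

definition config :: "('q, 'c) control \<Rightarrow> 'i tape \<Rightarrow> 'i tape \<Rightarrow> nat \<times> 'i tape list" where
  "config s t1 t2 = (to_nat s, [t1, t2])"

lemma step_config_machine:
  assumes "action s (read_tape t1) (read_tape t2) = (s', x, y)" "s \<noteq> Accept" "s \<noteq> Reject"
  shows "step_config machine (config s t1 t2) = config s' (act_tape x t1) (act_tape y t2)"
  using assms by (simp add: step_config_def machine_def config_def)

lemma funpow_step: "f x = y \<Longrightarrow> (f ^^ n) y = z \<Longrightarrow> (f ^^ Suc n) x = z"
  by (simp add: funpow_swap1)

lemma push_steps:
  assumes "holds inp ys t2"
  shows "\<exists>t2'. holds inp (rev cs @ ys) t2' \<and>
    (step_config machine ^^ (2 * length cs)) (config (Push e q cs) t1 t2) = config (Push e q []) t1 t2'"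
  using assms
proof (induction cs arbitrary: ys t2)
  case (Cons c cs)
  define u where "u = act_tape (read_tape t2, MoveLeft) t2"
  define v where "v = act_tape (Aux (to_nat c), Stay) u"
  have v: "holds inp (c # ys) v"
    unfolding v_def u_def using Cons.prems by (rule holds_push) auto
  from Cons.IH[OF v] obtain t2' where t2': "holds inp (rev (c # cs) @ ys) t2'"
    "(step_config machine ^^ (2 * length cs)) (config (Push e q cs) t1 v) = config (Push e q []) t1 t2'"
    by auto
  have "step_config machine (config (Push e q (c # cs)) t1 t2) = config (Write e q c cs) t1 u"
    by (subst step_config_machine) (auto simp: u_def)
  moreover have "step_config machine (config (Write e q c cs) t1 u) = config (Push e q cs) t1 v"
    by (subst step_config_machine) (auto simp: v_def)
  ultimately have "(step_config machine ^^ Suc (Suc (2 * length cs))) (config (Push e q (c # cs)) t1 t2) =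
    config (Push e q []) t1 t2'"
    using t2'(2) by (intro funpow_step)
  then show ?case using t2'(1) by (intro exI[of _ t2']) simp
qed (auto simp del: split_paired_Ex)

text \<open>An input symbol costs one step to read and one to resume reading, an output symbol costs
  two, and the closing blank one. The output lies reversed on the second tape.\<close>

lemma read_steps:
  assumes "holds inp s t1" "holds inp ys t2"
  shows "\<exists>t1' t2'. holds inp [] t1' \<and> holds inp (rev (snd (pass q s)) @ ys) t2' \<and>
    (step_config machine ^^ (2 * length s + 2 * length (snd (pass q s)) + 1)) (config (Read q) t1 t2) =
      config (Push True (fst (pass q s)) []) t1' t2'"
  using assms
proof (induction s arbitrary: q ys t1 t2)
  case Nil
  obtain q' out where d: "\<delta> q None = (q', out)" by force
  have a: "read_tape t1 = Blank" using holds_read_tape(1)[OF Nil(1)] by simp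
  have 1: "step_config machine (config (Read q) t1 t2) = config (Push True q' out) t1 t2"
    using a d by (subst step_config_machine) (auto, metis act_tape_read)
  obtain t2' where t2': "holds inp (rev out @ ys) t2'"
    "(step_config machine ^^ (2 * length out)) (config (Push True q' out) t1 t2) =
      config (Push True q' []) t1 t2'"
    using push_steps[OF Nil(2)] by blast
  have "(step_config machine ^^ Suc (2 * length out)) (config (Read q) t1 t2) =
      config (Push True q' []) t1 t2'"
    using 1 t2'(2) by (rule funpow_step)
  then show ?case using t2'(1) Nil(1) d by (intro exI[of _ t1] exI[of _ t2']) simp
next
  case (Cons x s)
  obtain q' out where d: "\<delta> q (Some x) = (q', out)" by force
  have a: "read_tape t1 \<noteq> Blank" "stack_symbol inp (read_tape t1) = x"
    using holds_read_tape[OF Cons.prems(1)] by auto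
  define u where "u = act_tape (Blank, MoveRight) t1"
  have u: "holds inp s u" unfolding u_def by (rule holds_pop[OF Cons.prems(1)])
  have 1: "step_config machine (config (Read q) t1 t2) = config (Push False q' out) u t2"
    using a d by (subst step_config_machine) (auto simp: u_def)
  obtain v where v: "holds inp (rev out @ ys) v"
    "(step_config machine ^^ (2 * length out)) (config (Push False q' out) u t2) =
      config (Push False q' []) u v"
    using push_steps[OF Cons.prems(2)] by blast
  have 2: "step_config machine (config (Push False q' []) u v) = config (Read q') u v"
    by (subst step_config_machine) auto
  obtain t1' t2' where t: "holds inp [] t1'" "holds inp (rev (snd (pass q' s)) @ rev out @ ys) t2'"
    "(step_config machine ^^ (2 * length s + 2 * length (snd (pass q' s)) + 1)) (config (Read q') u v) =
      config (Push True (fst (pass q' s)) []) t1' t2'"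
    using Cons.IH[OF u v(1)] by blast
  have p: "pass q (x # s) = (fst (pass q' s), out @ snd (pass q' s))"
    by (simp add: d case_prod_beta)
  have "(step_config machine ^^ (2 * length s + 2 * length (snd (pass q' s)) + 1 + 1 + 2 * length out + 1))
      (config (Read q) t1 t2) = config (Push True (fst (pass q' s)) []) t1' t2'"
    using 1 2 v t by (simp add: funpow_add funpow_swap1)
  moreover have "2 * length s + 2 * length (snd (pass q' s)) + 1 + 1 + 2 * length out + 1 =
      2 * length (x # s) + 2 * length (snd (pass q (x # s))) + 1"
    unfolding p by simp
  ultimately show ?case using t p by (metis (no_types, lifting) append_assoc fst_conv rev_append snd_conv)
qed

lemma return_steps:
  assumes "holds inp ys t1" "holds inp zs t2"
  shows "\<exists>t1' t2'. holds inp (rev zs @ ys) t1' \<and> holds inp [] t2' \<and>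
    (step_config machine ^^ (2 * length zs + 1)) (config (Return q) t1 t2) = config (Read q) t1' t2'"
  using assms
proof (induction zs arbitrary: ys t1 t2)
  case Nil
  have "step_config machine (config (Return q) t1 t2) = config (Read q) t1 t2"
    using holds_read_tape(1)[OF Nil(2)]
    by (subst step_config_machine) (auto, metis act_tape_read)
  then show ?case using Nil by (intro exI[of _ t1] exI[of _ t2]) simp
next
  case (Cons z zs)
  have b: "read_tape t2 \<noteq> Blank" "stack_symbol inp (read_tape t2) = z"
    using holds_read_tape[OF Cons.prems(2)] by auto
  define u where "u = act_tape (read_tape t1, MoveLeft) t1"
  define u' where "u' = act_tape (Aux (to_nat z), Stay) u"
  define v where "v = act_tape (Blank, MoveRight) t2"
  have v: "holds inp zs v" unfolding v_def by (rule holds_pop[OF Cons.prems(2)])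
  have u': "holds inp (z # ys) u'"
    unfolding u'_def u_def using Cons.prems(1) by (rule holds_push) auto
  have 1: "step_config machine (config (Return q) t1 t2) = config (Restore q z) u v"
    using b by (subst step_config_machine) (auto simp: u_def v_def)
  have 2: "step_config machine (config (Restore q z) u v) = config (Return q) u' v"
    by (subst step_config_machine) (auto simp: u'_def)
  obtain t1' t2' where t: "holds inp (rev zs @ z # ys) t1'" "holds inp [] t2'"
    "(step_config machine ^^ (2 * length zs + 1)) (config (Return q) u' v) = config (Read q) t1' t2'"
    using Cons.IH[OF u' v] by blast
  have "(step_config machine ^^ Suc (Suc (2 * length zs + 1))) (config (Return q) t1 t2) = config (Read q) t1' t2'"
    using 1 2 t(3) by (intro funpow_step)
  then show ?case using t by (intro exI[of _ t1'] exI[of _ t2']) auto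
qed

text \<open>One pass takes \<open>2 * length s + 2 * length s' + 1\<close> steps to read and write,
  one to test for a verdict and \<open>2 * length s' + 1\<close> to pour back, at most
  \<open>6 * B + 3\<close> in all.\<close>

lemma run_steps:
  assumes "run B n q s b" "holds inp s t1" "holds inp [] t2"
  shows "\<exists>t \<le> n * (6 * B + 3). fst ((step_config machine ^^ t) (config (Read q) t1 t2)) =
    (if b then accept_state machine else reject_state machine)"
  using assms
proof (induction n arbitrary: q s t1 t2)
  case (Suc n)
  define q' where "q' = fst (pass q s)"
  define s' where "s' = snd (pass q s)"
  have B: "length s \<le> B" "length s' \<le> B"
    and h: "case halt q' of Some b' \<Rightarrow> b' = b | None \<Rightarrow> run B n q' s' b"
    using Suc.prems(1) unfolding q'_def s'_def by (simp_all add: case_prod_beta)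
  obtain u v where u: "holds inp [] u" and v: "holds inp (rev s') v"
    and 1: "(step_config machine ^^ (2 * length s + 2 * length s' + 1)) (config (Read q) t1 t2) =
      config (Push True q' []) u v"
    using read_steps[OF Suc.prems(2,3), of q] by (auto simp: q'_def s'_def)
  show ?case
  proof (cases "halt q'")
    case None
    then have 2: "step_config machine (config (Push True q' []) u v) = config (Return q') u v"
      by (subst step_config_machine) auto
    obtain u' v' where "holds inp s' u'" "holds inp [] v'"
      and 3: "(step_config machine ^^ (2 * length s' + 1)) (config (Return q') u v) = config (Read q') u' v'"
      using return_steps[OF u v, of q'] unfolding rev_rev_ident append_Nil2 length_rev by blast
    then obtain t where t: "t \<le> n * (6 * B + 3)"
      "fst ((step_config machine ^^ t) (config (Read q') u' v')) =
        (if b then accept_state machine else reject_state machine)"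
      using Suc.IH h None by fastforce
    have "(step_config machine ^^ (t + ((2 * length s' + 1) + (1 + (2 * length s + 2 * length s' + 1)))))
        (config (Read q) t1 t2) = (step_config machine ^^ t) (config (Read q') u' v')"
      using 1 2 3 by (simp only: funpow_add comp_apply) simp
    then show ?thesis
      using t B by (intro exI[of _ "t + ((2 * length s' + 1) + (1 + (2 * length s + 2 * length s' + 1)))"]) simp
  next
    case (Some b')
    then have 2: "step_config machine (config (Push True q' []) u v) =
        config (if b then Accept else Reject) u v"
      using h by (subst step_config_machine) auto
    then have "(step_config machine ^^ (Suc (2 * length s + 2 * length s' + 1))) (config (Read q) t1 t2) =
        config (if b then Accept else Reject) u v"
      using 1 by simp
    then show ?thesis
      using B by (intro exI[of _ "Suc (2 * length s + 2 * length s' + 1)"])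
        (auto simp: config_def machine_def)
  qed
qed simp

lemma holds_initial_tape: "holds inp (map inp w) (initial_tape w)"
proof (cases w)
  case Nil
  then show ?thesis by (auto simp: holds_def intro: exI[of _ "[]"])
next
  case (Cons i v)
  then show ?thesis unfolding Cons initial_tape.simps holds_def prod.case
    by (intro conjI exI[of _ "Input i # map Input v"] exI[of _ "[]"]) auto
qed

theorem decidable_in_ptimeI:
  assumes L: "L \<subseteq> lists \<Sigma>"
    and run: "\<And>w. w \<in> lists \<Sigma> \<Longrightarrow>
      run (c * (length w + 1) ^ d) (c' * (length w + 1) ^ d') start (map inp w) (w \<in> L)"
  shows "decidable_in_ptime \<Sigma> L"
proof -
  \<comment> \<open>With \<open>N\<close> one more than the input length, there are
    \<open>c' * N ^ d'\<close> passes of at most \<open>6 * (c * N ^ d) + 3\<close> steps, and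
    \<open>N \<ge> 1\<close> absorbs the summand 3.\<close>
  define p :: "nat poly" where "p = smult (c' * (6 * c + 3)) ([:1, 1:] ^ (d + d'))"
  have p: "poly p n = c' * (6 * c + 3) * (n + 1) ^ (d + d')" for n
    by (simp add: p_def poly_power)
  have "\<exists>t \<le> poly p (length w). fst ((step_config machine ^^ t) (initial_config machine w)) =
      (if w \<in> L then accept_state machine else reject_state machine)" if w: "w \<in> lists \<Sigma>" for w
  proof -
    define N where "N = length w + 1"
    have "initial_config machine w = config (Read start) (initial_tape w) (initial_tape [])"
      by (simp add: initial_config_def config_def machine_def)
    then obtain t where t: "t \<le> c' * N ^ d' * (6 * (c * N ^ d) + 3)"
      "fst ((step_config machine ^^ t) (initial_config machine w)) =
      (if w \<in> L then accept_state machine else reject_state machine)"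
      using run_steps[OF run[OF w] holds_initial_tape, of "initial_tape []"] holds_initial_tape[of "[]"]
      by (auto simp: N_def)
    have "c' * N ^ d' * (6 * (c * N ^ d) + 3) \<le> c' * N ^ d' * ((6 * c + 3) * N ^ d)"
      by (intro mult_left_mono) (auto simp: N_def algebra_simps)
    also have "\<dots> = poly p (length w)" by (simp add: p N_def power_add)
    finally show ?thesis using t by (meson order_trans)
  qed
  then show ?thesis using machine_over L finite_\<Sigma> unfolding decidable_in_ptime_def by blast
qed

end

section \<open>The decision procedure\<close>

text \<open>The tags stand for arguments and values of a table and for image words of a product.
  Arguments must be pairwise incomparable, values must form a prefix code but may repeat, and image
  words are unrestricted. Only the last two kinds are counted.\<close>

datatype tag = Arg | Val | Img

text \<open>
  A word is written as \<open>Head t\<close>, its letters as cells, and \<open>Tail d f\<close>. A marked cell has already been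
  compared with the current word, \<open>f\<close> records that this comparison has failed, and \<open>d\<close> that some
  earlier word of the list is a prefix.
\<close>

datatype symbol = Sym input_symbol | Head tag | Cell nat bool | Tail bool bool

text \<open>
  \<open>Skip q\<close> copies the remaining string and enters \<open>q\<close> for the next pass. \<open>Held\<close> delays a generator by
  one symbol, since only the last one may be consumed. In \<open>Front\<close> and \<open>Cmp\<close>, the flag \<open>s\<close> says that a
  later word is a strict prefix of the current one; in \<open>Fin\<close>, the flag \<open>e\<close> says that the word being
  read is longer than the current one.
\<close>

datatype phase =
  Verdict bool | Skip phase | Start
| Tab | Tab_Arg | Tab_Val | Wrd
| Eval | Held nat | Gap nat "word list" | Scan nat word "word list" | Copy nat "word list" | Discard nat "word list"
| Pick "nat option" | Reset "nat option" tag bool | Front "nat option" tag bool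
| Cmp "nat option" tag nat bool "bool option" | Fin "nat option" tag bool

instance input_symbol :: countable by countable_datatype
instance tag :: countable by countable_datatype
instance symbol :: countable by countable_datatype
instance phase :: countable by countable_datatype

definition is_mark :: "input_symbol \<Rightarrow> bool" where
  "is_mark x \<longleftrightarrow> x = Table_Mark \<or> x = Word_Mark"

fun marks_item :: "symbol \<Rightarrow> bool" where
  "marks_item (Sym x) = is_mark x"
| "marks_item _ = False"

abbreviation cells :: "word \<Rightarrow> symbol list" where
  "cells w \<equiv> map (\<lambda>a. Cell a False) w"

definition image_word :: "word \<Rightarrow> symbol list" where
  "image_word w = Head Img # cells w @ [Tail False False]"

text \<open>Generators are built into the control: \<open>gens g\<close> lists words generating the
  domain of the generator with index \<open>g\<close>, and \<open>img g\<close> gives its values on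
  them.\<close>

locale procedure =
  fixes k m :: nat and gens :: "nat \<Rightarrow> word list" and img :: "nat \<Rightarrow> word \<Rightarrow> word"
    and verdict :: "nat option \<Rightarrow> nat option \<Rightarrow> bool"
  assumes k: "k \<ge> 2"
    and gens: "\<And>g. g < m \<Longrightarrow> set (gens g) \<subseteq> words k"
    and img: "\<And>g p. g < m \<Longrightarrow> p \<in> set (gens g) \<Longrightarrow> img g p \<in> words k"
begin

text \<open>The first tick turns \<open>None\<close> into a residue, so counting directly produces
  an \<open>ideal_class\<close>, with \<open>None\<close> only if nothing was counted.\<close>

definition tick :: "nat option \<Rightarrow> nat option" where
  "tick c = Some (((case c of None \<Rightarrow> 0 | Some n \<Rightarrow> n) + 1) mod (k - 1))"

text \<open>Here \<open>u\<close> is the part of the current word already read. It is stored only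
  while some domain generator extends it, so boundedly many letters are remembered; on reaching a
  generator its image is written and the remaining letters are copied.\<close>

definition enter :: "nat \<Rightarrow> word \<Rightarrow> word list \<Rightarrow> phase \<times> symbol list" where
  "enter g u ps = (if u \<in> set (gens g) then (Copy g ps, Head Img # cells (img g u))
     else if \<exists>p\<in>set (gens g). prefix u p then (Scan g u ps, []) else (Discard g ps, []))"

abbreviation (input) "fail \<equiv> (Verdict False, [])"

text \<open>Unexpected symbols lead to rejection, so the pass that reads an item also checks its
  syntax. In \<open>Cmp\<close>, the component \<open>x\<close> is \<open>None\<close> until the
  next unmarked letter of the word is met, and then records whether the comparison failed. The value
  \<open>Some False\<close> on entry lets the rest of the current word pass unchanged.\<close>

fun inner :: "phase \<Rightarrow> symbol \<Rightarrow> phase \<times> symbol list" where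
  "inner (Verdict b) y = (Verdict b, [])"
| "inner (Skip q) y = (Skip q, [y])"
| "inner Start y = fail"
| "inner Tab y = (case y of Sym Arg_Mark \<Rightarrow> (Tab_Arg, [Head Arg]) | _ \<Rightarrow> fail)"
| "inner Tab_Arg y = (case y of Sym (Letter a) \<Rightarrow> (Tab_Arg, [Cell a False])
     | Sym Val_Mark \<Rightarrow> (Tab_Val, [Tail False False, Head Val]) | _ \<Rightarrow> fail)"
| "inner Tab_Val y = (case y of Sym (Letter a) \<Rightarrow> (Tab_Val, [Cell a False])
     | Sym Arg_Mark \<Rightarrow> (Tab_Arg, [Tail False False, Head Arg]) | _ \<Rightarrow> fail)"
| "inner Wrd y = (case y of Sym (Generator g) \<Rightarrow> (Wrd, [y]) | _ \<Rightarrow> fail)"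
| "inner Eval y = (case y of Sym (Generator g) \<Rightarrow> (Held g, [])
     | Head t \<Rightarrow> (Skip (Pick None), [y]) | _ \<Rightarrow> fail)"
| "inner (Held g) y = (case y of Sym (Generator g') \<Rightarrow> (Held g', [Sym (Generator g)])
     | Head t \<Rightarrow> enter g [] (gens g) | _ \<Rightarrow> fail)"
| "inner (Gap g ps) y = (case y of Head t \<Rightarrow> enter g [] ps | _ \<Rightarrow> fail)"
| "inner (Scan g u ps) y = (case y of Cell a b \<Rightarrow> enter g (u @ [a]) ps
     | Tail d f \<Rightarrow> (Gap g (filter (\<lambda>p. \<not> prefix u p) ps),
         concat (map (\<lambda>p. image_word (img g p)) (filter (prefix u) ps)))
     | _ \<Rightarrow> fail)"
| "inner (Copy g ps) y = (case y of Cell a b \<Rightarrow> (Copy g ps, [y]) | Tail d f \<Rightarrow> (Gap g ps, [y]) | _ \<Rightarrow> fail)"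
| "inner (Discard g ps) y = (case y of Cell a b \<Rightarrow> (Discard g ps, []) | Tail d f \<Rightarrow> (Gap g ps, []) | _ \<Rightarrow> fail)"
| "inner (Pick c) y = (case y of Head t \<Rightarrow> (Reset c t True, []) | _ \<Rightarrow> fail)"
| "inner (Reset c t f) y = (case y of Head t' \<Rightarrow> (Reset c t (t' \<noteq> t), [y])
     | Cell a b \<Rightarrow> (Reset c t f, [Cell a False]) | Tail d f' \<Rightarrow> (Reset c t f, [Tail d f]) | _ \<Rightarrow> fail)"
| "inner (Front c t s) y = (case y of Cell a b \<Rightarrow> (Cmp c t a s (Some False), [])
     | Tail d f \<Rightarrow> if s \<and> t \<noteq> Img then fail
         else (Fin (if t \<noteq> Arg \<and> \<not> d \<and> \<not> s then tick c else c) t False, [])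
     | _ \<Rightarrow> fail)"
| "inner (Cmp c t a s x) y = (case y of Head t' \<Rightarrow> (Cmp c t a s None, [y])
     | Cell b e \<Rightarrow> if x = None \<and> \<not> e then (Cmp c t a s (Some (b \<noteq> a)), [Cell b True]) else (Cmp c t a s x, [y])
     | Tail d f \<Rightarrow> (case x of None \<Rightarrow> (Cmp c t a (s \<or> \<not> f) (Some False), [Tail d True])
         | Some e \<Rightarrow> (Cmp c t a s (Some False), [Tail d (f \<or> e)]))
     | _ \<Rightarrow> fail)"
| "inner (Fin c t e) y = (case y of Head t' \<Rightarrow> (Fin c t False, [y])
     | Cell b e' \<Rightarrow> (Fin c t (e \<or> \<not> e'), [y])
     | Tail d f \<Rightarrow> if f then (Fin c t e, [y]) else if t = Arg \<or> t = Val \<and> e then fail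
         else (Fin c t e, [Tail True f])
     | _ \<Rightarrow> fail)"

text \<open>Behaviour at the end of an item; the next item passes through unchanged.\<close>

fun finish :: "phase \<Rightarrow> phase \<times> symbol list" where
  "finish Tab = (Pick None, [])"
| "finish Tab_Val = (Pick None, [Tail False False])"
| "finish Wrd = (Eval, image_word [])"
| "finish Eval = (Pick None, [])"
| "finish (Held g) = (Eval, [])"
| "finish (Gap g ps) = (Eval, [])"
| "finish (Reset c t f) = (Front c t False, [])"
| "finish (Cmp c t a s x) = (Front c t s, [])"
| "finish (Fin c t e) = (Pick c, [])"
| "finish (Skip q) = (q, [])"
| "finish (Verdict b) = (Verdict b, [])"
| "finish _ = fail"

text \<open>A verdict is absorbing and must not be postponed. As \<open>Skip\<close> is never
  nested, finitely many phases suffice.\<close>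

definition skip :: "phase \<Rightarrow> phase" where
  "skip q = (case q of Verdict b \<Rightarrow> q | Skip q' \<Rightarrow> q | _ \<Rightarrow> Skip q)"

text \<open>The first component holds the class of the first item once it is known.
  \<open>Start\<close> consumes the mark of its item, so a mark met in a later phase signals the
  next item; a third one is rejected at \<open>Pick\<close>.\<close>

definition step :: "nat option option \<times> phase \<Rightarrow> symbol option \<Rightarrow>
    (nat option option \<times> phase) \<times> symbol list" where
  "step c x = (case c of (r, q) \<Rightarrow> (case x of
     None \<Rightarrow> (case q of
         Pick c \<Rightarrow> ((r, Verdict (case r of None \<Rightarrow> False | Some c' \<Rightarrow> verdict c' c)), [])
       | _ \<Rightarrow> (case finish q of (q', out) \<Rightarrow> ((r, q'), out)))
   | Some y \<Rightarrow>
       if marks_item y then (case q of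
           Start \<Rightarrow> ((r, if y = Sym Table_Mark then Tab else Wrd), [])
         | Skip q' \<Rightarrow> ((r, q), [y])
         | Verdict b \<Rightarrow> ((r, q), [])
         | Pick c \<Rightarrow> (case r of None \<Rightarrow> ((Some c, Skip Start), [y]) | Some c' \<Rightarrow> ((r, Verdict False), []))
         | _ \<Rightarrow> (case finish q of (q', out) \<Rightarrow> ((r, skip q'), out @ [y])))
       else (case inner q y of (q', out) \<Rightarrow> ((r, q'), out))))"

definition halt :: "nat option option \<times> phase \<Rightarrow> bool option" where
  "halt c = (case snd c of Verdict b \<Rightarrow> Some b | _ \<Rightarrow> None)"

section \<open>Finiteness of the control\<close>

definition counts :: "nat option set" where
  "counts = insert None (Some ` {..<k})"

fun base_phase :: "phase \<Rightarrow> bool" where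
  "base_phase (Skip q) = False"
| "base_phase (Held g) = (g < m)"
| "base_phase (Gap g ps) = (g < m \<and> ps \<in> set (subseqs (gens g)))"
| "base_phase (Scan g u ps) = (g < m \<and> (\<exists>p\<in>set (gens g). prefix u p) \<and> ps \<in> set (subseqs (gens g)))"
| "base_phase (Copy g ps) = (g < m \<and> ps \<in> set (subseqs (gens g)))"
| "base_phase (Discard g ps) = (g < m \<and> ps \<in> set (subseqs (gens g)))"
| "base_phase (Pick c) = (c \<in> counts)"
| "base_phase (Reset c t f) = (c \<in> counts)"
| "base_phase (Front c t s) = (c \<in> counts)"
| "base_phase (Cmp c t a s x) = (c \<in> counts \<and> a < k)"
| "base_phase (Fin c t e) = (c \<in> counts)"
| "base_phase q = True"

definition phases :: "phase set" where
  "phases = {q. base_phase q} \<union> Skip ` {q. base_phase q}"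

definition results :: "nat option option set" where
  "results = insert None (Some ` counts)"

definition symbols :: "symbol set" where
  "symbols = Sym ` input_symbols k m \<union> range Head \<union> (\<lambda>(a, b). Cell a b) ` ({..<k} \<times> UNIV)
     \<union> (\<lambda>(d, f). Tail d f) ` UNIV"

lemma UNIV_tag: "(UNIV :: tag set) = {Arg, Val, Img}"
  using tag.exhaust by auto

lemma finite_counts: "finite counts"
  by (simp add: counts_def)

lemma finite_symbols: "finite symbols"
  by (auto simp: symbols_def input_symbols_def UNIV_tag)

lemma finite_base_phases: "finite {q. base_phase q}"
proof (rule finite_subset)
  let ?G = "SIGMA g:{..<m}. set (subseqs (gens g))"
  let ?V = "SIGMA g:{..<m}. {u. \<exists>p\<in>set (gens g). prefix u p} \<times> set (subseqs (gens g))"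
  show "{q. base_phase q} \<subseteq> {Start, Tab, Tab_Arg, Tab_Val, Wrd, Eval} \<union> range Verdict \<union> Held ` {..<m}
     \<union> (\<lambda>(g, ps). Gap g ps) ` ?G \<union> (\<lambda>(g, u, ps). Scan g u ps) ` ?V
     \<union> (\<lambda>(g, ps). Copy g ps) ` ?G \<union> (\<lambda>(g, ps). Discard g ps) ` ?G
     \<union> Pick ` counts \<union> (\<lambda>(c, t, f). Reset c t f) ` (counts \<times> UNIV)
     \<union> (\<lambda>(c, t, f). Front c t f) ` (counts \<times> UNIV)
     \<union> (\<lambda>(c, t, a, s, x). Cmp c t a s x) ` (counts \<times> UNIV \<times> {..<k} \<times> UNIV \<times> UNIV)
     \<union> (\<lambda>(c, t, f). Fin c t f) ` (counts \<times> UNIV)" (is "_ \<subseteq> ?S")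
  proof
    fix q
    assume "q \<in> {q. base_phase q}"
    then have "base_phase q" by simp
    then show "q \<in> ?S"
      by (cases q) (simp_all add: image_iff)
  qed
  have "{u. \<exists>p\<in>set (gens g). prefix u p} = (\<Union>p\<in>set (gens g). set (prefixes p))" for g by auto
  then have "finite {u. \<exists>p\<in>set (gens g). prefix u p}" for g by simp
  moreover have "finite (UNIV :: (tag \<times> bool) set)" "finite (UNIV :: tag set)" "finite (UNIV :: bool option set)"
    by (simp_all add: UNIV_tag flip: UNIV_Times_UNIV)
  ultimately show "finite ?S" using finite_counts by simp
qed

lemma phases_intro: "base_phase q \<Longrightarrow> q \<in> phases"
  by (simp add: phases_def)

lemma set_image_word:
  assumes "w \<in> words k"
  shows "set (image_word w) \<subseteq> symbols"
  using assms by (auto simp: image_word_def symbols_def words_def)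

lemma cells_symbols: "w \<in> words k \<Longrightarrow> set (cells w) \<subseteq> symbols"
  by (auto simp: symbols_def words_def)

lemma simple_symbols [simp]: "Head t \<in> symbols" "Tail d f \<in> symbols" "Cell a b \<in> symbols \<longleftrightarrow> a < k"
    "Sym x \<in> symbols \<longleftrightarrow> x \<in> input_symbols k m"
  by (auto simp: symbols_def)

lemma tick_counts: "tick c \<in> counts"
proof -
  have "n mod (k - 1) < k" for n using k mod_less_divisor[of "k - 1" n] by linarith
  then show ?thesis by (simp add: tick_def counts_def)
qed

lemma enter_closed:
  assumes "g < m" "ps \<in> set (subseqs (gens g))"
  shows "base_phase (fst (enter g u ps)) \<and> set (snd (enter g u ps)) \<subseteq> symbols"
  using assms cells_symbols[OF img[OF assms(1)], of u] by (auto simp: enter_def)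

lemma filter_subseqs:
  assumes "ps \<in> set (subseqs xs)"
  shows "filter P ps \<in> set (subseqs xs)"
  using assms subseq_order.order_trans[OF subseq_filter_left[of P ps]] by simp

lemma inner_closed:
  assumes q: "base_phase q" and y: "y \<in> symbols"
  shows "fst (inner q y) \<in> phases \<and> set (snd (inner q y)) \<subseteq> symbols"
proof -
  have e: "fst (enter g u ps) \<in> phases \<and> set (snd (enter g u ps)) \<subseteq> symbols"
    if "g < m" "ps \<in> set (subseqs (gens g))" for g u ps
    using enter_closed[OF that] phases_intro by blast
  have self: "gens g \<in> set (subseqs (gens g))" for g by simp
  show ?thesis
  proof (cases q)
    case (Scan g u ps)
    then have g: "g < m" "ps \<in> set (subseqs (gens g))" using q by auto
    then have "set ps \<subseteq> set (gens g)" using subseqs_powset[of "gens g"] by blast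
    then have "set (image_word (img g p)) \<subseteq> symbols" if "p \<in> set ps" for p
      using set_image_word[OF img[OF g(1)]] that by blast
    then show ?thesis
      using Scan g e[OF g] filter_subseqs[OF g(2)] by (cases y) (auto simp: phases_intro)
  next
    case (Held g)
    then have "g < m" using q by auto
    then show ?thesis using Held y e[of g "gens g"]
      by (cases y) (auto simp: phases_intro input_symbols_def split: input_symbol.splits)
  next
    case (Gap g ps)
    then show ?thesis using q y e[of g ps]
      by (cases y) (auto simp: phases_intro)
  next
    case Eval
    then show ?thesis using y
      by (cases y) (auto simp: phases_def counts_def input_symbols_def split: input_symbol.splits)
  next
    case Tab
    then show ?thesis by (auto simp: phases_intro split: symbol.split input_symbol.split)
  next
    case Tab_Arg
    then show ?thesis using y
      by (auto simp: phases_intro input_symbols_def split: symbol.split input_symbol.split)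
  next
    case Tab_Val
    then show ?thesis using y
      by (auto simp: phases_intro input_symbols_def split: symbol.split input_symbol.split)
  next
    case Wrd
    then show ?thesis using y
      by (auto simp: phases_intro input_symbols_def split: symbol.split input_symbol.split)
  next
    case (Front c t s)
    then show ?thesis using q y by (cases y) (auto simp: phases_intro tick_counts)
  next
    case (Cmp c t a s x)
    then show ?thesis using q y by (cases y; cases x) (auto simp: phases_intro)
  next
    case (Fin c t e)
    then show ?thesis using q y by (cases y) (auto simp: phases_intro)
  next
    case (Reset c t e)
    then show ?thesis using q y by (cases y) (auto simp: phases_intro)
  next
    case (Pick c)
    then show ?thesis using q y by (cases y) (auto simp: phases_intro)
  next
    case (Copy g ps)
    then show ?thesis using q y by (cases y) (auto simp: phases_intro)
  next
    case (Discard g ps)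
    then show ?thesis using q y by (cases y) (auto simp: phases_intro)
  qed (use q y in \<open>auto simp: phases_intro\<close>)
qed

lemma finish_closed:
  assumes "base_phase q"
  shows "base_phase (fst (finish q)) \<and> set (snd (finish q)) \<subseteq> symbols"
  using assms by (cases q) (auto simp: counts_def image_word_def)

lemma step_closed:
  assumes "c \<in> results \<times> phases" "x \<in> insert None (Some ` symbols)"
  shows "fst (step c x) \<in> results \<times> phases \<and> set (snd (step c x)) \<subseteq> symbols"
proof -
  obtain r q where c: "c = (r, q)" "r \<in> results" "q \<in> phases" using assms(1) by auto
  show ?thesis
  proof (cases "base_phase q")
    case False
    then obtain q' where "q = Skip q'" "base_phase q'" using c(3) by (auto simp: phases_def)
    then show ?thesis using c assms(2) by (auto simp: step_def phases_intro split: if_splits)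
  next
    case True
    have f: "fst (finish q) \<in> phases" "skip (fst (finish q)) \<in> phases" "set (snd (finish q)) \<subseteq> symbols"
      using finish_closed[OF True] by (auto simp: phases_def skip_def split: phase.splits)
    have i: "fst (inner q y) \<in> phases \<and> set (snd (inner q y)) \<subseteq> symbols" if "y \<in> symbols" for y
      using inner_closed[OF True that] .
    have v: "Verdict b \<in> phases" "Skip Start \<in> phases" "Tab \<in> phases" "Wrd \<in> phases" for b
      by (auto simp: phases_def)
    show ?thesis
    proof (cases x)
      case None
      then show ?thesis using c(1,2) f v
        by (cases "finish q") (auto simp: step_def split: phase.splits)
    next
      case (Some y)
      then have y: "y \<in> symbols" using assms(2) by auto
      show ?thesis
      proof (cases "marks_item y")
        case False
        then show ?thesis using Some c(1,2) i[OF y] by (auto simp: step_def split: prod.splits)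
      next
        case mark: True
        show ?thesis
        proof (cases q)
          case (Pick e)
          then have "Some e \<in> results" using True by (auto simp: results_def)
          then show ?thesis using Pick mark Some c v y by (auto simp: step_def split: option.splits)
        qed (use mark Some c f v y True in \<open>auto simp: step_def split: prod.splits\<close>)
      qed
    qed
  qed
qed

sublocale transducer step halt "(None, Start)" Sym "results \<times> phases" symbols "input_symbols k m"
proof unfold_locales
  have "finite phases" using finite_base_phases by (simp add: phases_def)
  then show "finite (results \<times> phases)" using finite_counts by (simp add: results_def)
  show "finite symbols" by (rule finite_symbols)
  show "finite (input_symbols k m)" by (simp add: input_symbols_def)
  show "(None, Start) \<in> results \<times> phases" by (simp add: results_def phases_def)
  show "Sym ` input_symbols k m \<subseteq> symbols" by (auto simp: symbols_def)
qed (use step_closed in blast)+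

end

section \<open>Words on the tape during a comparison\<close>

fun raw_word :: "tag \<times> (nat \<times> bool) list \<times> bool \<times> bool \<Rightarrow> symbol list" where
  "raw_word (t, ms, d, f) = Head t # map (\<lambda>(a, b). Cell a b) ms @ [Tail d f]"

fun entry_of :: "tag \<times> (nat \<times> bool) list \<times> bool \<times> bool \<Rightarrow> tag \<times> bool \<times> word" where
  "entry_of (t, ms, d, f) = (t, d, map fst ms)"

text \<open>The loop invariant after \<open>j\<close> letters of the current word \<open>u\<close>
  with tag \<open>t\<close>. Words with another tag count as failed from the start, and a word with
  fewer than \<open>j\<close> letters fails because the two prefixes differ in length (as long as
  \<open>j \<le> length u\<close>).\<close>

fun marked :: "nat \<Rightarrow> word \<Rightarrow> tag \<Rightarrow> tag \<times> bool \<times> word \<Rightarrow> symbol list" where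
  "marked j u t (t', d, w) = Head t' # map (\<lambda>a. Cell a True) (take j w) @ cells (drop j w)
     @ [Tail d (t' \<noteq> t \<or> take j w \<noteq> take j u)]"

text \<open>The prefix need not be strict: later copies of \<open>u\<close> are suppressed too, so
  repeated words are counted once.\<close>

fun shadow :: "tag \<Rightarrow> word \<Rightarrow> tag \<times> bool \<times> word \<Rightarrow> tag \<times> bool \<times> word" where
  "shadow t u (t', d, w) = (t', d \<or> t' = t \<and> prefix u w, w)"

text \<open>The forbidden cases in which the later word is at least as long as \<open>u\<close>. A
  later word that is a strict prefix of \<open>u\<close> is detected by the flag \<open>s\<close>
  instead.\<close>

fun conflict :: "tag \<Rightarrow> word \<Rightarrow> tag \<times> bool \<times> word \<Rightarrow> bool" where
  "conflict t u (t', d, w) \<longleftrightarrow> t' = t \<and> (t = Arg \<and> prefix u w \<or> t = Val \<and> strict_prefix u w)"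

text \<open>The value of the flag \<open>s\<close> after \<open>j\<close> letters: so far only words
  with fewer than \<open>j\<close> letters have been seen to end. At \<open>j = length u\<close> it
  becomes the strict prefix condition, see \<open>below_length\<close>.\<close>

definition below :: "tag \<Rightarrow> word \<Rightarrow> (tag \<times> bool \<times> word) list \<Rightarrow> nat \<Rightarrow> bool" where
  "below t u es j \<longleftrightarrow> (\<exists>(t', d, w)\<in>set es. t' = t \<and> length w < j \<and> w = take (length w) u)"

fun weight :: "tag \<times> bool \<times> word \<Rightarrow> nat" where
  "weight (t, d, w) = length w + 2"

lemma prefix_take: "take (length u) w = u \<longleftrightarrow> prefix u w"
  by (metis append_eq_conv_conj prefix_def)

lemma below_Suc:
  assumes "j < length u"
  shows "below t u es (Suc j) \<longleftrightarrow> below t u es j \<or>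
    (\<exists>(t', d, w)\<in>set es. t' = t \<and> length w \<le> j \<and> take j w = take j u)"
proof -
  have *: "length w < Suc j \<and> w = take (length w) u \<longleftrightarrow>
      length w < j \<and> w = take (length w) u \<or> length w \<le> j \<and> take j w = take j u" for w
  proof -
    have "length w = j" if "length w \<le> j" "take j w = take j u"
      using that assms by (metis length_take min.absorb4 nat_less_le take_all)
    then show ?thesis by (auto simp: less_Suc_eq)
  qed
  show ?thesis unfolding below_def * conj_disj_distribL case_prod_beta bex_disj_distrib ..
qed

lemma below_length: "below t u es (length u) \<longleftrightarrow> (\<exists>(t', d, w)\<in>set es. t' = t \<and> strict_prefix w u)"
proof -
  have "length w < length u \<and> w = take (length w) u \<longleftrightarrow> strict_prefix w u" for w
    using prefix_take[of w u] prefix_length_less[of w u]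
    by (metis prefix_order.le_less nat_less_le)
  then show ?thesis unfolding below_def by auto
qed

lemma length_raw_words:
  "length (concat (map raw_word rs)) = sum_list (map weight (map entry_of rs))"
  by (induction rs) auto

lemma length_marked: "length (concat (map (marked j u t) es)) = sum_list (map weight es)"
  by (induction es) auto

lemma weight_shadow: "sum_list (map weight (map (shadow t u) es)) = sum_list (map weight es)"
  by (induction es) auto

lemma raw_word_no_mark: "y \<in> set (raw_word r) \<Longrightarrow> \<not> marks_item y"
  by (cases r) auto

lemma marked_no_mark: "y \<in> set (marked j u t e) \<Longrightarrow> \<not> marks_item y"
  by (cases e) auto

definition boundary :: "symbol list \<Rightarrow> bool" where
  "boundary s \<longleftrightarrow> s = [] \<or> marks_item (hd s)"

section \<open>Passes within one item\<close>

context procedure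
begin

text \<open>Between marks only \<open>inner\<close> acts. Separating this part of a pass removes the
  stored class and the rules for the end of an item from the calculations.\<close>

fun feed :: "phase \<Rightarrow> symbol list \<Rightarrow> phase \<times> symbol list" where
  "feed q [] = (q, [])"
| "feed q (y # s) = (let (q1, o1) = inner q y; (q2, o2) = feed q1 s in (q2, o1 @ o2))"

lemma feed_append_eq:
  "feed q (s @ s') = (fst (feed (fst (feed q s)) s'), snd (feed q s) @ snd (feed (fst (feed q s)) s'))"
  by (induction s arbitrary: q) (simp_all add: case_prod_beta)

lemma feed_append:
  assumes "feed q s = (q1, o1)" "feed q1 s' = (q2, o2)"
  shows "feed q (s @ s') = (q2, o1 @ o2)"
  unfolding feed_append_eq by (simp add: assms)

lemma fst_feed_append: "fst (feed q (s @ s')) = fst (feed (fst (feed q s)) s')"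
  by (simp add: feed_append_eq)

lemma feed_Verdict: "feed (Verdict b) s = (Verdict b, [])"
  by (induction s) auto

lemma step_eq:
  "step (r, q) x = (case x of
     None \<Rightarrow> (case q of
         Pick c \<Rightarrow> ((r, Verdict (case r of None \<Rightarrow> False | Some c' \<Rightarrow> verdict c' c)), [])
       | _ \<Rightarrow> (case finish q of (q', out) \<Rightarrow> ((r, q'), out)))
   | Some y \<Rightarrow>
       if marks_item y then (case q of
           Start \<Rightarrow> ((r, if y = Sym Table_Mark then Tab else Wrd), [])
         | Skip q' \<Rightarrow> ((r, q), [y])
         | Verdict b \<Rightarrow> ((r, q), [])
         | Pick c \<Rightarrow> (case r of None \<Rightarrow> ((Some c, Skip Start), [y]) | Some c' \<Rightarrow> ((r, Verdict False), []))
         | _ \<Rightarrow> (case finish q of (q', out) \<Rightarrow> ((r, skip q'), out @ [y])))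
       else (case inner q y of (q', out) \<Rightarrow> ((r, q'), out)))"
  unfolding step_def by simp

lemma step_inner: "\<not> marks_item y \<Longrightarrow> step (r, q) (Some y) = ((r, fst (inner q y)), snd (inner q y))"
  by (simp add: step_eq case_prod_beta)

lemma pass_append:
  assumes "\<forall>y\<in>set s. \<not> marks_item y"
  shows "pass (r, q) (s @ rest) =
    (fst (pass (r, fst (feed q s)) rest), snd (feed q s) @ snd (pass (r, fst (feed q s)) rest))"
  using assms by (induction s arbitrary: q) (simp_all add: case_prod_beta step_inner)

lemma pass_feed:
  assumes "\<forall>y\<in>set s. \<not> marks_item y" "feed q s = (q1, o1)"
  shows "pass (r, q) (s @ rest) = (fst (pass (r, q1) rest), o1 @ snd (pass (r, q1) rest))"
  using pass_append[OF assms(1)] assms(2) by simp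

lemma pass_feed_rest:
  assumes "feed q s = (q1, o1)" "\<forall>y\<in>set s. \<not> marks_item y" "pass (r, q1) rest = ((r', q2), o2 @ rest)"
  shows "pass (r, q) (s @ rest) = ((r', q2), (o1 @ o2) @ rest)"
  using pass_feed[OF assms(2,1)] assms(3) by simp

lemma pass_Skip: "pass (r, Skip q) s = ((r, q), s)"
  by (induction s) (auto simp: step_eq)

lemma pass_Verdict: "pass (r, Verdict b) s = ((r, Verdict b), [])"
  by (induction s) (auto simp: step_eq)

definition regular :: "phase \<Rightarrow> bool" where
  "regular q \<longleftrightarrow> (case q of Start \<Rightarrow> False | Pick c \<Rightarrow> False | Skip q' \<Rightarrow> False | Verdict b \<Rightarrow> False | _ \<Rightarrow> True)"

text \<open>The end of the string and the mark of the next item have the same effect, so both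
  positions of an item are treated at once. The phases with rules of their own are excluded by
  \<open>regular\<close>.\<close>

lemma pass_boundary:
  assumes "boundary rest" "finish q = (q', out)" "regular q" "skip q' = Skip q'"
  shows "pass (r, q) rest = ((r, q'), out @ rest)"
proof (cases rest)
  case Nil
  then show ?thesis using assms by (cases q) (auto simp: step_eq regular_def)
next
  case (Cons y s)
  then have "marks_item y" using assms(1) by (simp add: boundary_def)
  then have "step (r, q) (Some y) = ((r, Skip q'), out @ [y])"
    using assms by (cases q) (auto simp: step_eq regular_def)
  then show ?thesis using Cons by (simp add: pass_Skip)
qed

lemma pass_boundary_fail:
  assumes "boundary rest" "finish q = (Verdict False, out)" "regular q"
  shows "fst (pass (r, q) rest) = (r, Verdict False)"
proof (cases rest)
  case Nil
  then show ?thesis using assms by (cases q) (auto simp: step_eq regular_def)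
next
  case (Cons y s)
  then have "marks_item y" using assms(1) by (simp add: boundary_def)
  then have "step (r, q) (Some y) = ((r, Verdict False), out @ [y])"
    using assms by (cases q) (auto simp: step_eq regular_def skip_def)
  then show ?thesis using Cons by (simp add: pass_Verdict)
qed

text \<open>When a pass rejects, its output is not computed, yet its length must be bounded. Leaving
  out evaluation, where long images may be written, each symbol yields at most two, and the end of
  an item at most the two symbols of \<open>image_word []\<close>.\<close>

fun slim :: "phase \<Rightarrow> bool" where
  "slim Eval = False"
| "slim (Held g) = False"
| "slim (Gap g ps) = False"
| "slim (Scan g u ps) = False"
| "slim (Copy g ps) = False"
| "slim (Discard g ps) = False"
| "slim q = True"

lemma inner_slim:
  assumes "slim q"
  shows "slim (fst (inner q y)) \<and> length (snd (inner q y)) \<le> 2"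
  using assms by (cases q) (auto split: symbol.split input_symbol.split option.split)

lemma pass_slim:
  assumes "slim q"
  shows "length (snd (pass (r, q) s)) \<le> 2 * length s + 2"
  using assms
proof (induction s arbitrary: q)
  case Nil
  then show ?case by (cases q) (auto simp: step_eq image_word_def)
next
  case (Cons y s)
  show ?case
  proof (cases "marks_item y")
    case False
    then show ?thesis
      using inner_slim[OF Cons.prems, of y] Cons.IH[of "fst (inner q y)"]
      by (simp add: step_inner case_prod_beta)
  next
    case True
    show ?thesis
    proof (cases q)
      case Start
      then show ?thesis using True Cons.IH[of Tab] Cons.IH[of Wrd] by (auto simp: step_eq case_prod_beta)
    qed (use True Cons.prems in \<open>auto simp: step_eq case_prod_beta skip_def pass_Skip pass_Verdict image_word_def
          split: option.split\<close>)
  qed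
qed

lemma run_verdict:
  assumes "fst (pass (r, q) s) = (r', Verdict b)" "slim q" "2 * length s + 2 \<le> B"
  shows "run B (Suc n) (r, q) s b"
  using assms pass_slim[OF assms(2), of r s] by (auto simp: case_prod_beta halt_def)

lemma run_pass:
  assumes "pass c s = ((r', q'), s')" "skip q' = Skip q'" "length s \<le> B" "length s' \<le> B" "run B n (r', q') s' b"
  shows "run B (Suc n) c s b"
  using assms by (cases q') (auto simp: halt_def skip_def)

subsection \<open>Comparison of words\<close>

lemma feed_Reset_word: "feed (Reset c t f) (raw_word e) = (Reset c t (fst e \<noteq> t), marked 0 u t (entry_of e))"
proof -
  obtain t' ms d f' where e: "e = (t', ms, d, f')" by (cases e) auto
  have "feed (Reset c t f) (map (\<lambda>(a, b). Cell a b) ms) = (Reset c t f, cells (map fst ms))" for f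
    by (induction ms) auto
  from feed_append[OF this] show ?thesis by (auto simp: e)
qed

text \<open>Marks and failure flags left from the previous round are cleared here, which is why
  \<open>raw_word\<close> may contain arbitrary ones.\<close>

lemma feed_Reset:
  "\<exists>f'. feed (Reset c t f) (concat (map raw_word rs)) =
     (Reset c t f', concat (map (marked 0 u t) (map entry_of rs)))"
proof (induction rs arbitrary: f)
  case (Cons e rs)
  obtain f' where "feed (Reset c t (fst e \<noteq> t)) (concat (map raw_word rs)) =
     (Reset c t f', concat (map (marked 0 u t) (map entry_of rs)))" using Cons.IH by blast
  from feed_append[OF feed_Reset_word[of c t f e u] this] show ?case by auto
qed simp

text \<open>A word without unmarked cells that has not failed is a strict prefix of
  \<open>u\<close>, since \<open>u\<close> still has the letter at position \<open>j\<close>. It is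
  reported in \<open>s\<close> and fails from then on.\<close>

lemma feed_Cmp_word:
  assumes "j < length u"
  shows "feed (Cmp c t (u ! j) s x) (marked j u t (t', d, w)) =
    (Cmp c t (u ! j) (s \<or> t' = t \<and> length w \<le> j \<and> take j w = take j u) (Some False), marked (Suc j) u t (t', d, w))"
proof -
  have 1: "feed (Cmp c t a s None) (map (\<lambda>a. Cell a True) v) = (Cmp c t a s None, map (\<lambda>a. Cell a True) v)" for a v
    by (induction v) auto
  have 2: "feed (Cmp c t a s (Some y)) (cells v) = (Cmp c t a s (Some y), cells v)" for a v y
    by (induction v) auto
  show ?thesis
  proof (cases "length w \<le> j")
    case True
    have "length (take (Suc j) u) = Suc j" using assms by simp
    then have "w \<noteq> take (Suc j) u" using True by auto
    then show ?thesis
      using True by (auto simp: feed_append_eq 1)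
  next
    case False
    then have w: "drop j w = w ! j # drop (Suc j) w" "take (Suc j) w = take j w @ [w ! j]"
      and u: "take (Suc j) u = take j u @ [u ! j]"
      using assms by (simp_all add: Cons_nth_drop_Suc take_Suc_conv_app_nth)
    let ?f = "t' \<noteq> t \<or> take j w \<noteq> take j u"
    have "feed (Cmp c t (u ! j) s None) (cells (drop j w) @ [Tail d ?f]) =
      (Cmp c t (u ! j) s (Some False), Cell (w ! j) True # cells (drop (Suc j) w) @ [Tail d (?f \<or> w ! j \<noteq> u ! j)])"
      by (auto simp add: w(1) feed_append_eq 2)
    then have "feed (Cmp c t (u ! j) s x) (marked j u t (t', d, w)) =
      (Cmp c t (u ! j) s (Some False), Head t' # map (\<lambda>a. Cell a True) (take j w) @
        Cell (w ! j) True # cells (drop (Suc j) w) @ [Tail d (?f \<or> w ! j \<noteq> u ! j)])"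
      by (simp add: feed_append_eq 1)
    moreover have "?f \<or> w ! j \<noteq> u ! j \<longleftrightarrow> t' \<noteq> t \<or> take (Suc j) w \<noteq> take (Suc j) u"
      using u w(2) by (metis append1_eq_conv)
    ultimately show ?thesis using False by (simp add: w)
  qed
qed

lemma feed_Cmp:
  assumes "j < length u"
  shows "\<exists>x'. feed (Cmp c t (u ! j) s x) (concat (map (marked j u t) es)) =
     (Cmp c t (u ! j) (s \<or> (\<exists>(t', d, w)\<in>set es. t' = t \<and> length w \<le> j \<and> take j w = take j u)) x',
      concat (map (marked (Suc j) u t) es))"
proof (induction es arbitrary: s x)
  case (Cons e es)
  obtain t' d w where e: "e = (t', d, w)" by (cases e) auto
  let ?s = "s \<or> t' = t \<and> length w \<le> j \<and> take j w = take j u"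
  obtain x' where "feed (Cmp c t (u ! j) ?s (Some False)) (concat (map (marked j u t) es)) =
     (Cmp c t (u ! j) (?s \<or> (\<exists>(t', d, w)\<in>set es. t' = t \<and> length w \<le> j \<and> take j w = take j u)) x',
      concat (map (marked (Suc j) u t) es))" using Cons.IH by blast
  from feed_append[OF feed_Cmp_word[OF assms] this]
  show ?case by (auto simp: e disj_assoc)
qed auto

text \<open>Once all letters of \<open>u\<close> have been compared, the absence of failure means
  that \<open>u\<close> is a prefix, and a remaining unmarked cell that it is a strict one.\<close>

lemma feed_Fin_word:
  "feed (Fin c t e) (marked (length u) u t (t', d, w)) =
    (if conflict t u (t', d, w) then (Verdict False, Head t' # map (\<lambda>a. Cell a True) (take (length u) w) @ cells (drop (length u) w))
     else (Fin c t (drop (length u) w \<noteq> []),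
       raw_word (t', map (\<lambda>a. (a, True)) (take (length u) w) @ map (\<lambda>a. (a, False)) (drop (length u) w),
         d \<or> t' = t \<and> prefix u w, t' \<noteq> t \<or> \<not> prefix u w)))"
proof -
  have 1: "feed (Fin c t e) (map (\<lambda>a. Cell a True) v) = (Fin c t e, map (\<lambda>a. Cell a True) v)" for v e
    by (induction v) auto
  have 2: "feed (Fin c t e) (cells v) = (Fin c t (e \<or> v \<noteq> []), cells v)" for v e
    by (induction v arbitrary: e) auto
  have "strict_prefix u w \<longleftrightarrow> prefix u w \<and> drop (length u) w \<noteq> []"
    by (auto simp: strict_prefix_def prefix_def)
  then show ?thesis
    by (auto simp: prefix_take feed_append_eq 1 2)
qed

lemma feed_Fin:
  "if \<exists>e\<in>set es. conflict t u e then fst (feed (Fin c t x) (concat (map (marked (length u) u t) es))) = Verdict False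
   else \<exists>x' rs. feed (Fin c t x) (concat (map (marked (length u) u t) es)) = (Fin c t x', concat (map raw_word rs))
     \<and> map entry_of rs = map (shadow t u) es"
proof (induction es arbitrary: x)
  case (Cons e es)
  obtain t' d w where e: "e = (t', d, w)" by (cases e) auto
  let ?r = "(t', map (\<lambda>a. (a, True)) (take (length u) w) @ map (\<lambda>a. (a, False)) (drop (length u) w),
         d \<or> t' = t \<and> prefix u w, t' \<noteq> t \<or> \<not> prefix u w)"
  have entry: "entry_of ?r = shadow t u e" by (simp add: e comp_def)
  let ?tl = "concat (map (marked (length u) u t) es)"
  show ?case
  proof (cases "conflict t u e")
    case True
    then have "fst (feed (Fin c t x) (marked (length u) u t e)) = Verdict False"
      using feed_Fin_word[of c t x u t' d w] by (simp add: e)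
    then show ?thesis using True by (simp add: fst_feed_append feed_Verdict)
  next
    case False
    then have f: "feed (Fin c t x) (marked (length u) u t e) = (Fin c t (drop (length u) w \<noteq> []), raw_word ?r)"
      using feed_Fin_word[of c t x u t' d w] by (simp add: e)
    show ?thesis
    proof (cases "\<exists>e\<in>set es. conflict t u e")
      case True
      then have "fst (feed (Fin c t (drop (length u) w \<noteq> [])) ?tl) = Verdict False"
        using Cons.IH[of "drop (length u) w \<noteq> []"] by simp
      then show ?thesis using True f by (simp add: fst_feed_append)
    next
      case F: False
      then obtain x' rs where rs: "feed (Fin c t (drop (length u) w \<noteq> [])) ?tl = (Fin c t x', concat (map raw_word rs))"
        "map entry_of rs = map (shadow t u) es"
        using Cons.IH[of "drop (length u) w \<noteq> []"] by auto
      have "feed (Fin c t x) (concat (map (marked (length u) u t) (e # es))) = (Fin c t x', concat (map raw_word (?r # rs)))"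
        using feed_append[OF f rs(1)] by simp
      moreover have "map entry_of (?r # rs) = map (shadow t u) (e # es)" using entry rs(2) by simp
      ultimately show ?thesis using F False by (metis (no_types, lifting) set_ConsD)
    qed
  qed
qed auto

text \<open>The effect of the passes on the level of lists. Each round removes the first word, so
  every pair is examined once: the flag \<open>s\<close> and the conflicts cover both directions. A
  word is counted unless an earlier word is a prefix of it or a later one a strict prefix.\<close>

fun compare :: "nat option \<Rightarrow> (tag \<times> bool \<times> word) list \<Rightarrow> nat option option" where
  "compare c [] = Some c"
| "compare c ((t, d, u) # es) = (let s = \<exists>(t', d', w)\<in>set es. t' = t \<and> strict_prefix w u in
     if s \<and> t \<noteq> Img \<or> (\<exists>e\<in>set es. conflict t u e) then None
     else compare (if t \<noteq> Arg \<and> \<not> d \<and> \<not> s then tick c else c) (map (shadow t u) es))"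

lemma compare_letters:
  assumes "boundary rest" "sum_list (map weight es) + length u + 1 + length rest \<le> B" "j \<le> length u"
    and "run B n (r, Front c t (below t u es (length u)))
      (Tail d True # concat (map (marked (length u) u t) es) @ rest) b"
  shows "run B (n + (length u - j)) (r, Front c t (below t u es j))
      (cells (drop j u) @ Tail d True # concat (map (marked j u t) es) @ rest) b"
  using assms(3)
proof (induction "length u - j" arbitrary: j)
  case 0
  then show ?case using assms(4) by simp
next
  case (Suc l)
  then have j: "j < length u" by simp
  then have dr: "drop j u = u ! j # drop (Suc j) u" by (simp add: Cons_nth_drop_Suc)
  let ?a = "u ! j" and ?s = "below t u es j"
  obtain x' where x': "feed (Cmp c t ?a ?s (Some False)) (concat (map (marked j u t) es)) =
     (Cmp c t ?a (below t u es (Suc j)) x', concat (map (marked (Suc j) u t) es))"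
    using feed_Cmp[OF j] unfolding below_Suc[OF j] by blast
  have "feed (Cmp c t ?a ?s (Some False)) (cells v @ [Tail d True]) =
      (Cmp c t ?a ?s (Some False), cells v @ [Tail d True])" for v
    by (induction v) auto
  from feed_append[OF this x', of "drop (Suc j) u"]
  have "feed (Front c t ?s) ((cells (drop j u) @ [Tail d True]) @ concat (map (marked j u t) es)) =
     (Cmp c t ?a (below t u es (Suc j)) x',
      cells (drop (Suc j) u) @ Tail d True # concat (map (marked (Suc j) u t) es))" (is "feed _ ?str = (?q, ?out)")
    by (simp add: dr)
  moreover have "\<forall>y\<in>set ?str. \<not> marks_item y" using marked_no_mark by auto
  moreover have "pass (r, ?q) rest = ((r, Front c t (below t u es (Suc j))), [] @ rest)"
    by (rule pass_boundary[OF assms(1)]) (auto simp: regular_def skip_def)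
  ultimately have p: "pass (r, Front c t ?s) (?str @ rest) = ((r, Front c t (below t u es (Suc j))), (?out @ []) @ rest)"
    by (rule pass_feed_rest)
  have len: "length (?str @ rest) \<le> B" "length (?out @ rest) \<le> B"
    using assms(2) j length_marked[of j u t es] length_marked[of "Suc j" u t es] by simp_all
  have "run B (n + (length u - Suc j)) (r, Front c t (below t u es (Suc j))) (?out @ rest) b"
    using Suc.hyps(1)[of "Suc j"] Suc.hyps(2) j by simp
  from run_pass[OF p[unfolded append_Nil2] _ len this] have "run B (Suc (n + (length u - Suc j))) (r, Front c t ?s) (?str @ rest) b"
    by (simp add: skip_def)
  moreover have "Suc (n + (length u - Suc j)) = n + (length u - j)" using j by simp
  ultimately have "run B (n + (length u - j)) (r, Front c t ?s) (?str @ rest) b" by (simp only:)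
  then show ?case by simp
qed

text \<open>A round takes one pass to reset, one per letter of the removed word and one to finish,
  which is exactly the weight of that word. \<open>B\<close> exceeds twice \<open>N\<close> because
  rejecting passes are bounded only by \<open>pass_slim\<close>.\<close>

lemma compare_run:
  assumes "boundary rest" "sum_list (map weight (map entry_of rs)) + length rest \<le> N" "2 * N + 2 \<le> B"
    and "case compare c (map entry_of rs) of Some c' \<Rightarrow> run B n (r, Pick c') rest b | None \<Rightarrow> \<not> b"
  shows "run B (n + sum_list (map weight (map entry_of rs))) (r, Pick c) (concat (map raw_word rs) @ rest) b"
  using assms(2,4)
proof (induction "length rs" arbitrary: rs c)
  case 0
  then show ?case by simp
next
  case (Suc l)
  then obtain e rs' where rs: "rs = e # rs'" "length rs' = l" by (cases rs) auto
  obtain t ms d f where e: "e = (t, ms, d, f)" by (cases e) auto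
  define u where "u = map fst ms"
  define es where "es = map entry_of rs'"
  let ?W = "sum_list (map weight es)"
  have W: "sum_list (map weight (map entry_of rs)) = length u + 2 + ?W"
    by (simp add: rs e u_def es_def)
  have N: "length u + 2 + ?W + length rest \<le> N" using Suc.prems(1) W by simp
  have ent: "map entry_of rs = (t, d, u) # es" by (simp add: rs e u_def es_def)
  let ?s = "below t u es (length u)"
  let ?c' = "if t \<noteq> Arg \<and> \<not> d \<and> \<not> ?s then tick c else c"
  let ?fin = "Tail d True # concat (map (marked (length u) u t) es)"
  have fin_mark: "\<forall>y\<in>set ?fin. \<not> marks_item y" using marked_no_mark by auto
  have fin_len: "length (?fin @ rest) \<le> N" using N length_marked[of "length u" u t es] by simp
  have B: "2 * length (?fin @ rest) + 2 \<le> B" using fin_len assms(3) by linarith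
  have cmp: "compare c (map entry_of rs) =
      (if ?s \<and> t \<noteq> Img \<or> (\<exists>e\<in>set es. conflict t u e) then None else compare ?c' (map (shadow t u) es))"
    unfolding ent compare.simps Let_def below_length by (rule refl)
  have final: "run B (n + ?W + 1) (r, Front c t ?s) (?fin @ rest) b"
  proof (cases "?s \<and> t \<noteq> Img \<or> (\<exists>e\<in>set es. conflict t u e)")
    case True
    then have "\<not> b" using Suc.prems(2) cmp by simp
    have "fst (feed (Front c t ?s) ?fin) = (if ?s \<and> t \<noteq> Img then Verdict False
        else fst (feed (Fin ?c' t False) (concat (map (marked (length u) u t) es))))"
      by (simp add: case_prod_beta feed_Verdict)
    moreover have "fst (feed (Fin ?c' t False) (concat (map (marked (length u) u t) es))) = Verdict False"
      if "\<exists>e\<in>set es. conflict t u e"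
      using feed_Fin[of es t u "?c'" False] that by (simp only: if_True)
    ultimately have "fst (feed (Front c t ?s) ?fin) = Verdict False" using True by presburger
    then obtain out where "feed (Front c t ?s) ?fin = (Verdict False, out)" by (metis prod.collapse)
    then have "fst (pass (r, Front c t ?s) (?fin @ rest)) = (r, Verdict False)"
      using pass_feed[OF fin_mark] by (simp add: pass_Verdict)
    from run_verdict[OF this _ B] show ?thesis using \<open>\<not> b\<close> by simp
  next
    case False
    then obtain x' rs'' where f: "feed (Fin ?c' t False) (concat (map (marked (length u) u t) es)) =
        (Fin ?c' t x', concat (map raw_word rs''))" and ent': "map entry_of rs'' = map (shadow t u) es"
      using feed_Fin[of es t u "?c'" False] by auto
    have "feed (Front c t ?s) ?fin = (Fin ?c' t x', concat (map raw_word rs''))"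
      using f False by auto
    moreover have "pass (r, Fin ?c' t x') rest = ((r, Pick ?c'), [] @ rest)"
      by (rule pass_boundary[OF assms(1)]) (auto simp: regular_def skip_def)
    ultimately have p: "pass (r, Front c t ?s) (?fin @ rest) = ((r, Pick ?c'), concat (map raw_word rs'') @ rest)"
      using pass_feed[OF fin_mark] by simp
    have w: "sum_list (map weight (map entry_of rs'')) = ?W" unfolding ent' by (rule weight_shadow)
    have "run B (n + sum_list (map weight (map entry_of rs''))) (r, Pick ?c') (concat (map raw_word rs'') @ rest) b"
    proof (rule Suc.hyps(1))
      show "l = length rs''" using ent' rs(2) unfolding es_def by (metis length_map)
      show "sum_list (map weight (map entry_of rs'')) + length rest \<le> N" using w N by simp
      show "case compare ?c' (map entry_of rs'') of Some c' \<Rightarrow> run B n (r, Pick c') rest b | None \<Rightarrow> \<not> b"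
        using Suc.prems(2) cmp False unfolding ent' by simp
    qed
    then have "run B (n + ?W) (r, Pick ?c') (concat (map raw_word rs'') @ rest) b" unfolding w .
    moreover have "length (concat (map raw_word rs'') @ rest) \<le> B"
      using length_raw_words[of rs''] w N assms(3) by simp
    ultimately have "run B (Suc (n + ?W)) (r, Front c t ?s) (?fin @ rest) b"
      using B by (intro run_pass[OF p]) (auto simp: skip_def)
    then show ?thesis by simp
  qed
  have letters: "run B (n + ?W + 1 + (length u - 0)) (r, Front c t (below t u es 0))
      (cells (drop 0 u) @ Tail d True # concat (map (marked 0 u t) es) @ rest) b"
    by (rule compare_letters[OF assms(1)]) (use final N assms(3) in auto)
  have "feed (Reset c t f) (map (\<lambda>(a, b). Cell a b) ms) = (Reset c t f, cells u)" for f
    unfolding u_def by (induction ms) auto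
  moreover have "feed (Reset c t True) [Tail d f] = (Reset c t True, [Tail d True])" by simp
  moreover obtain f'' where f'': "feed (Reset c t True) (concat (map raw_word rs')) =
     (Reset c t f'', concat (map (marked 0 u t) es))" using feed_Reset unfolding es_def by blast
  ultimately have "feed (Reset c t True) (map (\<lambda>(a, b). Cell a b) ms @ [Tail d f] @ concat (map raw_word rs')) =
     (Reset c t f'', cells u @ [Tail d True] @ concat (map (marked 0 u t) es))"
    by (intro feed_append)
  then have "feed (Pick c) (concat (map raw_word rs)) =
     (Reset c t f'', cells u @ Tail d True # concat (map (marked 0 u t) es))" (is "_ = (?q, ?out)")
    by (simp add: rs e)
  moreover have "\<forall>y\<in>set (concat (map raw_word rs)). \<not> marks_item y" using raw_word_no_mark by auto
  moreover have "pass (r, ?q) rest = ((r, Front c t False), [] @ rest)"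
    by (rule pass_boundary[OF assms(1)]) (auto simp: regular_def skip_def)
  ultimately have p: "pass (r, Pick c) (concat (map raw_word rs) @ rest) = ((r, Front c t False), ?out @ rest)"
    using pass_feed_rest[of "Pick c" _ ?q ?out r rest r "Front c t False" "[]"] by simp
  have "below t u es 0 = False" by (simp add: below_def)
  then have "run B (n + ?W + 1 + length u) (r, Front c t False) (?out @ rest) b" using letters by simp
  moreover have "length (?out @ rest) \<le> B" "length (concat (map raw_word rs) @ rest) \<le> B"
    using N assms(3) length_marked[of 0 u t es] length_raw_words[of rs] W by simp_all
  ultimately have "run B (Suc (n + ?W + 1 + length u)) (r, Pick c) (concat (map raw_word rs) @ rest) b"
    by (intro run_pass[OF p]) (auto simp: skip_def)
  then show ?case unfolding W by (simp add: add.commute add.left_commute)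
qed

end

section \<open>Generators for the image of an ideal\<close>

fun factor :: "word list \<Rightarrow> word \<Rightarrow> word \<Rightarrow> (word \<times> word) option" where
  "factor P u [] = (if u \<in> set P then Some (u, []) else None)"
| "factor P u (a # v) = (if u \<in> set P then Some (u, a # v) else factor P (u @ [a]) v)"

lemma factor_Some: "factor P u v = Some (p, s) \<Longrightarrow> p \<in> set P \<and> u @ v = p @ s \<and> prefix u p"
proof (induction v arbitrary: u)
  case (Cons a v)
  then show ?case using append_prefixD by (fastforce split: if_splits)
qed (auto split: if_splits)

lemma factor_None: "factor P u v = None \<Longrightarrow> p \<in> set P \<Longrightarrow> prefix u p \<Longrightarrow> \<not> prefix p (u @ v)"
proof (induction v arbitrary: u)
  case Nil
  then show ?case by (auto split: if_splits dest: prefix_order.antisym)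
next
  case (Cons a v)
  then have u: "u \<notin> set P" "factor P (u @ [a]) v = None" by (auto split: if_splits)
  obtain z where z: "p = u @ z" using Cons.prems(3) by (auto simp: prefix_def)
  then obtain x z' where z': "z = x # z'" using u(1) Cons.prems(2) by (cases z) auto
  show ?case
  proof
    assume "prefix p (u @ a # v)"
    then have p: "prefix p ((u @ [a]) @ v)" and "x = a" using z z' by auto
    then have "prefix (u @ [a]) p" using z z' by simp
    then show False using Cons.IH[OF u(2) Cons.prems(2)] p by blast
  qed
qed

text \<open>A word either contains a generator of the domain as a prefix, and is mapped, or it is
  replaced by the images of the generators extending it. Each generator is used at most once
  (\<open>ps\<close> are those still available); this keeps the list from growing exponentially.\<close>

definition apply_word :: "word list \<Rightarrow> (word \<Rightarrow> word) \<Rightarrow> word list \<Rightarrow> word \<Rightarrow> word list \<times> word list" where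
  "apply_word P f ps w = (case factor P [] w of Some (p, s) \<Rightarrow> ([f p @ s], ps)
     | None \<Rightarrow> (map f (filter (prefix w) ps), filter (\<lambda>p. \<not> prefix w p) ps))"

fun apply_words :: "word list \<Rightarrow> (word \<Rightarrow> word) \<Rightarrow> word list \<Rightarrow> word list \<Rightarrow> word list" where
  "apply_words P f ps [] = []"
| "apply_words P f ps (w # ws) = fst (apply_word P f ps w) @ apply_words P f (snd (apply_word P f ps w)) ws"

text \<open>The first alternative accounts for domain generators that are already used up: their
  full images were written earlier and cover all words below them. It cannot occur when every
  generator is available at the start.\<close>

lemma apply_words_covers:
  assumes "w \<in> set ws" "prefix w x" "p \<in> set P" "prefix p x"
  shows "(\<exists>q\<in>set P - set ps. prefix q x) \<or>
    (\<exists>z\<in>set (apply_words P f ps ws). \<exists>q\<in>set P. \<exists>s. z = f q @ s \<and> prefix (q @ s) x)"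
  using assms(1)
proof (induction ws arbitrary: ps)
  case (Cons a ws)
  let ?o = "fst (apply_word P f ps a)" and ?ps = "snd (apply_word P f ps a)"
  show ?case
  proof (cases "w = a")
    case True
    show ?thesis
    proof (cases "factor P [] a")
      case None
      then have "\<not> prefix p a" using factor_None[of P "[]" a p] assms(3) by simp
      then have "prefix a p" using assms(2,4) True by (meson prefix_same_cases)
      then have "p \<in> set ps \<Longrightarrow> f p \<in> set ?o" using None by (simp add: apply_word_def)
      moreover have "f p = f p @ [] \<and> prefix (p @ []) x" using assms(4) by simp
      ultimately show ?thesis using assms(3,4) by (cases "p \<in> set ps") (simp only: apply_words.simps set_append, blast)+
    next
      case (Some ps')
      then obtain q s where qs: "factor P [] a = Some (q, s)" by (cases ps') auto
      then have "q \<in> set P" "a = q @ s" using factor_Some by fastforce+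
      moreover have "f q @ s \<in> set ?o" using qs by (simp add: apply_word_def)
      ultimately show ?thesis using assms(2) True by auto
    qed
  next
    case False
    then have "w \<in> set ws" using Cons.prems by simp
    from Cons.IH[OF this, of ?ps] show ?thesis
    proof
      assume "\<exists>q\<in>set P - set ?ps. prefix q x"
      then obtain q where q: "q \<in> set P" "q \<notin> set ?ps" "prefix q x" by blast
      show ?thesis
      proof (cases "q \<in> set ps")
        case True
        then have "f q \<in> set ?o" using q(2) by (auto simp: apply_word_def split: option.splits)
        moreover have "f q = f q @ [] \<and> prefix (q @ []) x" using q by simp
        ultimately show ?thesis using q(1) by (simp only: apply_words.simps set_append) blast
      qed (use q in blast)
    qed auto
  qed
qed simp

text \<open>The final disjunction keeps lengths under control: an output word is either the image of
  a generator or arises from an old word by replacing a prefix.\<close>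

lemma apply_words_sound:
  assumes "set ps \<subseteq> set P" "z \<in> set (apply_words P f ps ws)"
  shows "\<exists>w\<in>set ws. \<exists>q\<in>set P. \<exists>s. z = f q @ s \<and> prefix w (q @ s) \<and> (s = [] \<or> q @ s = w)"
  using assms
proof (induction ws arbitrary: ps)
  case (Cons a ws)
  show ?case
  proof (cases "z \<in> set (fst (apply_word P f ps a))")
    case True
    show ?thesis
    proof (cases "factor P [] a")
      case None
      then obtain q where "q \<in> set ps" "prefix a q" "z = f q" using True by (auto simp: apply_word_def)
      then show ?thesis using Cons.prems(1) by (intro bexI[of _ a] bexI[of _ q] exI[of _ "[]"]) auto
    next
      case (Some ps')
      then obtain q s where qs: "factor P [] a = Some (q, s)" by (cases ps') auto
      then have "q \<in> set P" "a = q @ s" using factor_Some by fastforce+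
      moreover have "z = f q @ s" using qs True by (simp add: apply_word_def)
      ultimately show ?thesis by auto
    qed
  next
    case False
    moreover have "set (snd (apply_word P f ps a)) \<subseteq> set P"
      using Cons.prems(1) by (auto simp: apply_word_def split: option.splits)
    ultimately show ?thesis using Cons.IH[of "snd (apply_word P f ps a)"] Cons.prems(2) by auto
  qed
qed simp

text \<open>The covering argument runs with all of \<open>P\<close> available, so reusing no
  generator loses nothing: the new list generates exactly the image, not merely an essentially equal
  ideal.\<close>

lemma apply_words_ideal:
  assumes \<psi>: "right_ideal_hom k \<psi>" "dom \<psi> = ideal_of k (set P)" and f: "\<And>p. p \<in> set P \<Longrightarrow> \<psi> p = Some (f p)"
    and ws: "set ws \<subseteq> words k"
  shows "ideal_of k (set (apply_words P f P ws)) = ideal_image \<psi> (ideal_of k (set ws))"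
proof (intro equalityI subsetI)
  fix y
  assume "y \<in> ideal_image \<psi> (ideal_of k (set ws))"
  then obtain x where x: "x \<in> ideal_of k (set ws)" "\<psi> x = Some y" by (auto simp: ideal_image_def)
  then obtain w v where w: "w \<in> set ws" "prefix w x" by (auto simp: ideal_of_def)
  have "x \<in> ideal_of k (set P)" using x(2) \<psi>(2) by blast
  then obtain p where p: "p \<in> set P" "prefix p x" by (auto simp: ideal_of_def)
  obtain z q s where z: "z \<in> set (apply_words P f P ws)" "q \<in> set P" "z = f q @ s" "prefix (q @ s) x"
    using apply_words_covers[OF w p, of P f] by blast
  then obtain t where t: "x = q @ s @ t" by (auto simp: prefix_def)
  then have "s @ t \<in> words k" using homD(6)[OF \<psi>(1) x(2)] by simp
  then have "y = z @ t" using homD(5)[OF \<psi>(1) f[OF z(2)]] t x(2) z(3) by simp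
  then show "y \<in> ideal_of k (set (apply_words P f P ws))"
    using z(1) \<open>s @ t \<in> words k\<close> unfolding ideal_of_def by auto
next
  fix y
  assume "y \<in> ideal_of k (set (apply_words P f P ws))"
  then obtain z t where z: "z \<in> set (apply_words P f P ws)" "t \<in> words k" "y = z @ t" by (auto simp: ideal_of_def)
  obtain w q s where w: "w \<in> set ws" "q \<in> set P" "z = f q @ s" "prefix w (q @ s)" "s = [] \<or> q @ s = w"
    using apply_words_sound[OF subset_refl z(1)] by blast
  have q: "q \<in> words k" using homD(6)[OF \<psi>(1) f[OF w(2)]] .
  then have qs: "q @ s \<in> words k" using w(1,5) ws by auto
  then have "\<psi> (q @ s @ t) = Some y" using homD(5)[OF \<psi>(1) f[OF w(2)], of "s @ t"] z w(3) by simp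
  moreover have "q @ s @ t \<in> ideal_of k (set ws)"
  proof -
    obtain v where v: "q @ s = w @ v" using w(4) by (auto simp: prefix_def)
    then have "v @ t \<in> words k" using qs z(2) by auto
    then show ?thesis using w(1) v unfolding ideal_of_def by (metis (mono_tags, lifting) append_assoc mem_Collect_eq)
  qed
  ultimately show "y \<in> ideal_image \<psi> (ideal_of k (set ws))" by (auto simp: ideal_image_def)
qed

text \<open>Amortised count: a word yields either a single word or one word for each available
  generator it uses up.\<close>

lemma length_apply_word: "length (fst (apply_word P f ps w)) + length (snd (apply_word P f ps w)) \<le> length ps + 1"
  by (auto simp: apply_word_def sum_length_filter_compl split: option.split)

lemma length_apply_words: "length (apply_words P f ps ws) \<le> length ws + length ps"
proof (induction ws arbitrary: ps)
  case (Cons w ws)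
  show ?case using Cons.IH[of "snd (apply_word P f ps w)"] length_apply_word[of P f ps w] by simp
qed simp

lemma apply_words_letter_bound:
  assumes "set ps \<subseteq> set P" "\<And>p. p \<in> set P \<Longrightarrow> length (f p) \<le> C" "\<And>w. w \<in> set ws \<Longrightarrow> length w \<le> M"
    "z \<in> set (apply_words P f ps ws)"
  shows "length z \<le> M + C"
proof -
  obtain w q s where w: "w \<in> set ws" "q \<in> set P" "z = f q @ s" "s = [] \<or> q @ s = w"
    using apply_words_sound[OF assms(1,4)] by blast
  then have "length s \<le> M" using assms(3) by fastforce
  then show ?thesis using w assms(2)[OF w(2)] by simp
qed

section \<open>Pairwise conditions and minimal words of a tagged list\<close>

definition tagged :: "tag \<Rightarrow> (tag \<times> bool \<times> word) list \<Rightarrow> word list" where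
  "tagged t es = map (\<lambda>e. snd (snd e)) (filter (\<lambda>e. fst e = t) es)"

lemma tagged_simps [simp]:
  "tagged t [] = []" "tagged t ((t', d, w) # es) = (if t' = t then w # tagged t es else tagged t es)"
  "tagged t (es @ es') = tagged t es @ tagged t es'"
  by (auto simp: tagged_def)

lemma tagged_shadow [simp]: "tagged t (map (shadow t' u) es) = tagged t es"
  by (induction es) auto

lemma set_tagged: "w \<in> set (tagged t es) \<longleftrightarrow> (\<exists>d. (t, d, w) \<in> set es)"
  by (induction es) (auto split: if_splits)

abbreviation incomparable :: "word \<Rightarrow> word \<Rightarrow> bool" where
  "incomparable u w \<equiv> \<not> prefix u w \<and> \<not> prefix w u"

abbreviation not_strict :: "word \<Rightarrow> word \<Rightarrow> bool" where
  "not_strict u w \<equiv> \<not> strict_prefix u w \<and> \<not> strict_prefix w u"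

text \<open>Comparing each word with all later ones yields a \<open>sorted_wrt\<close> statement.
  The relation is symmetric, so this is the condition for all pairs, and incomparability also rules
  out repetitions.\<close>

lemma sorted_wrt_incomparable: "sorted_wrt incomparable us \<longleftrightarrow> distinct us \<and> prefix_code (set us)"
proof (induction us)
  case (Cons u us)
  have "(\<forall>w\<in>set us. incomparable u w) \<longleftrightarrow> u \<notin> set us \<and> (\<forall>w\<in>set us. not_strict u w)"
    by (auto simp: strict_prefix_def)
  then show ?case using Cons.IH by (auto simp: prefix_code_def)
qed (simp add: prefix_code_def)

lemma sorted_wrt_not_strict: "sorted_wrt not_strict us \<longleftrightarrow> prefix_code (set us)"
  by (induction us) (auto simp: prefix_code_def)

text \<open>The recursion behind the count. \<open>U\<close> collects the earlier words; the new
  word contributes unless one of them is a prefix of it or a remaining word is a strict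
  prefix.\<close>

lemma min_gens_insert:
  "{w \<in> min_gens (insert u X). \<forall>x\<in>U. \<not> prefix x w} =
   {w \<in> min_gens X. \<forall>x\<in>insert u U. \<not> prefix x w} \<union>
   (if (\<exists>x\<in>U. prefix x u) \<or> (\<exists>w\<in>X. strict_prefix w u) then {} else {u})"
  by (auto simp: min_gens_def strict_prefix_def)

context procedure
begin

subsection \<open>Application of a generator\<close>

lemma feed_enter:
  assumes "set ps \<subseteq> set (gens g)"
  shows "fst (feed (fst (enter g u ps)) (cells v @ [Tail False False])) =
      (case factor (gens g) u v of Some (p, s) \<Rightarrow> Gap g ps | None \<Rightarrow> Gap g (filter (\<lambda>p. \<not> prefix (u @ v) p) ps)) \<and>
    snd (enter g u ps) @ snd (feed (fst (enter g u ps)) (cells v @ [Tail False False])) =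
      (case factor (gens g) u v of Some (p, s) \<Rightarrow> image_word (img g p @ s)
       | None \<Rightarrow> concat (map (\<lambda>p. image_word (img g p)) (filter (prefix (u @ v)) ps)))"
proof (induction v arbitrary: u)
  case Nil
  have "filter (prefix u) ps = [] \<and> filter (\<lambda>p. \<not> prefix u p) ps = ps" if "\<not> (\<exists>p\<in>set (gens g). prefix u p)"
    using that assms by (auto simp: filter_empty_conv filter_id_conv)
  then show ?case by (auto simp: enter_def image_word_def)
next
  case (Cons a v)
  have copy: "feed (Copy g ps) (cells v) = (Copy g ps, cells v)" for v by (induction v) auto
  have drop: "feed (Discard g ps) (cells v) = (Discard g ps, [])" for v by (induction v) auto
  consider (copy) "u \<in> set (gens g)" | (scan) "u \<notin> set (gens g)" "\<exists>p\<in>set (gens g). prefix u p"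
    | (drop) "u \<notin> set (gens g)" "\<not> (\<exists>p\<in>set (gens g). prefix u p)" by blast
  then show ?case
  proof cases
    case copy
    then show ?thesis by (simp add: enter_def feed_append_eq \<open>\<And>v. feed (Copy g ps) (cells v) = _\<close> image_word_def)
  next
    case scan
    note IH = Cons.IH[of "u @ [a]", unfolded append_assoc append_Cons append_Nil]
    from scan show ?thesis using IH by (simp add: enter_def[of g u] case_prod_beta)
  next
    case drop
    \<comment> \<open>Since no domain generator extends \<open>u\<close>, the word can neither be
      factored further on nor be extended to a generator: nothing is written and all of
      \<open>ps\<close> remains available.\<close>
    have "factor (gens g) (u @ [a]) v = None"
    proof (rule ccontr)
      assume "factor (gens g) (u @ [a]) v \<noteq> None"
      then obtain p s where "factor (gens g) (u @ [a]) v = Some (p, s)" by auto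
      then have "p \<in> set (gens g)" "prefix u p" using factor_Some append_prefixD by blast+
      then show False using drop by blast
    qed
    moreover have "\<forall>p\<in>set ps. \<not> prefix (u @ a # v) p"
      using drop(2) assms append_prefixD by blast
    ultimately show ?thesis
      using drop \<open>\<And>v. feed (Discard g ps) (cells v) = _\<close>
      by (simp add: enter_def feed_append_eq filter_empty_conv filter_id_conv)
  qed
qed

lemma feed_Gap_word:
  assumes "set ps \<subseteq> set (gens g)"
  shows "feed (Gap g ps) (image_word w) =
    (Gap g (snd (apply_word (gens g) (img g) ps w)), concat (map image_word (fst (apply_word (gens g) (img g) ps w))))"
proof -
  have "feed (Gap g ps) (image_word w) = (fst (feed (fst (enter g [] ps)) (cells w @ [Tail False False])),
      snd (enter g [] ps) @ snd (feed (fst (enter g [] ps)) (cells w @ [Tail False False])))"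
    by (simp add: image_word_def case_prod_beta)
  then show ?thesis
    using feed_enter[OF assms, of "[]" w] by (auto simp: apply_word_def comp_def split: option.split)
qed

lemma feed_Gap:
  assumes "set ps \<subseteq> set (gens g)"
  shows "\<exists>ps'. feed (Gap g ps) (concat (map image_word ws)) =
    (Gap g ps', concat (map image_word (apply_words (gens g) (img g) ps ws)))"
  using assms
proof (induction ws arbitrary: ps)
  case (Cons w ws)
  let ?ps = "snd (apply_word (gens g) (img g) ps w)"
  have "set ?ps \<subseteq> set (gens g)" using Cons.prems by (auto simp: apply_word_def split: option.splits)
  from Cons.IH[OF this] obtain ps' where ps': "feed (Gap g ?ps) (concat (map image_word ws)) =
    (Gap g ps', concat (map image_word (apply_words (gens g) (img g) ?ps ws)))" by blast
  from feed_append[OF feed_Gap_word[OF Cons.prems] this] show ?case by auto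
qed auto

definition act :: "nat \<Rightarrow> word list \<Rightarrow> word list" where
  "act g ws = apply_words (gens g) (img g) (gens g) ws"

lemma image_word_no_mark: "y \<in> set (image_word w) \<Longrightarrow> \<not> marks_item y"
  by (auto simp: image_word_def)

text \<open>The last generator is the one applied, because the rightmost factor of a product acts
  first.\<close>

lemma eval_pass:
  assumes "boundary rest"
  shows "pass (r, Eval) (map (Sym \<circ> Generator) (gs @ [g]) @ concat (map image_word ws) @ rest) =
    ((r, Eval), map (Sym \<circ> Generator) gs @ concat (map image_word (act g ws)) @ rest)"
proof -
  have held: "feed (Held h) (map (Sym \<circ> Generator) (gs @ [g])) = (Held g, map (Sym \<circ> Generator) (h # gs))" for h gs
    by (induction gs arbitrary: h) auto
  have gens: "feed Eval (map (Sym \<circ> Generator) (gs @ [g])) = (Held g, map (Sym \<circ> Generator) gs)"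
    using held by (cases gs) auto
  have "\<exists>q. feed (Held g) (concat (map image_word ws)) = (q, concat (map image_word (act g ws))) \<and>
      finish q = (Eval, []) \<and> regular q"
  proof (cases ws)
    \<comment> \<open>Without any word the generator is still held when the item ends; the image
      stays empty and evaluation continues.\<close>
    case Nil
    then show ?thesis by (simp add: act_def regular_def)
  next
    case (Cons w ws')
    have "feed (Held g) (concat (map image_word ws)) = feed (Gap g (gens g)) (concat (map image_word ws))"
      by (simp add: Cons image_word_def)
    then show ?thesis using feed_Gap[OF subset_refl, of g ws] by (auto simp: act_def regular_def)
  qed
  then obtain q where q: "feed (Held g) (concat (map image_word ws)) = (q, concat (map image_word (act g ws)))"
    "finish q = (Eval, [])" "regular q" by blast
  have "pass (r, q) rest = ((r, Eval), [] @ rest)"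
    by (rule pass_boundary[OF assms q(2,3)]) (simp add: skip_def)
  moreover have "\<forall>y\<in>set (map (Sym \<circ> Generator) (gs @ [g]) @ concat (map image_word ws)). \<not> marks_item y"
    using image_word_no_mark by (auto simp: is_mark_def)
  ultimately show ?thesis using pass_feed_rest[OF feed_append[OF gens q(1)]] by simp
qed

text \<open>The initial list \<open>[[]]\<close> generates \<open>words k\<close>, the image of the
  identity.\<close>

definition eval_words :: "nat list \<Rightarrow> word list" where
  "eval_words v = foldr act v [[]]"

text \<open>Induction from the right follows the order in which generators are consumed. The
  intermediate lists belong to the suffixes of \<open>v\<close>, so the length bound is demanded for
  all of these.\<close>

lemma eval_run:
  assumes "boundary rest"
    and "\<And>gs. suffix gs v \<Longrightarrow> length v + length (concat (map image_word (foldr act gs ws))) + length rest \<le> B"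
    and "run B n (r, Pick None) (concat (map image_word (foldr act v ws)) @ rest) b"
  shows "run B (n + length v + 1) (r, Eval) (map (Sym \<circ> Generator) v @ concat (map image_word ws) @ rest) b"
  using assms(2,3)
proof (induction v arbitrary: ws rule: rev_induct)
  case Nil
  have p: "pass (r, Eval) (concat (map image_word ws) @ rest) = ((r, Pick None), concat (map image_word ws) @ rest)"
  proof (cases ws)
    case Nil
    then show ?thesis using pass_boundary[OF assms(1), of Eval "Pick None" "[]"] by (simp add: regular_def skip_def)
  next
    case (Cons w ws')
    then show ?thesis by (simp add: image_word_def step_inner pass_Skip)
  qed
  have "length (concat (map image_word ws) @ rest) \<le> B" using Nil.prems(1)[of "[]"] by simp
  then show ?case using run_pass[OF p] Nil.prems(2) by (simp add: skip_def)
next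
  case (snoc g gs)
  have "run B (n + length gs + 1) (r, Eval) (map (Sym \<circ> Generator) gs @ concat (map image_word (act g ws)) @ rest) b"
  proof (rule snoc.IH)
    fix hs
    assume "suffix hs gs"
    then have "suffix (hs @ [g]) (gs @ [g])" by (auto simp: suffix_def)
    from snoc.prems(1)[OF this]
    show "length gs + length (concat (map image_word (foldr act hs (act g ws)))) + length rest \<le> B" by simp
  qed (use snoc.prems(2) in simp)
  moreover have "length (map (Sym \<circ> Generator) (gs @ [g]) @ concat (map image_word ws) @ rest) \<le> B"
    using snoc.prems(1)[of "[]"] by simp
  moreover have "length (map (Sym \<circ> Generator) gs @ concat (map image_word (act g ws)) @ rest) \<le> B"
    using snoc.prems(1)[of "[g]"] by (simp add: suffix_def)
  ultimately have "run B (Suc (n + length gs + 1)) (r, Eval)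
      (map (Sym \<circ> Generator) (gs @ [g]) @ concat (map image_word ws) @ rest) b"
    by (intro run_pass[OF eval_pass[OF assms(1)]]) (simp_all add: skip_def)
  moreover have "Suc (n + length gs + 1) = n + length (gs @ [g]) + 1" by simp
  ultimately show ?case by (simp only:)
qed

subsection \<open>The result of the comparison\<close>

lemma compare_defined:
  "compare c es \<noteq> None \<longleftrightarrow> sorted_wrt incomparable (tagged Arg es) \<and> sorted_wrt not_strict (tagged Val es)"
proof (induction c es rule: compare.induct)
  case (2 c t d u es)
  let ?s = "\<exists>(t', d', w)\<in>set es. t' = t \<and> strict_prefix w u"
  have s: "?s \<longleftrightarrow> (\<exists>w\<in>set (tagged t es). strict_prefix w u)"
    by (auto simp: Bex_def set_tagged)
  have c: "(\<exists>e\<in>set es. conflict t u e) \<longleftrightarrow>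
      (t = Arg \<and> (\<exists>w\<in>set (tagged t es). prefix u w) \<or> t = Val \<and> (\<exists>w\<in>set (tagged t es). strict_prefix u w))"
    by (auto simp: Bex_def set_tagged)
  show ?case
  proof (cases "?s \<and> t \<noteq> Img \<or> (\<exists>e\<in>set es. conflict t u e)")
    case True
    then have "compare c ((t, d, u) # es) = None" by (simp only: compare.simps Let_def if_True)
    moreover have "\<not> (sorted_wrt incomparable (tagged Arg ((t, d, u) # es)) \<and>
        sorted_wrt not_strict (tagged Val ((t, d, u) # es)))"
      using True unfolding s c by (cases t) (auto simp: strict_prefix_def)
    ultimately show ?thesis by blast
  next
    case False
    then have "compare c ((t, d, u) # es) = compare (if t \<noteq> Arg \<and> \<not> d \<and> \<not> ?s then tick c else c) (map (shadow t u) es)"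
      by (simp only: compare.simps Let_def if_False)
    moreover have "compare (if t \<noteq> Arg \<and> \<not> d \<and> \<not> ?s then tick c else c) (map (shadow t u) es) \<noteq> None \<longleftrightarrow>
        sorted_wrt incomparable (tagged Arg es) \<and> sorted_wrt not_strict (tagged Val es)"
      using 2[OF refl False] by simp
    moreover have "sorted_wrt incomparable (tagged Arg ((t, d, u) # es)) \<and> sorted_wrt not_strict (tagged Val ((t, d, u) # es))
        \<longleftrightarrow> sorted_wrt incomparable (tagged Arg es) \<and> sorted_wrt not_strict (tagged Val es)"
      using False unfolding s c by (cases t) (auto simp: strict_prefix_def)
    ultimately show ?thesis by simp
  qed
qed simp

text \<open>The induction needs the general form in which some words have been removed already:
  \<open>U t\<close> is the set of those with tag \<open>t\<close>, and the flags \<open>d\<close>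
  record what they shadow. The procedure starts with empty sets.\<close>

lemma compare_count:
  assumes "\<forall>(t, d, w)\<in>set es. d \<longleftrightarrow> (\<exists>x\<in>U t. prefix x w)" "compare c es = Some c'"
  shows "c' = (tick ^^ (card {w \<in> min_gens (set (tagged Val es)). \<forall>x\<in>U Val. \<not> prefix x w} +
    card {w \<in> min_gens (set (tagged Img es)). \<forall>x\<in>U Img. \<not> prefix x w})) c"
  using assms
proof (induction c es arbitrary: U rule: compare.induct)
  case (1 c)
  then show ?case by (simp add: min_gens_def)
next
  case (2 c t d u es)
  let ?s = "\<exists>(t', d', w)\<in>set es. t' = t \<and> strict_prefix w u"
  let ?c = "if t \<noteq> Arg \<and> \<not> d \<and> \<not> ?s then tick c else c"
  have s: "?s \<longleftrightarrow> (\<exists>w\<in>set (tagged t es). strict_prefix w u)"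
    by (auto simp: Bex_def set_tagged)
  have F: "\<not> (?s \<and> t \<noteq> Img \<or> (\<exists>e\<in>set es. conflict t u e))"
    using 2(3) by (auto split: if_splits)
  then have cmp: "compare ?c (map (shadow t u) es) = Some c'"
    using 2(3) by (simp only: compare.simps Let_def if_False)
  define U' where "U' = U(t := insert u (U t))"
  have U': "\<forall>(t', d', w)\<in>set (map (shadow t u) es). d' \<longleftrightarrow> (\<exists>x\<in>U' t'. prefix x w)"
  proof
    fix e
    assume "e \<in> set (map (shadow t u) es)"
    then obtain t' d0 w where e: "(t', d0, w) \<in> set es" "e = shadow t u (t', d0, w)" by auto
    then have "d0 \<longleftrightarrow> (\<exists>x\<in>U t'. prefix x w)" using bspec[OF 2(2), of "(t', d0, w)"] by simp
    then show "case e of (t', d', w) \<Rightarrow> d' \<longleftrightarrow> (\<exists>x\<in>U' t'. prefix x w)" using e(2) by (auto simp: U'_def)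
  qed
  have d: "d \<longleftrightarrow> (\<exists>x\<in>U t. prefix x u)" using 2(2) by simp
  let ?N = "\<lambda>U es t. card {w \<in> min_gens (set (tagged t es)). \<forall>x\<in>U t. \<not> prefix x w}"
  have fin: "finite {w \<in> min_gens (set (tagged t es)). P w}" for t es P
    by (rule finite_subset[of _ "set (tagged t es)"]) (auto simp: min_gens_def)
  have N: "?N U ((t, d, u) # es) t = ?N U' es t + (if d \<or> ?s then 0 else 1)"
  proof -
    have "u \<notin> {w \<in> min_gens (set (tagged t es)). \<forall>x\<in>insert u (U t). \<not> prefix x w}" by simp
    then show ?thesis
      unfolding s d by (simp add: min_gens_insert U'_def fin)
  qed
  have N': "?N U ((t, d, u) # es) t' = ?N U' es t'" if "t' \<noteq> t" for t'
    using that by (simp add: U'_def)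
  have IH: "c' = (tick ^^ (?N U' es Val + ?N U' es Img)) ?c"
    using 2(1)[OF refl F U' cmp] by simp
  show ?case
  proof (cases t)
    case Arg
    then show ?thesis using IH N'[of Val] N'[of Img] by simp
  next
    case Val
    then show ?thesis using IH N N'[of Img] by (simp add: funpow_swap1)
  next
    case Img
    then show ?thesis using IH N N'[of Val] by (simp add: funpow_swap1)
  qed
qed

lemma tick_funpow: "(tick ^^ n) None = (if n = 0 then None else Some (n mod (k - 1)))"
proof (induction n)
  case (Suc n)
  then show ?case by (cases n) (simp_all add: tick_def mod_Suc_eq)
qed simp

lemma ideal_class_ideal_of:
  assumes "finite X" "X \<subseteq> words k"
  shows "ideal_class k (ideal_of k X) = (tick ^^ card (min_gens X)) None"
proof -
  have "min_gens X = {} \<longleftrightarrow> X = {}" by (metis (mono_tags, lifting) all_not_in_conv mem_Collect_eq min_gens_def min_gens_prefix)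
  moreover have "finite (min_gens X)" using assms(1) by (auto simp: min_gens_def)
  moreover have "ideal_of k X = {} \<longleftrightarrow> X = {}" using subset_ideal_of[of X k] by (auto simp: ideal_of_def)
  ultimately show ?thesis by (simp add: ideal_class_def tick_funpow min_gens_ideal_of[OF assms(2)])
qed

fun entries :: "monoid_input \<Rightarrow> (tag \<times> bool \<times> word) list" where
  "entries (Table T) = concat (map (\<lambda>(p, q). [(Arg, False, p), (Val, False, q)]) T)"
| "entries (Gen_Word v) = map (\<lambda>w. (Img, False, w)) (eval_words v)"

lemma tagged_entries_Table:
  "tagged Arg (entries (Table T)) = map fst T" "tagged Val (entries (Table T)) = map snd T"
  "tagged Img (entries (Table T)) = []"
  by (induction T) auto

lemma tagged_entries_Gen_Word:
  "tagged t (entries (Gen_Word v)) = (if t = Img then eval_words v else [])"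
proof -
  have "tagged t (map (\<lambda>w. (Img, False, w)) ws) = (if t = Img then ws else [])" for ws
    by (induction ws) auto
  then show ?thesis by simp
qed

lemma entries_fresh: "\<forall>(t, d, w)\<in>set (entries i). d \<longleftrightarrow> (\<exists>x\<in>{}. prefix x w)"
  by (cases i) auto

lemma compare_Table:
  assumes "fst ` set T \<subseteq> words k" "snd ` set T \<subseteq> words k"
  shows "compare None (entries (Table T)) =
    (if is_table k T then Some (ideal_class k (ideal_of k (snd ` set T))) else None)"
proof -
  have "compare None (entries (Table T)) \<noteq> None \<longleftrightarrow> is_table k T"
    unfolding compare_defined tagged_entries_Table sorted_wrt_incomparable sorted_wrt_not_strict
    using assms by (auto simp: is_table_def)
  moreover have "c = ideal_class k (ideal_of k (snd ` set T))" if "compare None (entries (Table T)) = Some c" for c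
    using compare_count[of _ "\<lambda>_. {}", OF entries_fresh that] ideal_class_ideal_of[of "snd ` set T"] assms
    unfolding tagged_entries_Table by (simp add: min_gens_def)
  ultimately show ?thesis by (cases "compare None (entries (Table T))") auto
qed

lemma compare_Gen_Word:
  assumes "set (eval_words v) \<subseteq> words k"
  shows "compare None (entries (Gen_Word v)) = Some (ideal_class k (ideal_of k (set (eval_words v))))"
proof -
  have "compare None (entries (Gen_Word v)) \<noteq> None"
    unfolding compare_defined tagged_entries_Gen_Word by simp
  then obtain c where c: "compare None (entries (Gen_Word v)) = Some c" by blast
  then have "c = ideal_class k (ideal_of k (set (eval_words v)))"
    using compare_count[of _ "\<lambda>_. {}", OF entries_fresh c] ideal_class_ideal_of[OF _ assms]
    unfolding tagged_entries_Gen_Word by (simp add: min_gens_def)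
  then show ?thesis using c by simp
qed

end

section \<open>Encodings followed by arbitrary text\<close>

abbreviation table_symbols :: "(word \<times> word) list \<Rightarrow> input_symbol list" where
  "table_symbols T \<equiv> concat (map (\<lambda>(p, q). Arg_Mark # map Letter p @ Val_Mark # map Letter q) T)"

definition plain :: "tag \<Rightarrow> word \<Rightarrow> tag \<times> (nat \<times> bool) list \<times> bool \<times> bool" where
  "plain t w = (t, map (\<lambda>a. (a, False)) w, False, False)"

lemma raw_word_plain [simp]: "raw_word (plain t w) = Head t # cells w @ [Tail False False]"
  by (simp add: plain_def comp_def)

lemma entry_of_plain [simp]: "entry_of (plain t w) = (t, False, w)"
  by (simp add: plain_def comp_def)

definition plain_table :: "(word \<times> word) list \<Rightarrow> (tag \<times> (nat \<times> bool) list \<times> bool \<times> bool) list" where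
  "plain_table T = concat (map (\<lambda>(p, q). [plain Arg p, plain Val q]) T)"

text \<open>The text after the first item may be any string starting with a mark, valid or not.
  Uniqueness of the first item in this generality is needed to reject malformed second
  items.\<close>

lemma encode_input_append_eq:
  assumes eq: "encode_input i @ s = encode_input i' @ s'"
    and s: "boundary (map Sym s)" "boundary (map Sym s')"
  shows "i = i' \<and> s = s'"
proof -
  have m: "r = [] \<or> hd r \<in> {Table_Mark, Word_Mark}" if "boundary (map Sym r)" for r
    using that by (cases r) (auto simp: boundary_def is_mark_def)
  show ?thesis
  proof (cases i)
    case (Table T)
    with eq obtain T' where "i' = Table T'" by (cases i') auto
    then show ?thesis using eq Table encode_table_append_eq[of T s T' s'] m s by simp
  next
    case (Gen_Word v)
    with eq obtain v' where "i' = Gen_Word v'" by (cases i') auto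
    moreover have "s = [] \<or> hd s \<notin> range Generator" "s' = [] \<or> hd s' \<notin> range Generator"
      using m[OF s(1)] m[OF s(2)] by auto
    ultimately show ?thesis
      using eq Gen_Word map_marker_append_eq[of Generator v s v' s'] by (simp add: inj_def)
  qed
qed

lemma boundary_encode_input: "boundary (map Sym (encode_input i @ s))"
  by (cases i) (auto simp: boundary_def is_mark_def)

lemma encode_input_symbols:
  "set (encode_input (Table T)) \<subseteq> input_symbols k m \<longleftrightarrow> fst ` set T \<subseteq> words k \<and> snd ` set T \<subseteq> words k"
  "set (encode_input (Gen_Word v)) \<subseteq> input_symbols k m \<longleftrightarrow> set v \<subseteq> {..<m}"
proof -
  have L: "Letter a \<in> input_symbols k m \<longleftrightarrow> a < k" "Generator g \<in> input_symbols k m \<longleftrightarrow> g < m"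
    "Arg_Mark \<in> input_symbols k m" "Val_Mark \<in> input_symbols k m"
    "Table_Mark \<in> input_symbols k m" "Word_Mark \<in> input_symbols k m" for a g
    by (auto simp: input_symbols_def)
  have W: "w \<in> words k \<longleftrightarrow> Letter ` set w \<subseteq> input_symbols k m" for w
    by (auto simp: words_def L)
  have "set (table_symbols T) \<subseteq> input_symbols k m \<longleftrightarrow> (\<forall>(p, q)\<in>set T. p \<in> words k \<and> q \<in> words k)"
    by (induction T) (auto simp: W L)
  then show "set (encode_input (Table T)) \<subseteq> input_symbols k m \<longleftrightarrow> fst ` set T \<subseteq> words k \<and> snd ` set T \<subseteq> words k"
    by (auto simp: L)
  show "set (encode_input (Gen_Word v)) \<subseteq> input_symbols k m \<longleftrightarrow> set v \<subseteq> {..<m}"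
    by (auto simp: L)
qed

context procedure
begin

subsection \<open>Reading the input\<close>

lemma entry_of_plain_table: "map entry_of (plain_table T) = entries (Table T)"
  unfolding plain_table_def by (induction T) auto

lemma feed_Letters:
  "feed Tab_Arg (map Sym (map Letter w)) = (Tab_Arg, cells w)"
  "feed Tab_Val (map Sym (map Letter w)) = (Tab_Val, cells w)"
  by (induction w) auto

lemma feed_entry:
  "feed Tab_Arg (map Sym (map Letter p @ Val_Mark # map Letter q)) =
     (Tab_Val, cells p @ Tail False False # Head Val # cells q)"
  using feed_Letters(1)[of p] feed_Letters(2)[of q] by (simp add: feed_append_eq)

text \<open>A word is closed only when the next symbol shows that it has ended. The output thus lags
  by one \<open>Tail\<close>, which the equation adds on the right and finds on the left.\<close>

lemma feed_Tab_Val: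
  "\<exists>out. feed Tab_Val (map Sym (table_symbols T)) = (Tab_Val, out) \<and>
     out @ [Tail False False] = Tail False False # concat (map raw_word (plain_table T))"
proof (induction T)
  case (Cons e T)
  obtain p q where e: "e = (p, q)" by (cases e) auto
  obtain out where out: "feed Tab_Val (map Sym (table_symbols T)) = (Tab_Val, out)"
     "out @ [Tail False False] = Tail False False # concat (map raw_word (plain_table T))"
    using Cons.IH by blast
  from feed_append[OF feed_entry out(1), of p q]
  have "feed Tab_Val (map Sym (table_symbols (e # T))) =
      (Tab_Val, Tail False False # Head Arg # (cells p @ Tail False False # Head Val # cells q) @ out)"
    by (simp add: e)
  then show ?case using out(2) by (simp add: e plain_table_def)
qed (simp add: plain_table_def)

lemma symbols_no_mark: "\<forall>x\<in>set s. \<not> is_mark x \<Longrightarrow> \<forall>y\<in>set (map Sym s). \<not> marks_item y"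
  by auto

lemma table_symbols_no_mark: "\<forall>x\<in>set (table_symbols T). \<not> is_mark x"
  by (auto simp: is_mark_def)

lemma step_Start [simp]:
  "step (r, Start) (Some (Sym Table_Mark)) = ((r, Tab), [])"
  "step (r, Start) (Some (Sym Word_Mark)) = ((r, Wrd), [])"
  by (simp_all add: step_eq is_mark_def)

lemma pass_Table:
  assumes "boundary rest"
  shows "pass (r, Start) (map Sym (encode_input (Table T)) @ rest) =
    ((r, Pick None), concat (map raw_word (plain_table T)) @ rest)"
proof (cases T)
  case Nil
  then show ?thesis
    using pass_boundary[OF assms, of Tab "Pick None" "[]" r]
    by (simp add: regular_def skip_def plain_table_def)
next
  case (Cons e T')
  obtain p q where e: "e = (p, q)" by (cases e) auto
  obtain out where out: "feed Tab_Val (map Sym (table_symbols T')) = (Tab_Val, out)"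
     "out @ [Tail False False] = Tail False False # concat (map raw_word (plain_table T'))"
    using feed_Tab_Val by blast
  from feed_append[OF feed_entry out(1), of p q]
  have f: "feed Tab (map Sym (table_symbols T)) =
      (Tab_Val, Head Arg # (cells p @ Tail False False # Head Val # cells q) @ out)"
    by (simp add: e Cons)
  have b: "pass (r, Tab_Val) rest = ((r, Pick None), [Tail False False] @ rest)"
    by (rule pass_boundary[OF assms]) (auto simp: regular_def skip_def)
  have "pass (r, Tab) (map Sym (table_symbols T) @ rest) = ((r, Pick None),
      ((Head Arg # (cells p @ Tail False False # Head Val # cells q) @ out) @ [Tail False False]) @ rest)"
    by (rule pass_feed_rest[OF f symbols_no_mark[OF table_symbols_no_mark] b])
  then show ?thesis using out(2) by (simp add: e Cons plain_table_def)
qed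

lemma pass_Gen_Word:
  assumes "boundary rest"
  shows "pass (r, Start) (map Sym (encode_input (Gen_Word v)) @ rest) =
    ((r, Eval), map (Sym \<circ> Generator) v @ concat (map image_word [[]]) @ rest)"
proof -
  have f: "feed Wrd (map Sym (map Generator v)) = (Wrd, map Sym (map Generator v))" by (induction v) auto
  have b: "pass (r, Wrd) rest = ((r, Eval), image_word [] @ rest)"
    by (rule pass_boundary[OF assms]) (auto simp: regular_def skip_def)
  have "\<forall>x\<in>set (map Generator v). \<not> is_mark x" by (auto simp: is_mark_def)
  from pass_feed_rest[OF f symbols_no_mark[OF this] b] show ?thesis by simp
qed

text \<open>Both states are treated together because reading alternates between them. Stopping in
  \<open>Tab_Arg\<close> means an argument without value, which is rejected at the end of the
  item.\<close>

lemma table_dichotomy: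
  "(\<exists>q T. s = map Letter q @ table_symbols T) \<or> fst (feed Tab_Val (map Sym s)) \<in> {Verdict False, Tab_Arg}"
  "(\<exists>p q T. s = map Letter p @ Val_Mark # map Letter q @ table_symbols T) \<or>
     fst (feed Tab_Arg (map Sym s)) \<in> {Verdict False, Tab_Arg}"
proof (induction s)
  case Nil
  {
    case 1
    show ?case by (intro disjI1 exI[of _ "[]"]) simp
  next
    case 2
    show ?case by simp
  }
next
  case (Cons x s)
  {
    case 1
    show ?case
    proof (cases x)
      case (Letter a)
      show ?thesis using Cons(1)
      proof
        assume "\<exists>q T. s = map Letter q @ table_symbols T"
        then obtain q T where "s = map Letter q @ table_symbols T" by blast
        then have "x # s = map Letter (a # q) @ table_symbols T" using Letter by simp
        then show ?thesis by blast
      qed (simp add: Letter case_prod_beta)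
    next
      case Arg_Mark
      show ?thesis using Cons(2)
      proof
        assume "\<exists>p q T. s = map Letter p @ Val_Mark # map Letter q @ table_symbols T"
        then obtain p q T where "s = map Letter p @ Val_Mark # map Letter q @ table_symbols T" by blast
        then have "x # s = map Letter [] @ table_symbols ((p, q) # T)" using Arg_Mark by simp
        then show ?thesis by blast
      qed (simp add: Arg_Mark case_prod_beta)
    qed (simp_all add: feed_Verdict case_prod_beta)
  next
    case 2
    show ?case
    proof (cases x)
      case (Letter a)
      show ?thesis using Cons(2)
      proof
        assume "\<exists>p q T. s = map Letter p @ Val_Mark # map Letter q @ table_symbols T"
        then obtain p q T where "s = map Letter p @ Val_Mark # map Letter q @ table_symbols T" by blast
        then have "x # s = map Letter (a # p) @ Val_Mark # map Letter q @ table_symbols T" using Letter by simp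
        then show ?thesis by blast
      qed (simp add: Letter case_prod_beta)
    next
      case Val_Mark
      show ?thesis using Cons(1)
      proof
        assume "\<exists>q T. s = map Letter q @ table_symbols T"
        then obtain q T where "s = map Letter q @ table_symbols T" by blast
        then have "x # s = map Letter [] @ Val_Mark # map Letter q @ table_symbols T" using Val_Mark by simp
        then show ?thesis by blast
      qed (simp add: Val_Mark case_prod_beta)
    qed (simp_all add: feed_Verdict case_prod_beta)
  }
qed

lemma Tab_dichotomy:
  "(\<exists>T. s = table_symbols T) \<or> fst (feed Tab (map Sym s)) \<in> {Verdict False, Tab_Arg}"
proof (cases s)
  case Nil
  then show ?thesis by (intro disjI1 exI[of _ "[]"]) simp
next
  case (Cons x s')
  show ?thesis
  proof (cases x)
    case Arg_Mark
    show ?thesis using table_dichotomy(2)[of s']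
    proof
      assume "\<exists>p q T. s' = map Letter p @ Val_Mark # map Letter q @ table_symbols T"
      then obtain p q T where "s' = map Letter p @ Val_Mark # map Letter q @ table_symbols T" by blast
      then have "s = table_symbols ((p, q) # T)" using Arg_Mark Cons by simp
      then show ?thesis by blast
    qed (simp add: Cons Arg_Mark case_prod_beta)
  qed (simp_all add: Cons feed_Verdict case_prod_beta)
qed

lemma Wrd_dichotomy: "(\<exists>v. s = map Generator v) \<or> fst (feed Wrd (map Sym s)) = Verdict False"
proof (induction s)
  case (Cons x s)
  show ?case
  proof (cases x)
    case (Generator g)
    show ?thesis using Cons.IH
    proof
      assume "\<exists>v. s = map Generator v"
      then obtain v where "s = map Generator v" by blast
      then have "x # s = map Generator (g # v)" using Generator by simp
      then show ?thesis by (intro disjI1 exI[of _ "g # v"])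
    qed (simp add: Generator case_prod_beta)
  qed (simp_all add: feed_Verdict case_prod_beta)
qed simp

text \<open>Cutting at the next mark isolates the body of the item; a syntax error in it shows
  within the first pass, so later passes deal with well-formed items only.\<close>

lemma parse_item:
  "(\<exists>i rest. s = encode_input i @ rest \<and> boundary (map Sym rest)) \<or>
   fst (pass (r, Start) (map Sym s)) = (r, Verdict False)"
proof (cases s)
  case Nil
  then show ?thesis by (simp add: step_eq)
next
  case (Cons x s')
  define body where "body = takeWhile (\<lambda>x. \<not> is_mark x) s'"
  define rest where "rest = dropWhile (\<lambda>x. \<not> is_mark x) s'"
  have s': "s' = body @ rest" by (simp add: body_def rest_def)
  have bd: "boundary (map Sym rest)"
    using hd_dropWhile[of "\<lambda>x. \<not> is_mark x" s'] unfolding rest_def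
    by (cases "dropWhile (\<lambda>x. \<not> is_mark x) s'") (auto simp: boundary_def)
  have body: "\<forall>y\<in>set (map Sym body). \<not> marks_item y"
    unfolding body_def by (fastforce dest: set_takeWhileD)
  consider (table) "x = Table_Mark" | (word) "x = Word_Mark" | (other) "\<not> is_mark x" by (auto simp: is_mark_def)
  then show ?thesis
  proof cases
    case table
    show ?thesis using Tab_dichotomy[of body]
    proof
      assume "\<exists>T. body = table_symbols T"
      then obtain T where "body = table_symbols T" by blast
      then have "s = encode_input (Table T) @ rest" using Cons table s' by simp
      then show ?thesis using bd by blast
    next
      assume "fst (feed Tab (map Sym body)) \<in> {Verdict False, Tab_Arg}"
      moreover have "fst (pass (r, Tab_Arg) (map Sym rest)) = (r, Verdict False)"
        by (rule pass_boundary_fail[OF bd]) (auto simp: regular_def)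
      ultimately have "fst (pass (r, Tab) (map Sym body @ map Sym rest)) = (r, Verdict False)"
        using pass_append[OF body, of r Tab "map Sym rest"] by (auto simp: pass_Verdict)
      then show ?thesis using Cons table s' by simp
    qed
  next
    case word
    show ?thesis using Wrd_dichotomy[of body]
    proof
      assume "\<exists>v. body = map Generator v"
      then obtain v where "body = map Generator v" by blast
      then have "s = encode_input (Gen_Word v) @ rest" using Cons word s' by simp
      then show ?thesis using bd by blast
    next
      assume "fst (feed Wrd (map Sym body)) = Verdict False"
      then have "fst (pass (r, Wrd) (map Sym body @ map Sym rest)) = (r, Verdict False)"
        using pass_append[OF body, of r Wrd "map Sym rest"] by (auto simp: pass_Verdict)
      then show ?thesis using Cons word s' by simp
    qed
  next
    case other
    then show ?thesis using Cons by (simp add: step_inner pass_Verdict)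
  qed
qed

subsection \<open>Size bounds\<close>

definition gens_bound :: nat where
  "gens_bound = (\<Sum>g<m. length (gens g))"

definition img_bound :: nat where
  "img_bound = (\<Sum>g<m. \<Sum>p\<in>set (gens g). length (img g p))"

text \<open>The product is the constant in \<open>length_eval\<close>. The summand 2 makes room for
  the unread generators and the following text, and for tables, whose list of words is at most twice
  as long as their encoding.\<close>

definition size_factor :: nat where
  "size_factor = (1 + gens_bound) * (img_bound + 2) + 2"

lemma length_gens: "g < m \<Longrightarrow> length (gens g) \<le> gens_bound"
  unfolding gens_bound_def by (rule member_le_sum) auto

lemma length_img:
  assumes "g < m" "p \<in> set (gens g)"
  shows "length (img g p) \<le> img_bound"
proof -
  have "length (img g p) \<le> (\<Sum>p\<in>set (gens g). length (img g p))"
    using assms(2) by (intro member_le_sum) auto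
  also have "\<dots> \<le> img_bound"
    unfolding img_bound_def using assms(1) by (intro member_le_sum[of g "{..<m}"]) auto
  finally show ?thesis .
qed

lemma foldr_act_bounds:
  assumes "set gs \<subseteq> {..<m}"
  shows "length (foldr act gs [[]]) \<le> 1 + length gs * gens_bound"
    and "\<And>w. w \<in> set (foldr act gs [[]]) \<Longrightarrow> length w \<le> length gs * img_bound"
proof -
  have "length (foldr act gs [[]]) \<le> 1 + length gs * gens_bound \<and>
      (\<forall>w\<in>set (foldr act gs [[]]). length w \<le> length gs * img_bound)"
    using assms
  proof (induction gs)
    case (Cons g gs)
    let ?ws = "foldr act gs [[]]"
    have g: "g < m" and IH: "length ?ws \<le> 1 + length gs * gens_bound"
      "\<And>w. w \<in> set ?ws \<Longrightarrow> length w \<le> length gs * img_bound"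
      using Cons by auto
    have "length (act g ?ws) \<le> length ?ws + length (gens g)"
      unfolding act_def by (rule length_apply_words)
    moreover have "length w \<le> length gs * img_bound + img_bound" if w: "w \<in> set (act g ?ws)" for w
    proof -
      have "w \<in> set (apply_words (gens g) (img g) (gens g) ?ws)" using w by (simp only: act_def[of g ?ws])
      from apply_words_letter_bound[OF subset_refl length_img[OF g] IH(2) this] show ?thesis .
    qed
    ultimately show ?case using IH(1) length_gens[OF g] by (simp add: algebra_simps)
  qed simp
  then show "length (foldr act gs [[]]) \<le> 1 + length gs * gens_bound"
    "\<And>w. w \<in> set (foldr act gs [[]]) \<Longrightarrow> length w \<le> length gs * img_bound" by auto
qed

lemma length_image_words:
  assumes "\<And>w. w \<in> set ws \<Longrightarrow> length w \<le> M"
  shows "length (concat (map image_word ws)) \<le> length ws * (M + 2)"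
  using assms by (induction ws) (fastforce simp: image_word_def)+

lemma length_eval:
  assumes "set gs \<subseteq> {..<m}" "length gs \<le> n"
  shows "length (concat (map image_word (foldr act gs [[]]))) \<le> (1 + gens_bound) * (img_bound + 2) * (n + 1) ^ 2"
proof -
  have "length (concat (map image_word (foldr act gs [[]]))) \<le>
      length (foldr act gs [[]]) * (length gs * img_bound + 2)"
    by (rule length_image_words) (rule foldr_act_bounds(2)[OF assms(1)])
  also have "\<dots> \<le> (1 + length gs * gens_bound) * (length gs * img_bound + 2)"
    by (rule mult_right_mono[OF foldr_act_bounds(1)[OF assms(1)]]) simp
  also have "\<dots> \<le> ((1 + gens_bound) * (n + 1)) * ((img_bound + 2) * (n + 1))"
  proof (rule mult_mono)
    have "length gs * gens_bound \<le> n * gens_bound" using assms(2) by simp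
    moreover have "(1 + gens_bound) * (n + 1) = 1 + n * gens_bound + n + gens_bound" by (simp add: algebra_simps)
    ultimately show "1 + length gs * gens_bound \<le> (1 + gens_bound) * (n + 1)" by linarith
    have "length gs * img_bound \<le> n * img_bound" using assms(2) by simp
    moreover have "(img_bound + 2) * (n + 1) = n * img_bound + 2 * n + img_bound + 2" by (simp add: algebra_simps)
    ultimately show "length gs * img_bound + 2 \<le> (img_bound + 2) * (n + 1)" by linarith
  qed simp_all
  also have "\<dots> = (1 + gens_bound) * (img_bound + 2) * (n + 1) ^ 2"
    by (simp add: power2_eq_square algebra_simps)
  finally show ?thesis .
qed

lemma weight_Table: "sum_list (map weight (entries (Table T))) \<le> 2 * length (encode_input (Table T))"
proof -
  have "sum_list (map weight (entries (Table T))) \<le> 2 * length (table_symbols T)"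
    by (induction T) auto
  then show ?thesis by simp
qed

lemma weight_image_words: "sum_list (map weight (map (\<lambda>w. (Img, False, w)) ws)) = length (concat (map image_word ws))"
  by (induction ws) (auto simp: image_word_def)

text \<open>A product takes one pass to parse, \<open>length v + 1\<close> passes to evaluate and at
  most \<open>N\<close> to compare; a table skips the evaluation. As
  \<open>length v \<le> N\<close>, both cases fit into \<open>2 * N + 2\<close>.\<close>

lemma item_run:
  assumes rest: "boundary (map Sym rest)" and i: "set (encode_input i) \<subseteq> input_symbols k m"
    and len: "length (encode_input i @ rest) \<le> l" and N: "N = size_factor * (l + 1) ^ 2" and B: "2 * N + 2 \<le> B"
    and cont: "case compare None (entries i) of Some c \<Rightarrow> run B n (r, Pick c) (map Sym rest) b | None \<Rightarrow> \<not> b"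
  shows "run B (n + 2 * N + 2) (r, Start) (map Sym (encode_input i @ rest)) b"
proof -
  have sq: "l \<le> (l + 1) ^ 2" by (simp add: power2_eq_square)
  have "2 * (l + 1) ^ 2 \<le> N" unfolding N size_factor_def by (intro mult_right_mono) auto
  then have lN: "2 * l \<le> N" using sq by linarith
  show ?thesis
  proof (cases i)
    case (Table T)
    let ?rs = "plain_table T"
    have w: "sum_list (map weight (map entry_of ?rs)) + length (map Sym rest) \<le> N"
      using weight_Table[of T] len lN unfolding entry_of_plain_table by (simp add: Table)
    have "run B (n + sum_list (map weight (map entry_of ?rs))) (r, Pick None)
        (concat (map raw_word ?rs) @ map Sym rest) b"
      by (rule compare_run[OF rest w B]) (use cont in \<open>simp add: entry_of_plain_table Table\<close>)
    then have "run B (n + N) (r, Pick None) (concat (map raw_word ?rs) @ map Sym rest) b"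
      by (rule run_mono) (use w in simp_all)
    moreover have "length (concat (map raw_word ?rs) @ map Sym rest) \<le> B"
      using length_raw_words[of ?rs] w B by simp
    moreover have "length (map Sym (encode_input (Table T)) @ map Sym rest) \<le> B"
      using len lN B unfolding Table by simp
    ultimately have "run B (Suc (n + N)) (r, Start) (map Sym (encode_input (Table T)) @ map Sym rest) b"
      by (intro run_pass[OF pass_Table[OF rest]]) (simp_all add: skip_def)
    then have "run B (n + 2 * N + 2) (r, Start) (map Sym (encode_input (Table T)) @ map Sym rest) b"
      by (rule run_mono) auto
    then show ?thesis unfolding Table map_append .
  next
    case (Gen_Word v)
    let ?ws = "eval_words v"
    let ?rs = "map (plain Img) ?ws"
    have v: "set v \<subseteq> {..<m}" using i unfolding Gen_Word encode_input_symbols .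
    have lv: "length v + length rest + 1 \<le> l" using len by (simp add: Gen_Word)
    have bound: "length v + length (concat (map image_word (foldr act gs [[]]))) + length (map Sym rest) \<le> N"
      if "suffix gs v" for gs
    proof -
      have "set gs \<subseteq> {..<m}" "length gs \<le> l"
        using that v lv suffix_length_le[OF that] set_mono_suffix[OF that] by auto
      from length_eval[OF this] show ?thesis
        using lv sq unfolding N size_factor_def by (simp add: algebra_simps)
    qed
    have ent: "map entry_of ?rs = entries (Gen_Word v)" by (simp add: comp_def)
    have raw: "concat (map raw_word ?rs) = concat (map image_word ?ws)"
    proof -
      have "raw_word \<circ> plain Img = image_word" by (rule ext) (simp add: image_word_def)
      then show ?thesis by simp
    qed
    have w: "sum_list (map weight (map entry_of ?rs)) + length (map Sym rest) \<le> N"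
    proof -
      have "sum_list (map weight (map entry_of ?rs)) = length (concat (map image_word ?ws))"
        unfolding ent entries.simps weight_image_words ..
      then show ?thesis using bound[OF suffix_order.refl] unfolding eval_words_def by linarith
    qed
    have "run B (n + sum_list (map weight (map entry_of ?rs))) (r, Pick None)
        (concat (map raw_word ?rs) @ map Sym rest) b"
      by (rule compare_run[OF rest w B]) (use cont in \<open>simp only: ent Gen_Word\<close>)
    then have "run B (n + N) (r, Pick None) (concat (map raw_word ?rs) @ map Sym rest) b"
      by (rule run_mono) (use w in simp_all)
    then have run: "run B (n + N) (r, Pick None) (concat (map image_word (foldr act v [[]])) @ map Sym rest) b"
      unfolding raw unfolding eval_words_def .
    have "run B (n + N + length v + 1) (r, Eval)
        (map (Sym \<circ> Generator) v @ concat (map image_word [[]]) @ map Sym rest) b"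
    proof (rule eval_run[OF rest _ run])
      show "length v + length (concat (map image_word (foldr act gs [[]]))) + length (map Sym rest) \<le> B"
        if "suffix gs v" for gs
        using bound[OF that] B by linarith
    qed
    then have "run B (n + N + N + 1) (r, Eval)
        (map (Sym \<circ> Generator) v @ concat (map image_word [[]]) @ map Sym rest) b"
      by (rule run_mono) (use lv lN in simp_all)
    moreover have "length (map (Sym \<circ> Generator) v @ concat (map image_word [[]]) @ map Sym rest) \<le> B"
      using bound[of "[]"] B by simp
    moreover have "length (map Sym (encode_input (Gen_Word v)) @ map Sym rest) \<le> B"
      using len lN B unfolding Gen_Word by simp
    ultimately have "run B (Suc (n + N + N + 1)) (r, Start) (map Sym (encode_input (Gen_Word v)) @ map Sym rest) b"
      by (intro run_pass[OF pass_Gen_Word[OF rest]]) (simp_all add: skip_def)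
    then have "run B (n + 2 * N + 2) (r, Start) (map Sym (encode_input (Gen_Word v)) @ map Sym rest) b"
      by (rule run_mono) auto
    then show ?thesis unfolding Gen_Word map_append .
  qed
qed

lemma encode_input_not_rejected:
  assumes "boundary (map Sym rest)"
  shows "fst (pass (r, Start) (map Sym (encode_input i @ rest))) \<noteq> (r, Verdict False)"
  using pass_Table[OF assms] pass_Gen_Word[OF assms] by (cases i) (simp_all del: pass.simps)

definition accepted :: "input_symbol list \<Rightarrow> bool" where
  "accepted w \<longleftrightarrow> (\<exists>i j c c'. w = encode_input i @ encode_input j \<and> compare None (entries i) = Some c \<and>
     compare None (entries j) = Some c' \<and> verdict c c')"

lemma second_item_run:
  assumes s: "set s \<subseteq> input_symbols k m" and len: "length s \<le> l"
    and N: "N = size_factor * (l + 1) ^ 2" and B: "2 * N + 2 \<le> B"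
    and b: "b \<longleftrightarrow> (\<exists>j c'. s = encode_input j \<and> compare None (entries j) = Some c' \<and> verdict c c')"
  shows "run B (2 * N + 3) (Some c, Start) (map Sym s) b"
proof -
  have "(l + 1) ^ 2 \<le> N" unfolding N size_factor_def by simp
  moreover have "l \<le> (l + 1) ^ 2" by (simp add: power2_eq_square)
  ultimately have lB: "2 * length (map Sym s) + 2 \<le> B" using len B by simp
  show ?thesis using parse_item[of s "Some c"]
  proof
    assume rej: "fst (pass (Some c, Start) (map Sym s)) = (Some c, Verdict False)"
    have "\<not> b" using encode_input_not_rejected[of "[]" "Some c"] rej b by (auto simp: boundary_def)
    then have "run B (Suc 0) (Some c, Start) (map Sym s) b"
      using run_verdict[OF rej _ lB] by simp
    then show ?thesis by (rule run_mono) auto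
  next
    assume "\<exists>i rest. s = encode_input i @ rest \<and> boundary (map Sym rest)"
    then obtain i rest where i: "s = encode_input i @ rest" "boundary (map Sym rest)" by blast
    have uniq: "s = encode_input j \<longleftrightarrow> j = i \<and> rest = []" for j
      using encode_input_append_eq[of i rest j "[]"] i by (auto simp: boundary_def)
    have "run B (1 + 2 * N + 2) (Some c, Start) (map Sym (encode_input i @ rest)) b"
    proof (rule item_run[OF i(2) _ _ N B])
      show "set (encode_input i) \<subseteq> input_symbols k m" using s i(1) by simp
      show "length (encode_input i @ rest) \<le> l" using len i(1) by simp
      show "case compare None (entries i) of Some c' \<Rightarrow> run B 1 (Some c, Pick c') (map Sym rest) b | None \<Rightarrow> \<not> b"
      proof (cases "compare None (entries i)")
        case None
        then show ?thesis using b uniq by auto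
      next
        case (Some c')
        have "fst (pass (Some c, Pick c') (map Sym rest)) = (Some c, Verdict b)"
        proof (cases rest)
          case Nil
          then show ?thesis using b uniq Some by (simp add: step_eq)
        next
          case (Cons x xs)
          then show ?thesis using b uniq i(2) by (simp add: boundary_def step_eq pass_Verdict)
        qed
        moreover have "2 * length (map Sym rest) + 2 \<le> B" using lB i(1) by simp
        ultimately have "run B (Suc 0) (Some c, Pick c') (map Sym rest) b"
          by (intro run_verdict) auto
        then show ?thesis using Some by simp
      qed
    qed
    then show ?thesis using i(1) by (simp del: run.simps add: numeral_3_eq_3)
  qed
qed

text \<open>The first item takes \<open>2 * N + 2\<close> passes, storing its class takes one, and
  the second item takes \<open>2 * N + 3\<close> including the pass that gives the verdict.\<close>

lemma accepted_run:
  assumes s: "set s \<subseteq> input_symbols k m"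
    and N: "N = size_factor * (length s + 1) ^ 2" and B: "2 * N + 2 \<le> B"
  shows "run B (4 * N + 6) (None, Start) (map Sym s) (accepted s)"
proof -
  have "(length s + 1) ^ 2 \<le> N" unfolding N size_factor_def by simp
  moreover have "length s \<le> (length s + 1) ^ 2" by (simp add: power2_eq_square)
  ultimately have lB: "2 * length (map Sym s) + 2 \<le> B" using B by simp
  show ?thesis using parse_item[of s None]
  proof
    assume rej: "fst (pass (None, Start) (map Sym s)) = (None, Verdict False)"
    have "\<not> accepted s"
    proof
      assume "accepted s"
      then obtain i j where "s = encode_input i @ encode_input j" by (auto simp: accepted_def)
      then show False
        using encode_input_not_rejected[of "encode_input j" None i] boundary_encode_input[of j "[]"] rej by simp
    qed
    then have "run B (Suc 0) (None, Start) (map Sym s) (accepted s)"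
      using run_verdict[OF rej _ lB] by simp
    then show ?thesis by (rule run_mono) auto
  next
    assume "\<exists>i rest. s = encode_input i @ rest \<and> boundary (map Sym rest)"
    then obtain i rest where i: "s = encode_input i @ rest" "boundary (map Sym rest)" by blast
    have acc: "accepted s \<longleftrightarrow> (\<exists>c j c'. compare None (entries i) = Some c \<and>
        rest = encode_input j \<and> compare None (entries j) = Some c' \<and> verdict c c')"
    proof -
      have "s = encode_input i' @ encode_input j \<longleftrightarrow> i' = i \<and> rest = encode_input j" for i' j
        using encode_input_append_eq[of i rest i' "encode_input j"] i boundary_encode_input[of j "[]"] by auto
      then show ?thesis unfolding accepted_def by auto
    qed
    have "run B ((2 * N + 4) + 2 * N + 2) (None, Start) (map Sym (encode_input i @ rest)) (accepted s)"
    proof (rule item_run[OF i(2) _ _ N B])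
      show "set (encode_input i) \<subseteq> input_symbols k m" using s i(1) by simp
      show "length (encode_input i @ rest) \<le> length s" using i(1) by simp
      show "case compare None (entries i) of Some c \<Rightarrow> run B (2 * N + 4) (None, Pick c) (map Sym rest) (accepted s)
          | None \<Rightarrow> \<not> accepted s"
      proof (cases "compare None (entries i)")
        case None
        then show ?thesis using acc by simp
      next
        case (Some c)
        have rB: "2 * length (map Sym rest) + 2 \<le> B" using lB i(1) by simp
        have "run B (2 * N + 4) (None, Pick c) (map Sym rest) (accepted s)"
        proof (cases rest)
          case Nil
          have ne: "[] \<noteq> encode_input j" for j by (cases j) auto
          have "\<not> accepted s" using acc ne unfolding Nil by blast
          moreover have "fst (pass (None, Pick c) (map Sym rest)) = (None, Verdict False)"
            by (simp add: Nil step_eq)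
          ultimately have "run B (Suc 0) (None, Pick c) (map Sym rest) (accepted s)"
            using run_verdict[OF _ _ rB] by simp
          then show ?thesis by (rule run_mono) auto
        next
          case (Cons x xs)
          then have p: "pass (None, Pick c) (map Sym rest) = ((Some c, Start), map Sym rest)"
            using i(2) by (simp add: boundary_def step_eq pass_Skip)
          have "run B (2 * N + 3) (Some c, Start) (map Sym rest) (accepted s)"
            by (rule second_item_run[OF _ _ N B]) (use s i(1) acc Some in auto)
          then have "run B (Suc (2 * N + 3)) (None, Pick c) (map Sym rest) (accepted s)"
            using rB by (intro run_pass[OF p]) (auto simp: skip_def simp del: run.simps)
          then show ?thesis by (rule run_mono) auto
        qed
        then show ?thesis using Some by simp
      qed
    qed
    then have "run B ((2 * N + 4) + 2 * N + 2) (None, Start) (map Sym s) (accepted s)" using i(1) by simp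
    then show ?thesis by (rule run_mono) auto
  qed
qed

theorem accepted_decidable:
  assumes "L \<subseteq> lists (input_symbols k m)" "\<And>w. w \<in> lists (input_symbols k m) \<Longrightarrow> w \<in> L \<longleftrightarrow> accepted w"
  shows "decidable_in_ptime (input_symbols k m) L"
proof (rule decidable_in_ptimeI[OF assms(1)])
  fix w
  assume w: "w \<in> lists (input_symbols k m)"
  let ?x = "(length w + 1) ^ 2"
  have x: "1 \<le> ?x" by simp
  \<comment> \<open>The constant summands 2 and 6 are absorbed into multiples of \<open>?x\<close>
    in the final bounds, which is possible as \<open>?x \<ge> 1\<close>.\<close>
  have "run ((2 * size_factor + 2) * ?x) (4 * (size_factor * ?x) + 6) (None, Start) (map Sym w) (accepted w)"
  proof (rule accepted_run)
    show "set w \<subseteq> input_symbols k m" using w by auto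
    show "2 * (size_factor * ?x) + 2 \<le> (2 * size_factor + 2) * ?x" using x by (simp add: algebra_simps)
  qed simp
  then have "run ((2 * size_factor + 2) * ?x) ((4 * size_factor + 6) * ?x) (None, Start) (map Sym w) (accepted w)"
    by (rule run_mono) (use x in \<open>simp_all add: algebra_simps\<close>)
  then show "run ((2 * size_factor + 2) * ?x) ((4 * size_factor + 6) * ?x) (None, Start) (map Sym w) (w \<in> L)"
    using assms(2)[OF w] by simp
qed

end

section \<open>From classes to the decision problems\<close>

lemma map_empty_iff_ran: "ran u = {} \<longleftrightarrow> u = Map.empty"
  by (auto simp: ran_def fun_eq_iff) (meson not_Some_eq)

lemma encode_input_set:
  assumes "valid_input k m i"
  shows "set (encode_input i) \<subseteq> input_symbols k m"
proof (cases i)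
  case (Table T)
  then show ?thesis using assms unfolding Table encode_input_symbols by (simp add: is_table_def)
next
  case (Gen_Word v)
  then show ?thesis using assms unfolding Gen_Word encode_input_symbols by auto
qed

text \<open>Stated for any relation that factors through the image classes, so that both problems
  are instances.\<close>

theorem class_relation_decidable:
  assumes k: "k \<ge> 2"
    and \<gamma>: "\<And>g. g < m \<Longrightarrow> \<gamma> g \<in> carrier (thompson_higman k)"
    and rel: "\<And>u v. u \<in> carrier (thompson_higman k) \<Longrightarrow> v \<in> carrier (thompson_higman k) \<Longrightarrow>
      rel u v \<longleftrightarrow> R (ideal_class k (ran u)) (ideal_class k (ran v))"
  shows "decidable_in_ptime (input_symbols k m) (relation_problem k m \<gamma> rel)"
proof -
  have hom: "right_ideal_hom k (\<gamma> g)" if "g < m" for g using \<gamma>[OF that] by (simp add: carrier_iff)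
  have "\<exists>ps. set ps \<subseteq> words k \<and> dom (\<gamma> g) = ideal_of k (set ps)" if "g < m" for g
    using homD(1)[OF hom[OF that]] finite_list unfolding fg_right_ideal_def by metis
  \<comment> \<open>The finite data of the generators are fixed once and for all and become part of
    the machine, not of its input.\<close>
  then obtain gens where gens_dom: "\<And>g. g < m \<Longrightarrow> set (gens g) \<subseteq> words k \<and> dom (\<gamma> g) = ideal_of k (set (gens g))"
    by metis
  define img where "img g p = the (\<gamma> g p)" for g p
  have img_eq: "\<gamma> g p = Some (img g p)" if "g < m" "p \<in> set (gens g)" for g p
  proof -
    have "p \<in> dom (\<gamma> g)" using gens_dom[OF that(1)] that(2) subset_ideal_of by blast
    then show ?thesis unfolding img_def by auto
  qed
  interpret procedure k m gens img R
  proof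
    show "img g p \<in> words k" if "g < m" "p \<in> set (gens g)" for g p
      using homD(7)[OF hom[OF that(1)] img_eq[OF that]] .
  qed (use k gens_dom in auto)
  have k1: "k \<ge> 1" using k by simp

  have eval: "set (eval_words v) \<subseteq> words k \<and>
      list_product (thompson_higman k) (map \<gamma> v) \<in> carrier (thompson_higman k) \<and>
      ideal_equiv k (ideal_of k (set (eval_words v))) (ran (list_product (thompson_higman k) (map \<gamma> v)))"
    if "set v \<subseteq> {..<m}" for v
    using that
  proof (induction v)
    case Nil
    have "ran (Some |` words k) = words k" by (auto simp: ran_def restrict_map_def)
    moreover have "ideal_of k {[]} = words k" by (auto simp: ideal_of_def)
    ultimately show ?case using one_in_carrier[of k]
      by (simp add: eval_words_def list_product_def thompson_higman_def ideal_equiv_def dense_in_subset)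
  next
    case (Cons g v)
    let ?ws = "eval_words v" and ?u = "list_product (thompson_higman k) (map \<gamma> v)"
    have g: "g < m" and ws: "set ?ws \<subseteq> words k" and u: "?u \<in> carrier (thompson_higman k)"
      and eq: "ideal_equiv k (ideal_of k (set ?ws)) (ran ?u)"
      using Cons by auto
    have hu: "right_ideal_hom k ?u" using u by (simp add: carrier_iff)
    have e: "eval_words (g # v) = apply_words (gens g) (img g) (gens g) ?ws"
      by (simp add: eval_words_def act_def[of g "foldr act v [[]]"])
    have id: "ideal_of k (set (eval_words (g # v))) = ideal_image (\<gamma> g) (ideal_of k (set ?ws))"
      unfolding e using gens_dom[OF g] img_eq[OF g] by (intro apply_words_ideal[OF hom[OF g] _ _ ws]) auto
    have "ideal_image (\<gamma> g) (ideal_of k (set ?ws)) \<subseteq> words k"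
      using homD(7)[OF hom[OF g]] by (auto simp: ideal_image_def)
    then have "set (eval_words (g # v)) \<subseteq> words k" using id subset_ideal_of by blast
    moreover have p: "list_product (thompson_higman k) (map \<gamma> (g # v)) = \<gamma> g \<otimes>\<^bsub>thompson_higman k\<^esub> ?u"
      by (simp add: list_product_def)
    ultimately show ?case
      unfolding p id using mult_in_carrier[OF hom[OF g] hu] mult_ideal_equiv[OF hom[OF g] hu eq] by blast
  qed

  have input_class: "input_value k \<gamma> i \<in> carrier (thompson_higman k) \<and>
      compare None (entries i) = Some (ideal_class k (ran (input_value k \<gamma> i)))"
    if i: "valid_input k m i" for i
  proof (cases i)
    case (Table T)
    then have T: "is_table k T" using i by simp
    then have w: "fst ` set T \<subseteq> words k" "snd ` set T \<subseteq> words k" by (auto simp: is_table_def)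
    note t = table_hom_props[OF T]
    have e: "hom_equiv k (table_hom k T) (max_ext k (table_hom k T))" using max_ext_equiv[OF t(1)] .
    then have hm: "right_ideal_hom k (max_ext k (table_hom k T))" by (simp add: hom_equiv_iff)
    have "ideal_class k (ran (table_hom k T)) = ideal_class k (ran (max_ext k (table_hom k T)))"
      using ideal_class_cong[OF homD(2)[OF t(1)] homD(2)[OF hm] hom_equiv_ran[OF e] k1] .
    then show ?thesis
      using compare_Table[OF w] T max_ext_in_carrier[OF t(1)] unfolding Table t(2) by simp
  next
    case (Gen_Word v)
    then have "set v \<subseteq> {..<m}" using i by auto
    note v = eval[OF this]
    let ?u = "list_product (thompson_higman k) (map \<gamma> v)"
    have "right_ideal_hom k ?u" using v by (simp add: carrier_iff)
    moreover have "fg_right_ideal k (ideal_of k (set (eval_words v)))"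
      using v unfolding fg_right_ideal_def by blast
    ultimately have "ideal_class k (ideal_of k (set (eval_words v))) = ideal_class k (ran ?u)"
      using ideal_class_cong[OF _ homD(2) _ k1] v by blast
    then show ?thesis using compare_Gen_Word v unfolding Gen_Word by simp
  qed

  \<comment> \<open>Over the input alphabet only tables can be invalid, through violated code
    conditions; these are what the comparison detects.\<close>
  have invalid: "compare None (entries i) = None"
    if "set (encode_input i) \<subseteq> input_symbols k m" "\<not> valid_input k m i" for i
  proof (cases i)
    case (Table T)
    have "fst ` set T \<subseteq> words k" "snd ` set T \<subseteq> words k"
      using that(1) unfolding Table encode_input_symbols by auto
    then show ?thesis using compare_Table[of T] that(2) unfolding Table by simp
  next
    case (Gen_Word v)
    have "set v \<subseteq> {..<m}" using that(1) unfolding Gen_Word encode_input_symbols .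
    then show ?thesis using that(2) unfolding Gen_Word by auto
  qed

  show ?thesis
  proof (rule accepted_decidable)
    show "relation_problem k m \<gamma> rel \<subseteq> lists (input_symbols k m)"
      using encode_input_set unfolding relation_problem_def lists_eq_set by fastforce
    fix w
    assume w: "w \<in> lists (input_symbols k m)"
    show "w \<in> relation_problem k m \<gamma> rel \<longleftrightarrow> accepted w"
    proof
      assume "w \<in> relation_problem k m \<gamma> rel"
      then obtain i j where ij: "w = encode_input i @ encode_input j" "valid_input k m i" "valid_input k m j"
        "rel (input_value k \<gamma> i) (input_value k \<gamma> j)" by (auto simp: relation_problem_def)
      then show "accepted w" unfolding accepted_def using input_class[of i] input_class[of j] rel by blast
    next
      assume "accepted w"
      then obtain i j c c' where ij: "w = encode_input i @ encode_input j" "compare None (entries i) = Some c"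
        "compare None (entries j) = Some c'" "R c c'" by (auto simp: accepted_def)
      have "set (encode_input i) \<subseteq> input_symbols k m" "set (encode_input j) \<subseteq> input_symbols k m"
        using w ij(1) by auto
      then have "valid_input k m i" "valid_input k m j" using invalid ij(2,3) by fastforce+
      moreover from this have "rel (input_value k \<gamma> i) (input_value k \<gamma> j)"
        using input_class[of i] input_class[of j] rel ij by simp
      ultimately show "w \<in> relation_problem k m \<gamma> rel" using ij(1) unfolding relation_problem_def by blast
    qed
  qed
qed

theorem proposition4p1:
  fixes k :: nat and \<Gamma> :: "word_map set" and \<gamma> :: "nat \<Rightarrow> word_map"
  assumes "k \<ge> 2"
    and "finite \<Gamma>" and "monoid_generating_set (thompson_higman k) \<Gamma>"
    and "bij_betw \<gamma> {..<card \<Gamma>} \<Gamma>"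
  shows "decidable_in_ptime (input_symbols k (card \<Gamma>))
           (relation_problem k (card \<Gamma>) \<gamma> (J_le (thompson_higman k))) \<and>
         decidable_in_ptime (input_symbols k (card \<Gamma>))
           (relation_problem k (card \<Gamma>) \<gamma> (D_equiv (thompson_higman k)))"
proof
  have \<gamma>: "\<gamma> g \<in> carrier (thompson_higman k)" if "g < card \<Gamma>" for g
    using assms(3,4) that unfolding monoid_generating_set_def bij_betw_def by blast
  \<comment> \<open>The class \<open>None\<close> singles out zero, the only element with empty
    image.\<close>
  have J: "J_le (thompson_higman k) u v \<longleftrightarrow>
      (ideal_class k (ran v) = None \<longrightarrow> ideal_class k (ran u) = None)"
    if "u \<in> carrier (thompson_higman k)" "v \<in> carrier (thompson_higman k)" for u v
    using J_le_iff[OF that] by (simp add: ideal_class_def map_empty_iff_ran)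
  show "decidable_in_ptime (input_symbols k (card \<Gamma>))
           (relation_problem k (card \<Gamma>) \<gamma> (J_le (thompson_higman k)))"
    by (rule class_relation_decidable[where R = "\<lambda>c c'. c' = None \<longrightarrow> c = None", OF assms(1) \<gamma> J])
  have D: "D_equiv (thompson_higman k) u v \<longleftrightarrow> ideal_class k (ran u) = ideal_class k (ran v)"
    if "u \<in> carrier (thompson_higman k)" "v \<in> carrier (thompson_higman k)" for u v
    using D_equiv_iff[OF that] assms(1) by simp
  show "decidable_in_ptime (input_symbols k (card \<Gamma>))
           (relation_problem k (card \<Gamma>) \<gamma> (D_equiv (thompson_higman k)))"
    by (rule class_relation_decidable[where R = "(=)", OF assms(1) \<gamma> D])
qed

end
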